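(* Let $G$ be the ample groupoid attached to a contracting self-similar group. Then $J=\{0\}$ if and only if $J_{\mathbb{C}}=\{0\}$ if and only if $G$ does not satisfy condition $(\mathcal{S}_0)$.
   Context: Self-similar groups. Let $A$ be a finite alphabet and $T=A^*$ the rooted tree of finite words in $A$, with $\ell(\cdot)$ word length. A self-similar group is a subgroup $\Gamma$ of the automorphism group of $T$ such that for all $\gamma\in\Gamma$ and $x\in T$ there is $\gamma|_x\in\Gamma$ with $\gamma(xw)=\gamma(x)\,\gamma|_x(w)$ for all $w\in T$. It is contracting if there is a finite subset $N\subseteq\Gamma$ such that for all $\gamma\in\Gamma$ there is $l\in\mathbb{N}$ such that $\gamma|_u\in N$ for all $u\in T$ with $\ell(u)\ge l$. Attached groupoid. Let $X=\partial T$ be the space of infinite words in $A$ (product topology). For $u,v\in T$, $\gamma\in\Gamma$, $u\gamma v^*$ denotes the partial bijection $vT\to uT$, $vw\mapsto u\gamma(w)$, and also the induced partial homeomorphism $vX\to uX$; these, together with the nowhere defined map, form an inverse semigroup $S$. $G$ is the groupoid of germs of the action of $S$ on $X$: elements are classes $[u\gamma v^*,\omega]$ with $\omega\in vX$, where $[u_1\gamma_1v_1^*,\omega_1]=[u_2\gamma_2v_2^*,\omega_2]$ iff $\omega_1=\omega_2$ and there is a finite prefix $w=v_1z_1=v_2z_2$ of $\omega_1$ with $u_1\gamma_1(z_1)=u_2\gamma_2(z_2)$ and $\gamma_1|_{z_1}=\gamma_2|_{z_2}$. Source of $[\sigma,\omega]$ is $\omega$, range is $\sigma(\omega)$, $[\sigma,\tau(\omega)][\tau,\omega]=[\sigma\tau,\omega]$,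 the unit space is identified with $X$, and a basis for the topology is given by the sets $\{[\sigma,\omega]:\omega\in W\}$ for $\sigma\in S$ and $W$ an open subset of the domain of $\sigma$. $G$ is an ample groupoid (étale with totally disconnected Hausdorff unit space), possibly non-Hausdorff. Write $r,s$ for range and source and $G_x=s^{-1}(x)$. Algebras and singular ideals. An open bisection is an open $U\subseteq G$ on which $r$ and $s$ are injective. $C_c(U)$ is the set of continuous functions $U\to\mathbb{C}$ with compact support in $U$, extended by zero to $G$; $\mathcal{C}_c(G)$ is the linear span of all $C_c(U)$, a $*$-algebra under $f^*(g)=\overline{f(g^{-1})}$ and convolution. For $x\in X$, $\pi_x\colon\mathcal{C}_c(G)\to\mathcal{L}(\ell^2(G_x))$ is $\pi_x(f)\xi=f*\xi$; $C^*_r(G)$ is the completion of $\mathcal{C}_c(G)$ in the norm $\sup_{x}\|\pi_x(f)\|$. Elements $f\in C^*_r(G)$ are viewed as functions on $G$ via $f(g)=\langle\pi_{s(g)}(f)\delta_{s(g)},\delta_g\rangle$. The complex Steinberg algebra $\mathbb{C}G$ is the span of the indicator functions of compact open bisections. With $\mathrm{supp}^\circ(f)=\{f\neq0\}$, set $J=\{f\in C^*_r(G):s(\mathrm{supp}^\circ(f))\text{ has empty interior}\}$ and $J_{\mathbb{C}}=\{f\in\mathbb{C}G:\mathrm{supp}^\circ(f)\text{ has empty interior}\}$. Condition $(\mathcal{S}_0)$: there exist a positive integer $n$ and open bisections $U_1,\dots,U_n\subseteq G$ such that (1) $s(U_i)=s(U_j)$ for all $1\le i,j\le n$; (2) $U_i\setminus\bigcup_{j\neq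 i}U_j$ is non-empty and has empty interior for all $1\le i\le n$; (3) $\mathrm{span}_{\mathbb{Q}}\{b_I: I\subseteq\{1,\dots,n\},\ \#I>1,\ (\bigcap_{i\in I}U_i)\setminus(\bigcup_{j\notin I}U_j)\neq\emptyset\}\neq\mathbb{Q}^n$, where $b_I=\sum_{i\in I}b_i$ and $b_i$ is the $i$-th standard basis vector of $\mathbb{Q}^n$. *)

theory Defs
  imports "HOL-Analysis.Analysis" "HOL-Algebra.Group"
    "HOL-Library.Function_Algebras" "HOL-Library.Omega_Words_Fun"
begin

section \<open>Self-similar groups\<close>

text \<open>
  The tree over the alphabet \<open>'a\<close> has the finite words as vertices, the empty word as root, and
  an edge between \<open>w\<close> and \<open>w @ [a]\<close> for every word \<open>w\<close> and letter \<open>a\<close>.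
\<close>

definition tree_adj :: "'a list \<Rightarrow> 'a list \<Rightarrow> bool" where
  "tree_adj u v \<longleftrightarrow> (\<exists>a. v = u @ [a] \<or> u = v @ [a])"

definition tree_Aut :: "('a list \<Rightarrow> 'a list) monoid" where
  "tree_Aut = \<lparr>carrier = {g. bij g \<and> g [] = [] \<and> (\<forall>u v. tree_adj (g u) (g v) \<longleftrightarrow> tree_adj u v)},
               mult = (\<circ>), one = id\<rparr>"

lemma group_tree_Aut: "group (tree_Aut :: ('a list \<Rightarrow> 'a list) monoid)"
proof (rule groupI)
  fix g :: "'a list \<Rightarrow> 'a list" assume g: "g \<in> carrier tree_Aut"
  then have b: "bij g" by (simp add: tree_Aut_def)
  have i1: "inv_into UNIV g (g x) = x" for x using b by (simp add: bij_is_inj)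
  have i2: "g (inv_into UNIV g x) = x" for x using b by (simp add: bij_is_surj surj_f_inv_f)
  have "inv_into UNIV g [] = []"
    using g i1[of "[]"] by (simp add: tree_Aut_def)
  moreover have "tree_adj (inv_into UNIV g u) (inv_into UNIV g v) \<longleftrightarrow> tree_adj u v" for u v
  proof -
    have "tree_adj (g (inv_into UNIV g u)) (g (inv_into UNIV g v)) \<longleftrightarrow>
          tree_adj (inv_into UNIV g u) (inv_into UNIV g v)"
      using g by (simp add: tree_Aut_def)
    then show ?thesis by (simp only: i2)
  qed
  ultimately have "inv_into UNIV g \<in> carrier tree_Aut"
    using b by (simp add: tree_Aut_def bij_imp_bij_inv)
  moreover have "inv_into UNIV g \<circ> g = id" using b by (simp add: bij_is_inj)
  ultimately show "\<exists>h\<in>carrier tree_Aut. h \<otimes>\<^bsub>tree_Aut\<^esub> g = \<one>\<^bsub>tree_Aut\<^esub>"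
    by (intro bexI[of _ "inv_into UNIV g"]) (simp_all add: tree_Aut_def)
qed (auto simp: tree_Aut_def bij_comp comp_assoc)

definition self_similar :: "('a list \<Rightarrow> 'a list) set \<Rightarrow> bool" where
  "self_similar \<Gamma> \<longleftrightarrow> subgroup \<Gamma> tree_Aut \<and>
     (\<forall>\<gamma>\<in>\<Gamma>. \<forall>x. \<exists>\<delta>\<in>\<Gamma>. \<forall>w. \<gamma> (x @ w) = \<gamma> x @ \<delta> w)"

text \<open>
  The section \<open>\<gamma>|\<^sub>x\<close>: the defining equation \<open>\<gamma> (x @ w) = \<gamma> x @ \<gamma>|\<^sub>x w\<close> determines it uniquely.
\<close>

definition sect :: "('a list \<Rightarrow> 'a list) \<Rightarrow> 'a list \<Rightarrow> 'a list \<Rightarrow> 'a list" where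
  "sect \<gamma> x = (\<lambda>w. drop (length (\<gamma> x)) (\<gamma> (x @ w)))"

lemma sect_eq:
  assumes "\<And>w. \<gamma> (x @ w) = \<gamma> x @ \<delta> w"
  shows "sect \<gamma> x = \<delta>"
  by (simp add: sect_def assms)

definition contracting :: "('a list \<Rightarrow> 'a list) set \<Rightarrow> bool" where
  "contracting \<Gamma> \<longleftrightarrow>
     (\<exists>N\<subseteq>\<Gamma>. finite N \<and> (\<forall>\<gamma>\<in>\<Gamma>. \<exists>l. \<forall>u. length u \<ge> l \<longrightarrow> sect \<gamma> u \<in> N))"


section \<open>Groupoids with a topology\<close>

text \<open>
  The unit space is a separate topological space (of type \<open>'x\<close>), identified with the set of unit
  arrows through \<open>idn\<close>.  The product \<open>comp G g h\<close> is meaningful for arrows with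
  \<open>src G g = rng G h\<close>.
\<close>

record ('g, 'x) top_groupoid =
  arr :: "'g topology"
  base :: "'x topology"
  src :: "'g \<Rightarrow> 'x"
  rng :: "'g \<Rightarrow> 'x"
  idn :: "'x \<Rightarrow> 'g"
  comp :: "'g \<Rightarrow> 'g \<Rightarrow> 'g"

definition fibre :: "('g, 'x) top_groupoid \<Rightarrow> 'x \<Rightarrow> 'g set" where
  "fibre G x = {g \<in> topspace (arr G). src G g = x}"

definition open_bisection :: "('g, 'x) top_groupoid \<Rightarrow> 'g set \<Rightarrow> bool" where
  "open_bisection G U \<longleftrightarrow> openin (arr G) U \<and> inj_on (rng G) U \<and> inj_on (src G) U"


section \<open>The groupoid attached to a self-similar group\<close>

text \<open>
  The triple \<open>(u, \<gamma>, v)\<close> stands for the partial bijection \<open>u\<gamma>v\<^sup>*\<close>, which maps \<open>v @ w\<close> to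
  \<open>u @ \<gamma> w\<close>.  Different triples give different partial bijections of the tree, and the triples
  with \<open>\<gamma> \<in> \<Gamma>\<close> are exactly the nonzero elements of the inverse semigroup.  Its zero, the nowhere
  defined map, has no germs and contributes only the empty basic open set.
\<close>

type_synonym 'a triple = "'a list \<times> ('a list \<Rightarrow> 'a list) \<times> 'a list"

fun pbij :: "'a triple \<Rightarrow> 'a list \<rightharpoonup> 'a list" where
  "pbij (u, \<gamma>, v) x = (if \<exists>w. x = v @ w then Some (u @ \<gamma> (drop (length v) x)) else None)"

definition triples :: "('a list \<Rightarrow> 'a list) set \<Rightarrow> 'a triple set" where
  "triples \<Gamma> = {(u, \<gamma>, v) | u \<gamma> v. \<gamma> \<in> \<Gamma>}"

text \<open>The induced partial homeomorphism of the space of infinite words.\<close>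

definition bd_map :: "('a list \<Rightarrow> 'a list) \<Rightarrow> 'a word \<Rightarrow> 'a word" where
  "bd_map \<gamma> \<omega> = (\<lambda>n. \<gamma> (prefix (Suc n) \<omega>) ! n)"

fun bd_dom :: "'a triple \<Rightarrow> 'a word set" where
  "bd_dom (u, \<gamma>, v) = {v \<frown> \<omega> | \<omega>. True}"

fun bd_act :: "'a triple \<Rightarrow> 'a word \<Rightarrow> 'a word" where
  "bd_act (u, \<gamma>, v) \<omega> = u \<frown> bd_map \<gamma> (suffix (length v) \<omega>)"

definition word_space :: "'a word topology" where
  "word_space = product_topology (\<lambda>_. discrete_topology UNIV) UNIV"

definition germ_rel ::
    "('a list \<Rightarrow> 'a list) set \<Rightarrow> (('a triple \<times> 'a word) \<times> ('a triple \<times> 'a word)) set" where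
  "germ_rel \<Gamma> = {(((u1, \<gamma>1, v1), \<omega>1), ((u2, \<gamma>2, v2), \<omega>2)) | u1 \<gamma>1 v1 \<omega>1 u2 \<gamma>2 v2 \<omega>2.
     \<gamma>1 \<in> \<Gamma> \<and> \<gamma>2 \<in> \<Gamma> \<and> \<omega>1 \<in> bd_dom (u1, \<gamma>1, v1) \<and> \<omega>2 \<in> bd_dom (u2, \<gamma>2, v2) \<and>
     \<omega>1 = \<omega>2 \<and>
     (\<exists>w z1 z2 \<eta>. \<omega>1 = w \<frown> \<eta> \<and> w = v1 @ z1 \<and> w = v2 @ z2 \<and>
        u1 @ \<gamma>1 z1 = u2 @ \<gamma>2 z2 \<and> sect \<gamma>1 z1 = sect \<gamma>2 z2)}"

type_synonym 'a germ = "('a triple \<times> 'a word) set"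

definition germ :: "('a list \<Rightarrow> 'a list) set \<Rightarrow> 'a triple \<Rightarrow> 'a word \<Rightarrow> 'a germ" where
  "germ \<Gamma> \<sigma> \<omega> = germ_rel \<Gamma> `` {(\<sigma>, \<omega>)}"

definition germ_top :: "('a list \<Rightarrow> 'a list) set \<Rightarrow> 'a germ topology" where
  "germ_top \<Gamma> = topology_generated_by
     {{germ \<Gamma> \<sigma> \<omega> | \<omega>. \<omega> \<in> W} | \<sigma> W. \<sigma> \<in> triples \<Gamma> \<and> openin word_space W \<and> W \<subseteq> bd_dom \<sigma>}"

definition germ_src :: "'a germ \<Rightarrow> 'a word" where
  "germ_src g = (THE \<omega>. \<exists>\<sigma>. (\<sigma>, \<omega>) \<in> g)"

definition germ_rng :: "'a germ \<Rightarrow> 'a word" where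
  "germ_rng g = (THE \<eta>. \<exists>\<sigma> \<omega>. (\<sigma>, \<omega>) \<in> g \<and> \<eta> = bd_act \<sigma> \<omega>)"

text \<open>
  \<open>[\<sigma>, \<tau>(\<omega>)] [\<tau>, \<omega>] = [\<sigma>\<tau>, \<omega>]\<close>, where \<open>\<rho>\<close> is the triple of the composed partial bijection \<open>\<sigma>\<tau>\<close>
  (which is not the zero since both germs are composable).
\<close>

definition germ_comp ::
    "('a list \<Rightarrow> 'a list) set \<Rightarrow> 'a germ \<Rightarrow> 'a germ \<Rightarrow> 'a germ" where
  "germ_comp \<Gamma> g h = (THE k. \<exists>\<sigma>\<in>triples \<Gamma>. \<exists>\<tau>\<in>triples \<Gamma>. \<exists>\<rho>\<in>triples \<Gamma>. \<exists>\<omega>.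
     \<omega> \<in> bd_dom \<tau> \<and> bd_act \<tau> \<omega> \<in> bd_dom \<sigma> \<and> pbij \<rho> = pbij \<sigma> \<circ>\<^sub>m pbij \<tau> \<and>
     g = germ \<Gamma> \<sigma> (bd_act \<tau> \<omega>) \<and> h = germ \<Gamma> \<tau> \<omega> \<and> k = germ \<Gamma> \<rho> \<omega>)"

definition attached_groupoid ::
    "('a list \<Rightarrow> 'a list) set \<Rightarrow> ('a germ, 'a word) top_groupoid" where
  "attached_groupoid \<Gamma> = \<lparr>arr = germ_top \<Gamma>, base = word_space, src = germ_src, rng = germ_rng,
     idn = (\<lambda>\<omega>. germ \<Gamma> ([], id, []) \<omega>), comp = germ_comp \<Gamma>\<rparr>"


section \<open>The convolution algebra and the complex Steinberg algebra\<close>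

abbreviation cspan :: "('g \<Rightarrow> complex) set \<Rightarrow> ('g \<Rightarrow> complex) set" where
  "cspan \<equiv> module.span (\<lambda>c f g. c * f g)"

definition Cc_on :: "('g, 'x) top_groupoid \<Rightarrow> 'g set \<Rightarrow> ('g \<Rightarrow> complex) set" where
  "Cc_on G U = {f. continuous_map (subtopology (arr G) U) euclidean f \<and>
     compactin (subtopology (arr G) U) (subtopology (arr G) U closure_of {g \<in> U. f g \<noteq> 0}) \<and>
     (\<forall>g. g \<notin> U \<longrightarrow> f g = 0)}"

definition Cc :: "('g, 'x) top_groupoid \<Rightarrow> ('g \<Rightarrow> complex) set" where
  "Cc G = cspan (\<Union>{Cc_on G U | U. open_bisection G U})"

definition steinberg :: "('g, 'x) top_groupoid \<Rightarrow> ('g \<Rightarrow> complex) set" where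
  "steinberg G = cspan {indicator U | U. open_bisection G U \<and> compactin (arr G) U}"

text \<open>
  For \<open>f \<in> Cc G\<close> and fixed \<open>g\<close>, at most finitely many terms of the following sum are nonzero.
\<close>

definition convol ::
    "('g, 'x) top_groupoid \<Rightarrow> ('g \<Rightarrow> complex) \<Rightarrow> ('g \<Rightarrow> complex) \<Rightarrow> 'g \<Rightarrow> complex" where
  "convol G f \<xi> g = (\<Sum>\<^sub>\<infinity>(h, k) \<in> {(h, k). h \<in> topspace (arr G) \<and> k \<in> topspace (arr G) \<and>
     src G h = rng G k \<and> comp G h k = g}. f h * \<xi> k)"


section \<open>The reduced C*-algebra\<close>

text \<open>Elements of \<open>\<ell>\<^sup>2(G\<^sub>x)\<close> are functions on the whole type that vanish outside \<open>G\<^sub>x\<close>.\<close>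

definition ell2 :: "('g, 'x) top_groupoid \<Rightarrow> 'x \<Rightarrow> ('g \<Rightarrow> complex) set" where
  "ell2 G x = {\<xi>. (\<forall>g. g \<notin> fibre G x \<longrightarrow> \<xi> g = 0) \<and>
                  (\<lambda>g. (cmod (\<xi> g))\<^sup>2) summable_on fibre G x}"

definition l2_inner ::
    "('g, 'x) top_groupoid \<Rightarrow> 'x \<Rightarrow> ('g \<Rightarrow> complex) \<Rightarrow> ('g \<Rightarrow> complex) \<Rightarrow> complex" where
  "l2_inner G x \<xi> \<eta> = (\<Sum>\<^sub>\<infinity>g \<in> fibre G x. \<xi> g * cnj (\<eta> g))"

definition l2_norm :: "('g, 'x) top_groupoid \<Rightarrow> 'x \<Rightarrow> ('g \<Rightarrow> complex) \<Rightarrow> real" where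
  "l2_norm G x \<xi> = sqrt (\<Sum>\<^sub>\<infinity>g \<in> fibre G x. (cmod (\<xi> g))\<^sup>2)"

definition op_norm ::
    "('g, 'x) top_groupoid \<Rightarrow> 'x \<Rightarrow> (('g \<Rightarrow> complex) \<Rightarrow> ('g \<Rightarrow> complex)) \<Rightarrow> real" where
  "op_norm G x T = (SUP \<xi> \<in> {\<xi> \<in> ell2 G x. l2_norm G x \<xi> \<le> 1}. l2_norm G x (T \<xi>))"

text \<open>The regular representation \<open>\<pi>\<^sub>x(f) \<xi> = f * \<xi>\<close> is \<open>convol G f\<close> on \<open>ell2 G x\<close>.\<close>

definition red_norm :: "('g, 'x) top_groupoid \<Rightarrow> ('g \<Rightarrow> complex) \<Rightarrow> real" where
  "red_norm G f = (SUP x \<in> topspace (base G). op_norm G x (convol G f))"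

text \<open>
  The completion of \<open>Cc G\<close> in the reduced norm: Cauchy sequences modulo null sequences.
\<close>

definition red_Cauchy :: "('g, 'x) top_groupoid \<Rightarrow> (nat \<Rightarrow> 'g \<Rightarrow> complex) set" where
  "red_Cauchy G = {\<phi>. (\<forall>n. \<phi> n \<in> Cc G) \<and>
     (\<forall>\<epsilon>>0. \<exists>N. \<forall>m\<ge>N. \<forall>n\<ge>N. red_norm G (\<phi> m - \<phi> n) < \<epsilon>)}"

definition red_equiv ::
    "('g, 'x) top_groupoid \<Rightarrow> ((nat \<Rightarrow> 'g \<Rightarrow> complex) \<times> (nat \<Rightarrow> 'g \<Rightarrow> complex)) set" where
  "red_equiv G = {(\<phi>, \<psi>). \<phi> \<in> red_Cauchy G \<and> \<psi> \<in> red_Cauchy G \<and>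
     (\<lambda>n. red_norm G (\<phi> n - \<psi> n)) \<longlonglongrightarrow> 0}"

type_synonym 'g cstar = "(nat \<Rightarrow> 'g \<Rightarrow> complex) set"

definition Cstar_red :: "('g, 'x) top_groupoid \<Rightarrow> 'g cstar set" where
  "Cstar_red G = red_Cauchy G // red_equiv G"

definition cstar_zero :: "('g, 'x) top_groupoid \<Rightarrow> 'g cstar" where
  "cstar_zero G = red_equiv G `` {\<lambda>n. 0}"

text \<open>
  The extension of \<open>\<pi>\<^sub>x\<close> to the completion by continuity: \<open>\<pi>\<^sub>x(F) \<xi>\<close> is the limit in \<open>\<ell>\<^sup>2(G\<^sub>x)\<close> of
  \<open>\<pi>\<^sub>x(\<phi>\<^sub>n) \<xi>\<close> for the Cauchy sequences \<open>\<phi>\<close> representing \<open>F\<close>.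
\<close>

definition cstar_rep ::
    "('g, 'x) top_groupoid \<Rightarrow> 'x \<Rightarrow> 'g cstar \<Rightarrow> ('g \<Rightarrow> complex) \<Rightarrow> ('g \<Rightarrow> complex)" where
  "cstar_rep G x F \<xi> = (THE \<eta>. \<eta> \<in> ell2 G x \<and>
     (\<forall>\<phi>\<in>F. (\<lambda>n. l2_norm G x (convol G (\<phi> n) \<xi> - \<eta>)) \<longlonglongrightarrow> 0))"

definition cstar_fun :: "('g, 'x) top_groupoid \<Rightarrow> 'g cstar \<Rightarrow> 'g \<Rightarrow> complex" where
  "cstar_fun G F g = l2_inner G (src G g)
     (cstar_rep G (src G g) F (indicator {idn G (src G g)})) (indicator {g})"


section \<open>Singular ideals and the combinatorial condition\<close>

definition supp_open :: "('g, 'x) top_groupoid \<Rightarrow> ('g \<Rightarrow> complex) \<Rightarrow> 'g set" where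
  "supp_open G f = {g \<in> topspace (arr G). f g \<noteq> 0}"

definition sing_ideal :: "('g, 'x) top_groupoid \<Rightarrow> 'g cstar set" where
  "sing_ideal G = {F \<in> Cstar_red G.
     base G interior_of (src G ` supp_open G (cstar_fun G F)) = {}}"

definition alg_sing_ideal :: "('g, 'x) top_groupoid \<Rightarrow> ('g \<Rightarrow> complex) set" where
  "alg_sing_ideal G = {f \<in> steinberg G. arr G interior_of (supp_open G f) = {}}"

text \<open>
  Vectors of \<open>\<rat>\<^sup>n\<close> are functions \<open>nat \<Rightarrow> rat\<close> that vanish outside \<open>{1..n}\<close>.
\<close>

definition rat_vecs :: "nat \<Rightarrow> (nat \<Rightarrow> rat) set" where
  "rat_vecs n = {v. \<forall>i. i \<notin> {1..n} \<longrightarrow> v i = 0}"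

definition rat_basis :: "nat \<Rightarrow> nat \<Rightarrow> rat" where
  "rat_basis i = (\<lambda>j. if j = i then 1 else 0)"

abbreviation rat_span :: "(nat \<Rightarrow> rat) set \<Rightarrow> (nat \<Rightarrow> rat) set" where
  "rat_span \<equiv> module.span (\<lambda>q v i. q * v i)"

definition cond_S0 :: "('g, 'x) top_groupoid \<Rightarrow> bool" where
  "cond_S0 G \<longleftrightarrow> (\<exists>n::nat. \<exists>U :: nat \<Rightarrow> 'g set. n \<ge> 1 \<and>
     (\<forall>i\<in>{1..n}. open_bisection G (U i)) \<and>
     (\<forall>i\<in>{1..n}. \<forall>j\<in>{1..n}. src G ` U i = src G ` U j) \<and>
     (\<forall>i\<in>{1..n}. U i - (\<Union>j\<in>{1..n} - {i}. U j) \<noteq> {} \<and>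
        arr G interior_of (U i - (\<Union>j\<in>{1..n} - {i}. U j)) = {}) \<and>
     rat_span {(\<Sum>i\<in>I. rat_basis i) | I. I \<subseteq> {1..n} \<and> card I > 1 \<and>
        (\<Inter>i\<in>I. U i) - (\<Union>j\<in>{1..n} - I. U j) \<noteq> {}} \<noteq> rat_vecs n)"

end

theory Submission
  imports Defs
begin

text \<open>
  The second equivalence holds for every ample groupoid.  Condition \<open>(\<S>\<^sub>0)\<close> provides a nonzero
  rational vector \<open>c\<close> orthogonal to all the \<open>b\<^sub>I\<close>, and \<open>\<Sum> c\<^sub>i 1\<^sub>U\<^sub>i\<close>, cut down to a compact open set of
  sources, is a nonzero element of \<open>J\<^sub>\<complex>\<close>.  Conversely, given a nonzero \<open>f\<close> in \<open>J\<^sub>\<complex>\<close>, choose a unit \<open>x\<close> for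
  which the number of points of the support of \<open>f\<close> over \<open>x\<close> is positive and minimal.  Bisections
  through these points over a small neighbourhood of \<open>x\<close> satisfy \<open>(\<S>\<^sub>0)\<close>: by minimality \<open>f\<close> vanishes
  wherever two of them meet.

  For \<open>J = 0 \<Longrightarrow> J\<^sub>\<complex> = 0\<close> note that finitely many bisections coincide in a locally constant way over a
  dense open set of units, so for \<open>f\<close> in \<open>J\<^sub>\<complex>\<close> even \<open>s(supp f)\<close> has empty interior.

  For \<open>J\<^sub>\<complex> = 0 \<Longrightarrow> J = 0\<close> let \<open>N\<close> be the finite set of the contracting property.  Near a given unit,
  every element of \<open>C\<^sub>c(G)\<close> is uniformly close to a translate of \<open>\<Sum> c\<^sub>\<gamma> \<gamma>\<close> with \<open>\<gamma>\<close> in \<open>N\<close>, whose values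
  are the sums of \<open>c\<close> over the classes of elements of \<open>N\<close> with equal germs.  If \<open>J\<^sub>\<complex> = 0\<close>, duality shows
  that each such class is a linear combination of classes that occur over a nonempty open set.
  Since there are finitely many classes, the values at all germs are bounded by a constant, depending
  only on \<open>N\<close>, times the values over generic units, and for elements of \<open>J\<close> the latter are
  arbitrarily small.
\<close>

section \<open>Linear algebra\<close>

text \<open>Since \<open>G\<close> need not be Hausdorff, the value of a function in
  \<open>Cc G\<close> at a germ need not be a limit of its values at nearby generic germs; the proof
  recovers it as a linear combination of generic values. A better approximation of an element of J
  by \<open>Cc G\<close> forces a passage to deeper cylinders, so the bound must not deteriorate
  with depth. This is where self-similarity enters: equality of the germs of u\<gamma>v* and
  u\<delta>v* at v\<eta> is equality of the germs of \<gamma> and \<delta> at \<eta>, so below v the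
  combinatorics is that of \<open>N\<close> on the whole boundary, and one constant serves all
  depths. Of the completion only two facts are used: the reduced norm dominates the supremum norm,
  and an element whose function vanishes is zero. Condition (S_0) is rational whereas J_C has
  complex coefficients. One direction reads a rational vector as a complex one; in the other the
  values of f define a rational-linear map into the complex numbers, which suffices to see that the
  span is proper.\<close>

lemma fun_sum_apply: "(\<Sum>i\<in>A. f i) x = (\<Sum>i\<in>A. f i x)"
  by (induction A rule: infinite_finite_induct) auto

lemma vector_space_fun: "vector_space (\<lambda>(c :: 'k :: field) f i. c * f i)"
  by standard (auto simp: fun_eq_iff algebra_simps)

text \<open>A basis of the span of \<open>W\<close> together with \<open>v\<close> is independent,
  so some linear functional is 1 at \<open>v\<close> and 0 on that basis. All vectors involved
  vanish off the finite set \<open>N\<close>, so on them the functional is a finite sum whose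
  coefficients are its values at the coordinate vectors. It serves twice: over the rationals to
  produce an element of J_C from \<open>cond_S0\<close>, and over the complex numbers to express
  germ classes by generic ones.\<close>

lemma span_separation:
  fixes W :: "('i \<Rightarrow> 'k :: field) set"
  assumes fin: "finite N" and v: "v \<notin> module.span (\<lambda>c f i. c * f i) W"
    and supp: "\<And>w i. w \<in> insert v W \<Longrightarrow> i \<notin> N \<Longrightarrow> w i = 0"
  shows "\<exists>c. (\<forall>w\<in>W. (\<Sum>i\<in>N. c i * w i) = 0) \<and> (\<Sum>i\<in>N. c i * v i) \<noteq> 0"
proof -
  let ?s = "\<lambda>(c :: 'k) f (i :: 'i). c * f i"
  interpret V: vector_space ?s by (rule vector_space_fun)
  interpret F: vector_space "(*) :: 'k \<Rightarrow> 'k \<Rightarrow> 'k" by standard (auto simp: algebra_simps)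
  interpret P: vector_space_pair ?s "(*) :: 'k \<Rightarrow> 'k \<Rightarrow> 'k" ..
  obtain B where B: "B \<subseteq> W" "V.independent B" "W \<subseteq> V.span B"
    using V.maximal_independent_subset by blast
  have "v \<notin> V.span B"
    using v V.span_mono[OF B(1)] by blast
  then have ind: "V.independent (insert v B)" "v \<notin> B"
    using B(2) V.independent_insertI V.span_base by blast+
  obtain \<phi> where \<phi>: "Vector_Spaces.linear ?s (*) \<phi>" "\<forall>x\<in>insert v B. \<phi> x = (if x = v then 1 else 0)"
    using P.linear_independent_extend[OF ind(1), of "\<lambda>x. if x = v then 1 else 0"] by blast
  interpret L: Vector_Spaces.linear ?s "(*)" \<phi> by (rule \<phi>(1))
  define e where "e i = (\<lambda>j. if j = i then 1 else 0 :: 'k)" for i :: 'i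
  have expand: "\<phi> w = (\<Sum>i\<in>N. \<phi> (e i) * w i)" if "w \<in> insert v W" for w
  proof -
    have "w = (\<Sum>i\<in>N. ?s (w i) (e i))"
    proof
      fix j
      have "(\<Sum>i\<in>N. w i * e i j) = (\<Sum>i\<in>N. if j = i then w i else 0)"
        by (intro sum.cong) (auto simp: e_def)
      also have "\<dots> = w j"
        using fin supp[OF that, of j] by simp
      finally show "w j = (\<Sum>i\<in>N. ?s (w i) (e i)) j" by (simp add: fun_sum_apply)
    qed
    then have "\<phi> w = \<phi> (\<Sum>i\<in>N. ?s (w i) (e i))" by simp
    also have "\<dots> = (\<Sum>i\<in>N. w i * \<phi> (e i))"
      by (simp add: L.sum L.scale)
    finally show ?thesis by (simp add: mult.commute)
  qed
  have "\<phi> w = 0" if "w \<in> W" for w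
    using L.eq_0_on_span[of B w] \<phi>(2) ind(2) B(3) that by (metis insertCI subset_iff)
  moreover have "\<phi> v = 1" using \<phi>(2) by simp
  ultimately show ?thesis
    using expand by (intro exI[of _ "\<lambda>i. \<phi> (e i)"]) auto
qed

lemma span_fun_induct [consumes 1, case_names zero base add scale]:
  fixes S :: "('i \<Rightarrow> 'k :: field) set"
  assumes "f \<in> module.span (\<lambda>c f i. c * f i) S"
    and "P 0" and "\<And>f. f \<in> S \<Longrightarrow> P f" and "\<And>f g. P f \<Longrightarrow> P g \<Longrightarrow> P (f + g)"
    and "\<And>c f. P f \<Longrightarrow> P (\<lambda>i. c * f i)"
  shows "P f"
proof -
  interpret V: vector_space "\<lambda>(c :: 'k) f (i :: 'i). c * f i" by (rule vector_space_fun)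
  show ?thesis
    using assms(1)
  proof (induction rule: V.span_induct_alt)
    case base
    show ?case by (rule assms(2))
  next
    case (step c x y)
    then show ?case using assms(3)[of x] assms(4)[of "\<lambda>i. c * x i" y] assms(5)[of x c] by blast
  qed
qed

interpretation cspan: vector_space "\<lambda>(c :: complex) f g. c * f g"
  by (rule vector_space_fun)

section \<open>Ample groupoids\<close>

definition restr :: "('g, 'x) top_groupoid \<Rightarrow> 'g set \<Rightarrow> 'x set \<Rightarrow> 'g set" where
  "restr G U W = {g \<in> U. src G g \<in> W}"

text \<open>Inverses are expressed by the two cancellation laws, the form in which convolution uses
  them: translation by an arrow is injective. Total disconnectedness of the unit space appears as
  the existence of compact open neighbourhoods, the source of compact open bisections. The Hausdorff
  property is asked of the unit space only, since \<open>arr G\<close> may be non-Hausdorff.\<close>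

locale ample_groupoid =
  fixes G :: "('g, 'x) top_groupoid"
  assumes continuous_src: "continuous_map (arr G) (base G) (src G)"
    and open_src: "open_map (arr G) (base G) (src G)"
    and Hausdorff_base: "Hausdorff_space (base G)"
    and compact_open_nbhd: "openin (base G) V \<Longrightarrow> x \<in> V \<Longrightarrow>
          \<exists>W. openin (base G) W \<and> compactin (base G) W \<and> x \<in> W \<and> W \<subseteq> V"
    and base_nonempty: "topspace (base G) \<noteq> {}"
    and rng_base: "g \<in> topspace (arr G) \<Longrightarrow> rng G g \<in> topspace (base G)"
    and idn_arr: "x \<in> topspace (base G) \<Longrightarrow> idn G x \<in> topspace (arr G)"
    and src_idn: "x \<in> topspace (base G) \<Longrightarrow> src G (idn G x) = x"
    and rng_idn: "x \<in> topspace (base G) \<Longrightarrow> rng G (idn G x) = x"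
    and comp_idn: "g \<in> topspace (arr G) \<Longrightarrow> comp G g (idn G (src G g)) = g"
    and comp_arr: "g \<in> topspace (arr G) \<Longrightarrow> h \<in> topspace (arr G) \<Longrightarrow> src G g = rng G h \<Longrightarrow>
          comp G g h \<in> topspace (arr G)"
    and src_comp: "g \<in> topspace (arr G) \<Longrightarrow> h \<in> topspace (arr G) \<Longrightarrow> src G g = rng G h \<Longrightarrow>
          src G (comp G g h) = src G h"
    and rng_comp: "g \<in> topspace (arr G) \<Longrightarrow> h \<in> topspace (arr G) \<Longrightarrow> src G g = rng G h \<Longrightarrow>
          rng G (comp G g h) = rng G g"
    and cancel_left: "g \<in> topspace (arr G) \<Longrightarrow> h \<in> topspace (arr G) \<Longrightarrow> h' \<in> topspace (arr G) \<Longrightarrow>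
          src G g = rng G h \<Longrightarrow> src G g = rng G h' \<Longrightarrow> comp G g h = comp G g h' \<Longrightarrow> h = h'"
    and cancel_right: "g \<in> topspace (arr G) \<Longrightarrow> g' \<in> topspace (arr G) \<Longrightarrow> h \<in> topspace (arr G) \<Longrightarrow>
          src G g = rng G h \<Longrightarrow> src G g' = rng G h \<Longrightarrow> comp G g h = comp G g' h \<Longrightarrow> g = g'"
begin

lemma src_base: "g \<in> topspace (arr G) \<Longrightarrow> src G g \<in> topspace (base G)"
  using continuous_src by (auto simp: continuous_map_def)

lemma open_bisection_subset: "open_bisection G U \<Longrightarrow> U \<subseteq> topspace (arr G)"
  by (auto simp: open_bisection_def dest: openin_subset)

lemma open_bisection_inj:
  "open_bisection G U \<Longrightarrow> g \<in> U \<Longrightarrow> h \<in> U \<Longrightarrow> src G g = src G h \<Longrightarrow> g = h"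
  by (auto simp: open_bisection_def dest: inj_onD)

lemma finite_bisection_fibre: "open_bisection G U \<Longrightarrow> finite {g \<in> U. src G g = x}"
proof (rule finite_subset)
  assume "open_bisection G U"
  from open_bisection_inj[OF this] show "{g \<in> U. src G g = x} \<subseteq> {THE g. g \<in> U \<and> src G g = x}"
    by (auto intro!: the_equality[symmetric])
qed simp

lemma openin_src_image: "openin (arr G) U \<Longrightarrow> openin (base G) (src G ` U)"
  using open_src by (auto simp: open_map_def)

lemma openin_restr:
  assumes "openin (arr G) U" "openin (base G) W"
  shows "openin (arr G) (restr G U W)"
proof -
  have "restr G U W = U \<inter> {g \<in> topspace (arr G). src G g \<in> W}"
    using openin_subset[OF assms(1)] by (auto simp: restr_def)
  then show ?thesis
    using assms continuous_src by (auto intro: openin_continuous_map_preimage)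
qed

lemma open_bisection_restr:
  "open_bisection G U \<Longrightarrow> openin (base G) W \<Longrightarrow> open_bisection G (restr G U W)"
  using openin_restr[of U W] by (auto simp: open_bisection_def restr_def inj_on_def)

lemma open_bisection_homeomorphic:
  assumes "open_bisection G U"
  shows "homeomorphic_map (subtopology (arr G) U) (subtopology (base G) (src G ` U)) (src G)"
proof -
  have U: "openin (arr G) U" "inj_on (src G) U" "U \<subseteq> topspace (arr G)"
    using assms open_bisection_subset by (auto simp: open_bisection_def)
  have "open_map (subtopology (arr G) U) (base G) (src G)"
    using open_src U(1) by (auto simp: open_map_def openin_open_subtopology)
  then have "open_map (subtopology (arr G) U) (subtopology (base G) (src G ` U)) (src G)"
    by (rule open_map_into_subtopology) auto
  moreover have "continuous_map (subtopology (arr G) U) (subtopology (base G) (src G ` U)) (src G)"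
    using continuous_src by (auto simp: continuous_map_in_subtopology continuous_map_from_subtopology)
  moreover have "src G ` topspace (subtopology (arr G) U) = topspace (subtopology (base G) (src G ` U))"
    using U(3) src_base by auto
  moreover have "inj_on (src G) (topspace (subtopology (arr G) U))"
    using U(2) by (auto simp: inj_on_def)
  ultimately show ?thesis
    by (simp add: bijective_open_imp_homeomorphic_map)
qed

text \<open>The source map is a homeomorphism from \<open>U\<close> onto its image and takes the
  restricted bisection to \<open>W\<close>. In this way compact open sets of units yield compact
  open bisections.\<close>

lemma compactin_restr:
  assumes "open_bisection G U" "compactin (base G) W" "W \<subseteq> src G ` U"
  shows "compactin (arr G) (restr G U W)"
proof -
  have "src G ` restr G U W = W" using assms(3) by (auto simp: restr_def)
  then have "compactin (subtopology (base G) (src G ` U)) (src G ` restr G U W)"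
    using assms by (simp add: compactin_subtopology)
  moreover have "restr G U W \<subseteq> topspace (subtopology (arr G) U)"
    using open_bisection_subset[OF assms(1)] by (auto simp: restr_def)
  ultimately have "compactin (subtopology (arr G) U) (restr G U W)"
    using homeomorphic_map_compactness[OF open_bisection_homeomorphic[OF assms(1)]] by blast
  then show ?thesis by (simp add: compactin_subtopology)
qed

lemma closedin_src_compact: "compactin (arr G) V \<Longrightarrow> closedin (base G) (src G ` V)"
  using continuous_src Hausdorff_base image_compactin compactin_imp_closedin by metis

section \<open>The Steinberg algebra, its local structure and condition (S_0)\<close>

lemma steinberg_indicator:
  "open_bisection G U \<Longrightarrow> compactin (arr G) U \<Longrightarrow> indicator U \<in> steinberg G"
  by (auto simp: steinberg_def intro!: cspan.span_base)

lemma steinberg_combination: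
  assumes "\<And>i. i \<in> I \<Longrightarrow> f i \<in> steinberg G"
  shows "(\<lambda>g. \<Sum>i\<in>I. c i * f i g) \<in> steinberg G"
proof -
  have "(\<lambda>g. \<Sum>i\<in>I. c i * f i g) = (\<Sum>i\<in>I. (\<lambda>g. c i * f i g))"
    by (auto simp: fun_sum_apply)
  then show ?thesis
    using assms unfolding steinberg_def by (auto intro!: cspan.span_sum cspan.span_scale)
qed

text \<open>The value at \<open>g\<close> depends only on which members of a finite family
  \<open>K\<close> contain \<open>g\<close>; later arguments track just this incidence. Distinct
  indicator functions have distinct supports, so the coefficients may be indexed by the sets
  themselves.\<close>

lemma steinberg_eq_sum:
  assumes "f \<in> steinberg G"
  obtains K a where "finite K" "\<And>V. V \<in> K \<Longrightarrow> open_bisection G V" "\<And>V. V \<in> K \<Longrightarrow> compactin (arr G) V"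
    "\<And>g. f g = (\<Sum>V\<in>{V \<in> K. g \<in> V}. a V)"
proof -
  obtain t r where t: "finite t" "t \<subseteq> {indicator U | U. open_bisection G U \<and> compactin (arr G) U}"
    and f: "f = (\<Sum>h\<in>t. (\<lambda>g. r h * h g))"
    using assms unfolding steinberg_def cspan.span_explicit by auto
  define K where "K = (\<lambda>h. {g. h g \<noteq> 0}) ` t"
  have ind: "{g. (indicator U :: 'g \<Rightarrow> complex) g \<noteq> 0} = U" for U
    by (auto simp: indicator_def)
  have t': "h = indicator {g. h g \<noteq> 0}" "open_bisection G {g. h g \<noteq> 0}" "compactin (arr G) {g. h g \<noteq> 0}"
    if "h \<in> t" for h
  proof -
    obtain U where "h = indicator U" "open_bisection G U" "compactin (arr G) U"
      using t(2) \<open>h \<in> t\<close> by blast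
    then show "h = indicator {g. h g \<noteq> 0}" "open_bisection G {g. h g \<noteq> 0}"
        "compactin (arr G) {g. h g \<noteq> 0}"
      by (simp_all only: ind)
  qed
  have inj: "inj_on (\<lambda>h. {g. h g \<noteq> 0}) t"
    using t'(1) by (intro inj_onI) metis
  have "finite K" using t(1) by (simp add: K_def)
  moreover have "f g = (\<Sum>V\<in>{V \<in> K. g \<in> V}. r (indicator V))" for g
  proof -
    have "f g = (\<Sum>h\<in>t. r h * h g)" by (simp add: f fun_sum_apply)
    also have "\<dots> = (\<Sum>h\<in>t. r (indicator {g. h g \<noteq> 0}) * indicator {g. h g \<noteq> 0} g)"
    proof (rule sum.cong)
      fix h assume "h \<in> t"
      show "r h * h g = r (indicator {g. h g \<noteq> 0}) * indicator {g. h g \<noteq> 0} g"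
        by (subst (1 2) t'(1)[OF \<open>h \<in> t\<close>]) (rule refl)
    qed simp
    also have "\<dots> = (\<Sum>V\<in>K. r (indicator V) * indicator V g)"
      unfolding K_def by (subst sum.reindex[OF inj]) simp
    also have "\<dots> = (\<Sum>V\<in>{V \<in> K. g \<in> V}. r (indicator V))"
      using \<open>finite K\<close> by (intro sum.mono_neutral_cong_right) (auto simp: indicator_def)
    finally show ?thesis .
  qed
  ultimately show ?thesis
    using t' by (intro that[of K "\<lambda>V. r (indicator V)"]) (auto simp: K_def)
qed

text \<open>Functions are total on the type of arrows. Every bisection lies in
  \<open>topspace (arr G)\<close>, so a Steinberg function that vanishes on actual arrows is
  0.\<close>

lemma steinberg_supp: "f \<in> steinberg G \<Longrightarrow> f g \<noteq> 0 \<Longrightarrow> g \<in> supp_open G f"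
proof (elim steinberg_eq_sum)
  fix K and a :: "'g set \<Rightarrow> complex"
  assume K: "\<And>V. V \<in> K \<Longrightarrow> open_bisection G V" "\<And>g. f g = (\<Sum>V\<in>{V \<in> K. g \<in> V}. a V)" and "f g \<noteq> 0"
  then have "{V \<in> K. g \<in> V} \<noteq> {}" by (metis sum.empty)
  then show "g \<in> supp_open G f"
    using K(1) \<open>f g \<noteq> 0\<close> open_bisection_subset by (auto simp: supp_open_def)
qed

text \<open>Over a small neighbourhood \<open>W\<close> of \<open>x\<close>, a member of
  \<open>K\<close> with points over \<open>W\<close> passes through exactly one arrow
  \<open>h\<close> over \<open>x\<close>, and members through the same \<open>h\<close> coincide
  there. Grouping the coefficients by \<open>h\<close> gives \<open>f h\<close>, so near
  \<open>x\<close> the function is a sum of indicators of bisections weighted by its own values over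
  \<open>x\<close>.\<close>

lemma local_form:
  assumes K: "finite K" "\<And>V. V \<in> K \<Longrightarrow> open_bisection G V" "\<And>V. V \<in> K \<Longrightarrow> compactin (arr G) V"
    and f: "\<And>g. f g = (\<Sum>V\<in>{V \<in> K. g \<in> V}. a V)" and x: "x \<in> topspace (base G)"
  obtains W U where "openin (base G) W" "x \<in> W"
    "\<And>h. h \<in> supp_open G f \<Longrightarrow> src G h = x \<Longrightarrow>
       open_bisection G (U h) \<and> h \<in> U h \<and> src G ` U h = W"
    "\<And>g. src G g \<in> W \<Longrightarrow> f g = (\<Sum>h\<in>{h \<in> supp_open G f. src G h = x \<and> g \<in> U h}. f h)"
proof -
  \<comment> \<open>Two open bisections that meet over \<open>x\<close> meet over a whole
    neighbourhood of \<open>x\<close>, and by injectivity of the source they have the same points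
    there.\<close>
  define W1 where "W1 = (\<Inter>p\<in>{p \<in> K \<times> K. x \<in> src G ` (fst p \<inter> snd p)}. src G ` (fst p \<inter> snd p))
     \<inter> topspace (base G)"
  \<comment> \<open>Members of \<open>K\<close> without a point over \<open>x\<close> are removed
    here. Compactness makes their source images closed, so that the complement is open.\<close>
  define W2 where "W2 = (\<Inter>V\<in>{V \<in> K. x \<notin> src G ` V}. topspace (base G) - src G ` V)
     \<inter> topspace (base G)"
  have "openin (base G) W1"
    unfolding W1_def using K
    by (intro openin_INT) (auto simp: open_bisection_def intro!: openin_src_image openin_Int)
  moreover have "openin (base G) W2"
    unfolding W2_def using K closedin_src_compact
    by (intro openin_INT) (auto intro!: openin_diff)
  moreover define W where "W = W1 \<inter> W2"
  ultimately have W: "openin (base G) W" by auto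
  have xW: "x \<in> W" using x by (auto simp: W_def W1_def W2_def)
  have coincide: "g \<in> V'"
    if "V \<in> K" "V' \<in> K" "h \<in> V" "h \<in> V'" "src G h = x" "g \<in> V" "src G g \<in> W" for V V' h g
  proof -
    have "src G g \<in> src G ` (V \<inter> V')"
      using that unfolding W_def W1_def by force
    then obtain g' where "g' \<in> V" "g' \<in> V'" "src G g' = src G g" by auto
    then show ?thesis using open_bisection_inj[OF K(2)] that by metis
  qed
  have over_x: "\<exists>h\<in>V. src G h = x" if "V \<in> K" "g \<in> V" "src G g \<in> W" for V g
  proof (rule ccontr)
    assume "\<not> ?thesis"
    then have "V \<in> {V \<in> K. x \<notin> src G ` V}" using that by auto
    then have "src G g \<notin> src G ` V"
      using that unfolding W_def W2_def by blast
    then show False using that by blast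
  qed
  have "\<exists>V\<in>K. h \<in> V" if "h \<in> supp_open G f" for h
  proof (rule ccontr)
    assume "\<not> ?thesis"
    then have none: "{V \<in> K. h \<in> V} = {}" by blast
    have "f h = 0" using f[of h] unfolding none by simp
    then show False using that by (simp add: supp_open_def)
  qed
  then obtain c where c: "\<And>h. h \<in> supp_open G f \<Longrightarrow> c h \<in> K \<and> h \<in> c h" by metis
  define U where "U h = restr G (c h) W" for h
  have "open_bisection G (U h) \<and> h \<in> U h \<and> src G ` U h = W"
    if h: "h \<in> supp_open G f" "src G h = x" for h
  proof -
    have "W \<subseteq> src G ` c h"
    proof
      fix y assume "y \<in> W"
      moreover have "(c h, c h) \<in> {p \<in> K \<times> K. x \<in> src G ` (fst p \<inter> snd p)}"
        using c[OF h(1)] h(2) by auto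
      ultimately show "y \<in> src G ` c h" unfolding W_def W1_def by fastforce
    qed
    then show ?thesis
      using c[OF h(1)] h(2) xW K(2) W open_bisection_restr unfolding U_def by (auto simp: restr_def)
  qed
  moreover have "f g = (\<Sum>h\<in>{h \<in> supp_open G f. src G h = x \<and> g \<in> U h}. f h)" if g: "src G g \<in> W" for g
  proof -
    \<comment> \<open>Arrows with \<open>f h = 0\<close> may occur in \<open>H\<close>, because the
      coefficients of the bisections through \<open>h\<close> can cancel; they are discarded at the
      end.\<close>
    define H where "H = {h. src G h = x \<and> (\<exists>V\<in>K. h \<in> V \<and> g \<in> V)}"
    have "finite (\<Union>V\<in>K. {h \<in> V. src G h = x})" using K(1,2) finite_bisection_fibre by blast
    moreover have "H \<subseteq> (\<Union>V\<in>K. {h \<in> V. src G h = x})" by (auto simp: H_def)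
    ultimately have finH: "finite H" using finite_subset by blast
    have "{V \<in> K. g \<in> V} = (\<Union>h\<in>H. {V \<in> K. h \<in> V})"
    proof (intro equalityI subsetI)
      fix V assume V: "V \<in> {V \<in> K. g \<in> V}"
      then obtain h where "h \<in> V" "src G h = x" using over_x[of V g] g by auto
      then show "V \<in> (\<Union>h\<in>H. {V \<in> K. h \<in> V})" using V by (auto simp: H_def)
    next
      fix V assume "V \<in> (\<Union>h\<in>H. {V \<in> K. h \<in> V})"
      then show "V \<in> {V \<in> K. g \<in> V}" using coincide g by (auto simp: H_def)
    qed
    then have "f g = (\<Sum>V\<in>(\<Union>h\<in>H. {V \<in> K. h \<in> V}). a V)" by (simp add: f)
    also have "\<dots> = (\<Sum>h\<in>H. f h)"
      unfolding f using finH K(1) open_bisection_inj[OF K(2)]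
      by (intro sum.UNION_disjoint) (auto simp: H_def)
    also have "\<dots> = (\<Sum>h\<in>{h \<in> supp_open G f. src G h = x \<and> g \<in> U h}. f h)"
    proof (rule sum.mono_neutral_right[OF finH])
      show "{h \<in> supp_open G f. src G h = x \<and> g \<in> U h} \<subseteq> H"
        using c by (auto simp: H_def U_def restr_def)
      show "\<forall>h\<in>H - {h \<in> supp_open G f. src G h = x \<and> g \<in> U h}. f h = 0"
      proof (intro ballI, rule ccontr)
        fix h assume h: "h \<in> H - {h \<in> supp_open G f. src G h = x \<and> g \<in> U h}" and "f h \<noteq> 0"
        then obtain V where V: "V \<in> K" "h \<in> V" "g \<in> V" "src G h = x" by (auto simp: H_def)
        then have "h \<in> supp_open G f"
          using \<open>f h \<noteq> 0\<close> open_bisection_subset[OF K(2)] by (auto simp: supp_open_def)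
        moreover then have "g \<in> c h" using coincide[OF V(1) _ V(2) _ V(4,3) g] c by blast
        ultimately show False using h g V by (auto simp: U_def restr_def)
      qed
    qed
    finally show ?thesis .
  qed
  ultimately show thesis using that[OF W xW, of U] by blast
qed

lemma finite_supp_fibre:
  assumes "f \<in> steinberg G"
  shows "finite {h \<in> supp_open G f. src G h = x}"
proof -
  obtain K a where K: "finite K" "\<And>V. V \<in> K \<Longrightarrow> open_bisection G V"
      "\<And>g. f g = (\<Sum>V\<in>{V \<in> K. g \<in> V}. a V)"
    using steinberg_eq_sum[OF assms] by metis
  have "finite (\<Union>V\<in>K. {h \<in> V. src G h = x})" using K(1,2) finite_bisection_fibre by blast
  moreover have "{h \<in> supp_open G f. src G h = x} \<subseteq> (\<Union>V\<in>K. {h \<in> V. src G h = x})"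
  proof
    fix h assume h: "h \<in> {h \<in> supp_open G f. src G h = x}"
    then have "{V \<in> K. h \<in> V} \<noteq> {}" using K(3)[of h] by (auto simp: supp_open_def simp del: Collect_empty_eq)
    then show "h \<in> (\<Union>V\<in>K. {h \<in> V. src G h = x})" using h by blast
  qed
  ultimately show ?thesis using finite_subset by blast
qed

text \<open>The rational-linear map \<open>L\<close> sends the i-th basis vector to
  \<open>f (e i)\<close>. It kills every b_I of the condition because \<open>f\<close> vanishes
  where several of the bisections meet, and it kills no basis vector because \<open>f (e i)\<close>
  is nonzero. Hence the span is proper although the values of \<open>f\<close> are complex.\<close>

lemma cond_S0_if_alg_sing:
  assumes f: "f \<in> alg_sing_ideal G" and "f \<noteq> 0"
  shows "cond_S0 G"
proof -
  have f_st: "f \<in> steinberg G" and sing: "arr G interior_of (supp_open G f) = {}"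
    using f by (auto simp: alg_sing_ideal_def)
  obtain K a where K: "finite K" "\<And>V. V \<in> K \<Longrightarrow> open_bisection G V" "\<And>V. V \<in> K \<Longrightarrow> compactin (arr G) V"
      "\<And>g. f g = (\<Sum>V\<in>{V \<in> K. g \<in> V}. a V)"
    using steinberg_eq_sum[OF f_st] by metis
  define S where "S y = {h \<in> supp_open G f. src G h = y}" for y
  have finS: "finite (S y)" for y using finite_supp_fibre[OF f_st] by (simp add: S_def)
  obtain g0 where "f g0 \<noteq> 0" using \<open>f \<noteq> 0\<close> by (auto simp: fun_eq_iff)
  then have "S (src G g0) \<noteq> {}" using steinberg_supp[OF f_st] by (auto simp: S_def)
  then obtain x where x: "S x \<noteq> {}" and minimal: "\<And>y. S y \<noteq> {} \<Longrightarrow> card (S x) \<le> card (S y)"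
    using ex_has_least_nat[of "\<lambda>y. S y \<noteq> {}" _ "\<lambda>y. card (S y)"] by blast
  have "x \<in> topspace (base G)" using x src_base by (auto simp: S_def supp_open_def)
  obtain W U where W: "openin (base G) W" "x \<in> W"
    and U: "\<And>h. h \<in> S x \<Longrightarrow> open_bisection G (U h) \<and> h \<in> U h \<and> src G ` U h = W"
    and fU: "\<And>g. src G g \<in> W \<Longrightarrow> f g = (\<Sum>h\<in>{h \<in> S x. g \<in> U h}. f h)"
  proof (rule local_form[OF K \<open>x \<in> topspace (base G)\<close>])
    fix W U
    assume W: "openin (base G) W" "x \<in> W"
      and U: "\<And>h. h \<in> supp_open G f \<Longrightarrow> src G h = x \<Longrightarrow>
        open_bisection G (U h) \<and> h \<in> U h \<and> src G ` U h = W"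
      and fU: "\<And>g. src G g \<in> W \<Longrightarrow> f g = (\<Sum>h\<in>{h \<in> supp_open G f. src G h = x \<and> g \<in> U h}. f h)"
    have "{h \<in> supp_open G f. src G h = x \<and> g \<in> U h} = {h \<in> S x. g \<in> U h}" for g
      by (auto simp: S_def)
    then show thesis using that[OF W, of U] U fU by (simp add: S_def)
  qed
  define m where "m = card (S x)"
  obtain e where e: "bij_betw e {1..m} (S x)"
    using ex_bij_betw_nat_finite_1[OF finS] unfolding m_def by blast
  have eS: "e i \<in> S x" if "i \<in> {1..m}" for i using e that by (auto simp: bij_betw_def)
  have einj: "e i = e j \<longleftrightarrow> i = j" if "i \<in> {1..m}" "j \<in> {1..m}" for i j
    using inj_on_eq_iff[OF bij_betw_imp_inj_on[OF e]] that by blast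
  have fe: "f (e i) \<noteq> 0" if "i \<in> {1..m}" for i using eS[OF that] by (auto simp: S_def supp_open_def)
  have fsum: "f g = (\<Sum>i\<in>{i \<in> {1..m}. g \<in> U (e i)}. f (e i))" if "src G g \<in> W" for g
  proof -
    have "inj_on e {i \<in> {1..m}. g \<in> U (e i)}"
      by (rule inj_on_subset[OF bij_betw_imp_inj_on[OF e]]) blast
    moreover have "e ` {i \<in> {1..m}. g \<in> U (e i)} = {h \<in> e ` {1..m}. g \<in> U h}" by blast
    ultimately show ?thesis
      unfolding bij_betw_imp_surj_on[OF e] fU[OF that] by (metis (no_types, lifting) comp_apply sum.cong sum.reindex)
  qed
  have "m \<ge> 1" using x finS[of x] by (simp add: m_def Suc_le_eq card_gt_0_iff)
  moreover have "\<forall>i\<in>{1..m}. open_bisection G (U (e i))" using U eS by blast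
  moreover have "\<forall>i\<in>{1..m}. \<forall>j\<in>{1..m}. src G ` U (e i) = src G ` U (e j)" using U eS by blast
  moreover have "\<forall>i\<in>{1..m}. U (e i) - (\<Union>j\<in>{1..m} - {i}. U (e j)) \<noteq> {} \<and>
      arr G interior_of (U (e i) - (\<Union>j\<in>{1..m} - {i}. U (e j))) = {}"
  proof (intro ballI conjI)
    fix i assume i: "i \<in> {1..m}"
    let ?D = "U (e i) - (\<Union>j\<in>{1..m} - {i}. U (e j))"
    have "e i \<notin> U (e j)" if j: "j \<in> {1..m} - {i}" for j
    proof
      assume "e i \<in> U (e j)"
      moreover have "src G (e i) = src G (e j)" using eS i j by (simp add: S_def)
      ultimately have "e i = e j" using U[OF eS[of j]] j open_bisection_inj by blast
      then show False using einj[of i j] i j by auto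
    qed
    then have "e i \<in> ?D" using U[OF eS[OF i]] by blast
    then show "?D \<noteq> {}" by blast
    \<comment> \<open>On the part of one bisection outside the others a single term of the local sum
      survives, so \<open>f\<close> is the nonzero constant \<open>f (e i)\<close> there.\<close>
    have "?D \<subseteq> supp_open G f"
    proof
      fix g assume g: "g \<in> ?D"
      then have "src G g \<in> W" using U[OF eS[OF i]] by blast
      moreover have "{j \<in> {1..m}. g \<in> U (e j)} = {i}" using g i by blast
      ultimately have "f g = f (e i)" using fsum by simp
      then show "g \<in> supp_open G f" using fe[OF i] steinberg_supp[OF f_st] by simp
    qed
    then show "arr G interior_of ?D = {}" using sing interior_of_mono by blast
  qed
  moreover have "rat_span {(\<Sum>i\<in>I. rat_basis i) | I. I \<subseteq> {1..m} \<and> card I > 1 \<and>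
        (\<Inter>i\<in>I. U (e i)) - (\<Union>j\<in>{1..m} - I. U (e j)) \<noteq> {}} \<noteq> rat_vecs m"
  proof
    assume "rat_span {(\<Sum>i\<in>I. rat_basis i) | I. I \<subseteq> {1..m} \<and> card I > 1 \<and>
        (\<Inter>i\<in>I. U (e i)) - (\<Union>j\<in>{1..m} - I. U (e j)) \<noteq> {}} = rat_vecs m"
    moreover define P where "P = {I. I \<subseteq> {1..m} \<and> card I > 1 \<and>
        (\<Inter>i\<in>I. U (e i)) - (\<Union>j\<in>{1..m} - I. U (e j)) \<noteq> {}}"
    moreover define B where "B = (\<lambda>I. \<Sum>i\<in>I. rat_basis i) ` P"
    ultimately have span: "rat_span B = rat_vecs m" by (simp only: setcompr_eq_image)
    define L where "L v = (\<Sum>i\<in>{1..m}. f (e i) * of_rat (v i))" for v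
    have L_sum: "L (\<Sum>i\<in>I. rat_basis i) = (\<Sum>i\<in>I. f (e i))" if I: "I \<subseteq> {1..m}" for I
    proof -
      have finI: "finite I" using I finite_subset by blast
      have "(\<Sum>i\<in>I. rat_basis i) j = (if j \<in> I then 1 else 0)" for j
        using finI by (simp add: fun_sum_apply rat_basis_def)
      then have "L (\<Sum>i\<in>I. rat_basis i) = (\<Sum>i\<in>{1..m}. if i \<in> I then f (e i) else 0)"
        unfolding L_def by (intro sum.cong) auto
      also have "\<dots> = (\<Sum>i\<in>I. f (e i))"
        using I by (subst sum.inter_restrict[symmetric]) (auto simp: Int_absorb1)
      finally show ?thesis .
    qed
    have "L v = 0" if "v \<in> rat_span B" for v
      using that
    proof (induction rule: span_fun_induct)
      case zero
      then show ?case by (simp add: L_def)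
    next
      case (base v)
      then obtain I g where I: "I \<subseteq> {1..m}" "card I > 1" "v = (\<Sum>i\<in>I. rat_basis i)"
        and g: "g \<in> (\<Inter>i\<in>I. U (e i))" "g \<notin> (\<Union>j\<in>{1..m} - I. U (e j))"
        unfolding B_def P_def by blast
      have finI: "finite I" using I finite_subset by blast
      obtain i0 where "i0 \<in> I" using I(2) by fastforce
      then have gW: "src G g \<in> W" using g(1) I(1) U[OF eS[of i0]] by blast
      have "{i \<in> {1..m}. g \<in> U (e i)} = I" using g I(1) by blast
      then have fg: "f g = (\<Sum>i\<in>I. f (e i))" using fsum[OF gW] by simp
      have "f g = 0"
      proof (rule ccontr)
        assume "f g \<noteq> 0"
        define y where "y = src G g"
        have gS: "g \<in> S y" using steinberg_supp[OF f_st \<open>f g \<noteq> 0\<close>] by (simp add: S_def y_def)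
        have "\<exists>i\<in>{1..m}. h \<in> U (e i)" if "h \<in> S y" for h
        proof (rule ccontr)
          assume "\<not> ?thesis"
          then have "{i \<in> {1..m}. h \<in> U (e i)} = {}" by blast
          moreover have "src G h \<in> W" using that gW by (simp add: S_def y_def)
          ultimately have "f h = 0" using fsum[of h] by (metis sum.empty)
          then show False using that by (simp add: S_def supp_open_def)
        qed
        \<comment> \<open>Assigning to each support point over \<open>y\<close> the index of a
          bisection through it is injective, since a bisection has at most one point over
          \<open>y\<close>.\<close>
        then obtain k where k: "\<And>h. h \<in> S y \<Longrightarrow> k h \<in> {1..m} \<and> h \<in> U (e (k h))" by metis
        have uniq: "h = h'" if "h \<in> S y" "h' \<in> S y" "i \<in> {1..m}" "h \<in> U (e i)" "h' \<in> U (e i)" for h h' i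
          using that U[OF eS[OF that(3)]] open_bisection_inj by (auto simp: S_def)
        have "inj_on k (S y)" using k uniq by (metis inj_onI)
        \<comment> \<open>An index of \<open>I\<close> other than \<open>k g\<close> is missed by
          \<open>k\<close>: the only point of \<open>U (e j)\<close> over \<open>y\<close> is
          \<open>g\<close>, whose index is \<open>k g\<close>. So the support over \<open>y\<close>
          would have fewer than \<open>m\<close> points.\<close>
        obtain j where j: "j \<in> I" "j \<noteq> k g"
        proof -
          have "I \<noteq> {k g}" "I \<noteq> {}" using I(2) by auto
          then show thesis using that by blast
        qed
        have "j \<notin> k ` S y"
        proof
          assume "j \<in> k ` S y"
          then obtain h where h: "h \<in> S y" "j = k h" by blast
          then have "h \<in> U (e j)" "g \<in> U (e j)" using k g j by auto
          then have "h = g" using uniq h gS j I(1) by blast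
          then show False using h j by simp
        qed
        then have "k ` S y \<subset> {1..m}" using k j I(1) by blast
        then have "card (k ` S y) < card {1..m}" by (intro psubset_card_mono) auto
        then have "card (S y) < card (S x)" using card_image[OF \<open>inj_on k (S y)\<close>] by (simp add: m_def)
        then show False using minimal[of y] gS by auto
      qed
      then show ?case using L_sum[OF I(1)] fg I(3) by simp
    next
      case (add v w)
      then show ?case by (simp add: L_def of_rat_add distrib_left sum.distrib)
    next
      case (scale c v)
      have "L (\<lambda>i. c * v i) = of_rat c * L v"
        unfolding L_def by (simp add: of_rat_mult sum_distrib_left mult_ac)
      then show ?case using scale by simp
    qed
    moreover have "rat_basis 1 \<in> rat_vecs m" using \<open>m \<ge> 1\<close> by (auto simp: rat_vecs_def rat_basis_def)
    ultimately have "L (\<Sum>i\<in>{1}. rat_basis i) = 0" using span by simp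
    then show False using L_sum[of "{1}"] fe[of 1] \<open>m \<ge> 1\<close> by simp
  qed
  ultimately show ?thesis
    unfolding cond_S0_def by - (rule exI[of _ m], rule exI[of _ "\<lambda>i. U (e i)"], intro conjI, assumption+)
qed

lemma alg_sing_if_cond_S0:
  assumes "cond_S0 G"
  shows "\<exists>f\<in>alg_sing_ideal G. f \<noteq> 0"
proof -
  obtain n :: nat and U :: "nat \<Rightarrow> 'g set" where A: "\<forall>i\<in>{1..n}. open_bisection G (U i)"
    "\<forall>i\<in>{1..n}. \<forall>j\<in>{1..n}. src G ` U i = src G ` U j"
    "\<forall>i\<in>{1..n}. U i - (\<Union>j\<in>{1..n} - {i}. U j) \<noteq> {} \<and>
        arr G interior_of (U i - (\<Union>j\<in>{1..n} - {i}. U j)) = {}"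
    and "rat_span {(\<Sum>i\<in>I. rat_basis i) | I. I \<subseteq> {1..n} \<and> card I > 1 \<and>
        (\<Inter>i\<in>I. U i) - (\<Union>j\<in>{1..n} - I. U j) \<noteq> {}} \<noteq> rat_vecs n"
  proof -
    from assms[unfolded cond_S0_def] show thesis
      by (elim exE conjE) (rule that; assumption)
  qed
  note bis = bspec[OF A(1)] and src = bspec[OF bspec[OF A(2)]]
    and ne = conjunct1[OF bspec[OF A(3)]] and int = conjunct2[OF bspec[OF A(3)]]
  define P where "P = {I. I \<subseteq> {1..n} \<and> card I > 1 \<and> (\<Inter>i\<in>I. U i) - (\<Union>j\<in>{1..n} - I. U j) \<noteq> {}}"
  define B where "B = (\<lambda>I. \<Sum>i\<in>I. rat_basis i) ` P"
  have span: "rat_span B \<noteq> rat_vecs n"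
    using \<open>rat_span _ \<noteq> _\<close> by (simp only: setcompr_eq_image B_def P_def not_False_eq_True)
  interpret Q: vector_space "\<lambda>(q :: rat) v (i :: nat). q * v i" by (rule vector_space_fun)
  have basis_sum: "(\<Sum>i\<in>I. rat_basis i) j = (if j \<in> I then 1 else 0)" if "I \<subseteq> {1..n}" for I j
    using finite_subset[OF that] by (simp add: fun_sum_apply rat_basis_def)
  have B_vecs: "B \<subseteq> rat_vecs n"
  proof
    fix v assume "v \<in> B"
    then obtain I where "I \<subseteq> {1..n}" "v = (\<Sum>i\<in>I. rat_basis i)" by (auto simp: B_def P_def)
    then show "v \<in> rat_vecs n" using basis_sum[of I] by (auto simp: rat_vecs_def)
  qed
  have "Q.subspace (rat_vecs n)"
    by (rule Q.subspaceI) (auto simp: rat_vecs_def)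
  then have "rat_span B \<subseteq> rat_vecs n" using B_vecs Q.span_minimal by blast
  then obtain v where v: "v \<in> rat_vecs n" "v \<notin> rat_span B" using span by blast
  have "\<exists>c. (\<forall>w\<in>B. (\<Sum>i\<in>{1..n}. c i * w i) = 0) \<and> (\<Sum>i\<in>{1..n}. c i * v i) \<noteq> 0"
  proof (rule span_separation)
    fix w i assume "w \<in> insert v B" and i: "i \<notin> {1..n}"
    then have "w \<in> rat_vecs n" using v B_vecs by blast
    then show "w i = 0" using i unfolding rat_vecs_def by blast
  qed (use v in simp_all)
  then obtain c where c: "\<And>w. w \<in> B \<Longrightarrow> (\<Sum>i\<in>{1..n}. c i * w i) = 0"
    and cv: "(\<Sum>i\<in>{1..n}. c i * v i) \<noteq> 0" by blast
  from cv obtain i0 where "i0 \<in> {1..n}" "c i0 * v i0 \<noteq> 0"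
    by (rule sum.not_neutral_contains_not_neutral)
  then have i0: "i0 \<in> {1..n}" "c i0 \<noteq> 0" by simp_all
  \<comment> \<open>Only \<open>U i0\<close> passes through \<open>g0\<close>, so the value of
    \<open>f\<close> there will be \<open>c i0\<close>. The compact open \<open>W\<close> lies in
    the common source set, which makes all restricted bisections compact.\<close>
  obtain g0 where g0: "g0 \<in> U i0" "\<And>j. j \<in> {1..n} \<Longrightarrow> g0 \<in> U j \<Longrightarrow> j = i0" using ne[OF i0(1)] by blast
  have "openin (base G) (src G ` U i0)" using bis[OF i0(1)] openin_src_image by (auto simp: open_bisection_def)
  then obtain W where W: "openin (base G) W" "compactin (base G) W" "src G g0 \<in> W" "W \<subseteq> src G ` U i0"
    using compact_open_nbhd[of "src G ` U i0" "src G g0"] g0(1) by blast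
  define V where "V i = restr G (U i) W" for i
  define f :: "'g \<Rightarrow> complex" where "f g = (\<Sum>i\<in>{1..n}. of_rat (c i) * indicator (V i) g)" for g
  have "indicator (V i) \<in> steinberg G" if i: "i \<in> {1..n}" for i
    unfolding V_def
  proof (rule steinberg_indicator)
    show "open_bisection G (restr G (U i) W)" by (rule open_bisection_restr[OF bis[OF i] W(1)])
    have "W \<subseteq> src G ` U i" using W(4) src[OF i i0(1)] by simp
    then show "compactin (arr G) (restr G (U i) W)" by (rule compactin_restr[OF bis[OF i] W(2)])
  qed
  then have "f \<in> steinberg G" unfolding f_def by (rule steinberg_combination)
  have feq: "f g = of_rat (\<Sum>i\<in>{i \<in> {1..n}. g \<in> V i}. c i)" for g
  proof -
    have "f g = (\<Sum>i\<in>{i \<in> {1..n}. g \<in> V i}. of_rat (c i))"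
      unfolding f_def by (intro sum.mono_neutral_cong_right) (auto simp: indicator_def)
    then show ?thesis by (simp add: of_rat_sum)
  qed
  have "{i \<in> {1..n}. g0 \<in> V i} = {i0}" using g0 i0 W(3) unfolding V_def restr_def by blast
  then have "f g0 \<noteq> 0" using feq[of g0] i0 by simp
  then have "f \<noteq> 0" by auto
  \<comment> \<open>If several \<open>U i\<close> pass through \<open>g\<close>, then
    \<open>f g\<close> is the pairing of \<open>c\<close> with a member of \<open>B\<close>, which
    is 0. A nonzero value therefore forces exactly one bisection.\<close>
  have supp: "\<exists>i\<in>{1..n}. g \<in> U i \<and> (\<forall>j\<in>{1..n} - {i}. g \<notin> U j)" if "f g \<noteq> 0" for g
  proof -
    define I where "I = {i \<in> {1..n}. g \<in> V i}"
    have finI: "finite I" by (simp add: I_def)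
    have "(\<Sum>i\<in>I. c i) \<noteq> 0" using that feq[of g] by (auto simp: I_def)
    then have "I \<noteq> {}" by auto
    then have gW: "src G g \<in> W" by (auto simp: I_def V_def restr_def)
    then have I: "I = {i \<in> {1..n}. g \<in> U i}" by (auto simp: I_def V_def restr_def)
    have "\<not> card I > 1"
    proof
      assume "card I > 1"
      moreover have "I \<subseteq> {1..n}" by (auto simp: I_def)
      moreover have "g \<in> (\<Inter>i\<in>I. U i) - (\<Union>j\<in>{1..n} - I. U j)" unfolding I by blast
      ultimately have "(\<Sum>i\<in>I. rat_basis i) \<in> B" unfolding B_def P_def by blast
      from c[OF this] have "(\<Sum>j\<in>{1..n}. c j * (\<Sum>i\<in>I. rat_basis i) j) = 0" .
      moreover have "(\<Sum>j\<in>{1..n}. c j * (\<Sum>i\<in>I. rat_basis i) j) = (\<Sum>j\<in>{1..n}. if j \<in> I then c j else 0)"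
        by (intro sum.cong refl, subst basis_sum) (auto simp: I_def)
      ultimately have "(\<Sum>i\<in>{1..n} \<inter> I. c i) = 0" by (simp add: sum.inter_restrict)
      moreover have "{1..n} \<inter> I = I" using I by blast
      ultimately show False using \<open>(\<Sum>i\<in>I. c i) \<noteq> 0\<close> by simp
    qed
    moreover have "card I > 0" using \<open>I \<noteq> {}\<close> finI by (simp add: card_gt_0_iff)
    ultimately have "card I = 1" by linarith
    then obtain i where "I = {i}" by (auto simp: card_1_singleton_iff)
    then show ?thesis using I by blast
  qed
  have "arr G interior_of (supp_open G f) = {}"
  proof (rule ccontr)
    assume "\<not> ?thesis"
    then obtain T g where T: "openin (arr G) T" "g \<in> T" "T \<subseteq> supp_open G f"
      by (auto simp: interior_of_def)
    then have "f g \<noteq> 0" by (auto simp: supp_open_def)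
    then obtain i where i: "i \<in> {1..n}" "g \<in> U i"
      using supp by blast
    have "openin (arr G) (T \<inter> U i)" using T bis[OF i(1)] by (auto simp: open_bisection_def)
    \<comment> \<open>Support points on \<open>U i\<close> lie on no other \<open>U j\<close>, so an
      open set of them would be interior to the part of \<open>U i\<close> outside the other
      bisections.\<close>
    moreover have "T \<inter> U i \<subseteq> U i - (\<Union>j\<in>{1..n} - {i}. U j)"
    proof
      fix h assume h: "h \<in> T \<inter> U i"
      then have "f h \<noteq> 0" using T by (auto simp: supp_open_def)
      then obtain k where "k \<in> {1..n}" "\<forall>j\<in>{1..n} - {k}. h \<notin> U j" using supp by blast
      then show "h \<in> U i - (\<Union>j\<in>{1..n} - {i}. U j)" using h i(1) by blast
    qed
    ultimately show False using int[OF i(1)] T(2) i(2) by (auto simp: interior_of_def)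
  qed
  then show ?thesis using \<open>f \<in> steinberg G\<close> \<open>f \<noteq> 0\<close> by (auto simp: alg_sing_ideal_def)
qed

lemma alg_sing_zero_iff: "alg_sing_ideal G = {0} \<longleftrightarrow> \<not> cond_S0 G"
proof -
  have "0 \<in> alg_sing_ideal G"
    by (auto simp: alg_sing_ideal_def steinberg_def supp_open_def intro: cspan.span_zero)
  then show ?thesis using cond_S0_if_alg_sing alg_sing_if_cond_S0 by blast
qed

end

section \<open>Square-summable functions\<close>

text \<open>The infinite sum in \<open>l2_norm\<close> is informative only for summable functions.
  With a bound on all finite partial sums, triangle inequalities and limits are carried out in
  finite sums, and summability is recovered by \<open>ell2I\<close>.\<close>

definition l2_bd :: "('g, 'x) top_groupoid \<Rightarrow> 'x \<Rightarrow> ('g \<Rightarrow> complex) \<Rightarrow> real \<Rightarrow> bool" where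
  "l2_bd G x \<xi> M \<longleftrightarrow> (\<forall>E. finite E \<longrightarrow> E \<subseteq> fibre G x \<longrightarrow> L2_set (\<lambda>g. cmod (\<xi> g)) E \<le> M)"

lemma l2_bdD: "l2_bd G x \<xi> M \<Longrightarrow> finite E \<Longrightarrow> E \<subseteq> fibre G x \<Longrightarrow> L2_set (\<lambda>g. cmod (\<xi> g)) E \<le> M"
  by (simp add: l2_bd_def)

lemma l2_bd_nonneg: "l2_bd G x \<xi> M \<Longrightarrow> 0 \<le> M"
  using l2_bdD[of G x \<xi> M "{}"] by simp

lemma l2_norm_nonneg: "0 \<le> l2_norm G x \<xi>"
  by (simp add: l2_norm_def infsum_nonneg)

lemma L2_set_le_iff: "0 \<le> M \<Longrightarrow> L2_set f E \<le> M \<longleftrightarrow> (\<Sum>i\<in>E. (f i)\<^sup>2) \<le> M\<^sup>2"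
  unfolding L2_set_def by (metis real_sqrt_le_iff real_sqrt_unique)

lemma ell2_bd: "\<xi> \<in> ell2 G x \<Longrightarrow> l2_bd G x \<xi> (l2_norm G x \<xi>)"
  unfolding l2_bd_def ell2_def l2_norm_def L2_set_def
  by (auto intro!: finite_sum_le_infsum)

lemma ell2I:
  assumes "\<And>g. g \<notin> fibre G x \<Longrightarrow> \<xi> g = 0" and bd: "l2_bd G x \<xi> M"
  shows "\<xi> \<in> ell2 G x" "l2_norm G x \<xi> \<le> M"
proof -
  have M: "0 \<le> M" using l2_bd_nonneg[OF bd] .
  have le: "(\<Sum>g\<in>E. (cmod (\<xi> g))\<^sup>2) \<le> M\<^sup>2" if "finite E" "E \<subseteq> fibre G x" for E
    using l2_bdD[OF bd that] L2_set_le_iff[OF M, of "\<lambda>g. cmod (\<xi> g)" E] by simp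
  then have "bdd_above (sum (\<lambda>g. (cmod (\<xi> g))\<^sup>2) ` {E. E \<subseteq> fibre G x \<and> finite E})"
    by (auto intro!: bdd_aboveI[of _ "M\<^sup>2"])
  then have sm: "(\<lambda>g. (cmod (\<xi> g))\<^sup>2) summable_on fibre G x"
    by (intro nonneg_bdd_above_summable_on) auto
  then show "\<xi> \<in> ell2 G x" using assms(1) by (auto simp: ell2_def)
  have "(\<Sum>\<^sub>\<infinity>g\<in>fibre G x. (cmod (\<xi> g))\<^sup>2) \<le> M\<^sup>2"
    using sm le by (rule infsum_le_finite_sums)
  then show "l2_norm G x \<xi> \<le> M"
    unfolding l2_norm_def using M real_sqrt_le_mono by fastforce
qed

lemma l2_bd_add:
  assumes "l2_bd G x \<xi> M" "l2_bd G x \<eta> M'"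
  shows "l2_bd G x (\<xi> + \<eta>) (M + M')"
  unfolding l2_bd_def
proof (intro allI impI)
  fix E assume E: "finite E" "E \<subseteq> fibre G x"
  have "L2_set (\<lambda>g. cmod ((\<xi> + \<eta>) g)) E \<le> L2_set (\<lambda>g. cmod (\<xi> g) + cmod (\<eta> g)) E"
    by (intro L2_set_mono) (auto intro: norm_triangle_ineq)
  also have "\<dots> \<le> L2_set (\<lambda>g. cmod (\<xi> g)) E + L2_set (\<lambda>g. cmod (\<eta> g)) E"
    by (rule L2_set_triangle_ineq)
  finally show "L2_set (\<lambda>g. cmod ((\<xi> + \<eta>) g)) E \<le> M + M'"
    using l2_bdD[OF assms(1) E] l2_bdD[OF assms(2) E] by linarith
qed

lemma l2_bd_scale:
  assumes "l2_bd G x \<xi> M"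
  shows "l2_bd G x (\<lambda>g. c * \<xi> g) (cmod c * M)"
  unfolding l2_bd_def
proof (intro allI impI)
  fix E assume E: "finite E" "E \<subseteq> fibre G x"
  show "L2_set (\<lambda>g. cmod (c * \<xi> g)) E \<le> cmod c * M"
    using l2_bdD[OF assms E] by (simp add: norm_mult L2_set_right_distrib[symmetric] mult_left_mono)
qed

lemma ell2_add:
  assumes "\<xi> \<in> ell2 G x" "\<eta> \<in> ell2 G x"
  shows "\<xi> + \<eta> \<in> ell2 G x" "l2_norm G x (\<xi> + \<eta>) \<le> l2_norm G x \<xi> + l2_norm G x \<eta>"
  using ell2I[OF _ l2_bd_add[OF assms[THEN ell2_bd]]] assms by (auto simp: ell2_def)

lemma l2_norm_minus: "l2_norm G x (- \<xi>) = l2_norm G x \<xi>"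
  by (simp add: l2_norm_def)

lemma ell2_minus: "\<xi> \<in> ell2 G x \<Longrightarrow> - \<xi> \<in> ell2 G x"
  by (simp add: ell2_def)

lemma ell2_diff:
  assumes "\<xi> \<in> ell2 G x" "\<eta> \<in> ell2 G x"
  shows "\<xi> - \<eta> \<in> ell2 G x"
  using ell2_add(1)[OF assms(1) ell2_minus[OF assms(2)]] by simp

lemma ell2_zero: "0 \<in> ell2 G x" "l2_norm G x 0 = 0"
  by (auto simp: ell2_def l2_norm_def)

lemma cmod_le_l2_norm:
  assumes "\<xi> \<in> ell2 G x"
  shows "cmod (\<xi> g) \<le> l2_norm G x \<xi>"
proof (cases "g \<in> fibre G x")
  case True
  then show ?thesis using l2_bdD[OF ell2_bd[OF assms], of "{g}"] by simp
next
  case False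
  then show ?thesis using assms l2_norm_nonneg[of G x \<xi>] by (simp add: ell2_def)
qed

lemma ell2_restrict:
  assumes "\<xi> \<in> ell2 G x"
  shows "(\<lambda>g. if g \<in> F then \<xi> g else 0) \<in> ell2 G x"
    "l2_norm G x (\<lambda>g. if g \<in> F then \<xi> g else 0) \<le> l2_norm G x \<xi>"
proof -
  have "l2_bd G x (\<lambda>g. if g \<in> F then \<xi> g else 0) (l2_norm G x \<xi>)"
    unfolding l2_bd_def
  proof (intro allI impI)
    fix E assume E: "finite E" "E \<subseteq> fibre G x"
    have "L2_set (\<lambda>g. cmod (if g \<in> F then \<xi> g else 0)) E \<le> L2_set (\<lambda>g. cmod (\<xi> g)) E"
      by (intro L2_set_mono) auto
    also have "\<dots> \<le> l2_norm G x \<xi>" by (rule l2_bdD[OF ell2_bd[OF assms] E])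
    finally show "L2_set (\<lambda>g. cmod (if g \<in> F then \<xi> g else 0)) E \<le> l2_norm G x \<xi>" .
  qed
  from ell2I[OF _ this] assms
  show "(\<lambda>g. if g \<in> F then \<xi> g else 0) \<in> ell2 G x"
    "l2_norm G x (\<lambda>g. if g \<in> F then \<xi> g else 0) \<le> l2_norm G x \<xi>"
    by (auto simp: ell2_def)
qed

lemma ell2_indicator:
  assumes "k \<in> fibre G x"
  shows "indicator {k} \<in> ell2 G x" "l2_norm G x (indicator {k}) \<le> 1"
proof -
  have "l2_bd G x (indicator {k}) 1"
    unfolding l2_bd_def
  proof (intro allI impI)
    fix E :: "'a set" assume E: "finite E" "E \<subseteq> fibre G x"
    have "(\<Sum>g\<in>E. (cmod (indicator {k} g))\<^sup>2) = (\<Sum>g\<in>E. if g = k then 1 else 0)"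
      by (intro sum.cong) (auto simp: indicator_def)
    also have "\<dots> \<le> 1\<^sup>2" using E by simp
    finally show "L2_set (\<lambda>g. cmod (indicator {k} g)) E \<le> 1" by (subst L2_set_le_iff) auto
  qed
  moreover have "indicator {k} g = (0 :: complex)" if "g \<notin> fibre G x" for g
    using that assms by (auto simp: indicator_def)
  ultimately show "indicator {k} \<in> ell2 G x" "l2_norm G x (indicator {k}) \<le> 1"
    using ell2I[of G x "indicator {k}" 1] by blast+
qed

section \<open>Convolution operators\<close>

definition comp_pairs :: "('g, 'x) top_groupoid \<Rightarrow> 'g \<Rightarrow> ('g \<times> 'g) set" where
  "comp_pairs G g = {(h, k). h \<in> topspace (arr G) \<and> k \<in> topspace (arr G) \<and>
     src G h = rng G k \<and> comp G h k = g}"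

lemma convol_pairs: "convol G f \<xi> g = (\<Sum>\<^sub>\<infinity>(h, k)\<in>comp_pairs G g. f h * \<xi> k)"
  by (simp add: convol_def comp_pairs_def)

lemma convol_scale: "convol G (\<lambda>g. c * f g) \<xi> = (\<lambda>g. c * convol G f \<xi> g)"
proof
  fix g
  have "convol G (\<lambda>g. c * f g) \<xi> g = (\<Sum>\<^sub>\<infinity>p\<in>comp_pairs G g. c * (case p of (h, k) \<Rightarrow> f h * \<xi> k))"
    unfolding convol_pairs by (intro infsum_cong) (auto simp: mult_ac)
  then show "convol G (\<lambda>g. c * f g) \<xi> g = c * convol G f \<xi> g"
    by (simp add: convol_pairs infsum_cmult_right')
qed

lemma convol_minus: "convol G (- f) \<xi> = - convol G f \<xi>"
proof -
  have "- f = (\<lambda>g. - 1 * f g)" by auto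
  then have "convol G (- f) \<xi> = (\<lambda>g. - 1 * convol G f \<xi> g)" by (simp only: convol_scale)
  then show ?thesis by auto
qed

context ample_groupoid
begin

text \<open>Finiteness is asked over ranges: in a factorisation of \<open>g\<close> the left factor
  has the range of \<open>g\<close> and, by cancellation, determines the right factor. So the sum in
  \<open>convol G f\<close> is finite whatever the other argument is.\<close>

definition rfinite :: "('g \<Rightarrow> complex) \<Rightarrow> bool" where
  "rfinite f \<longleftrightarrow> (\<forall>x. finite {h \<in> topspace (arr G). rng G h = x \<and> f h \<noteq> 0})"

lemma finite_comp_pairs:
  assumes "rfinite f"
  shows "finite {p \<in> comp_pairs G g. f (fst p) \<noteq> 0}"
proof (rule finite_imageD)
  have "fst ` {p \<in> comp_pairs G g. f (fst p) \<noteq> 0} \<subseteq> {h \<in> topspace (arr G). rng G h = rng G g \<and> f h \<noteq> 0}"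
    by (auto simp: comp_pairs_def rng_comp)
  then show "finite (fst ` {p \<in> comp_pairs G g. f (fst p) \<noteq> 0})"
    using assms finite_subset unfolding rfinite_def by blast
  show "inj_on fst {p \<in> comp_pairs G g. f (fst p) \<noteq> 0}"
    by (auto simp: inj_on_def comp_pairs_def intro: cancel_left)
qed

lemma convol_summable:
  assumes "rfinite f"
  shows "(\<lambda>(h, k). f h * \<xi> k) summable_on comp_pairs G g"
proof (rule finite_nonzero_values_imp_summable_on)
  show "finite {p \<in> comp_pairs G g. (case p of (h, k) \<Rightarrow> f h * \<xi> k) \<noteq> 0}"
    by (rule finite_subset[OF _ finite_comp_pairs[OF assms, of g]]) auto
qed

lemma rfinite_add: "rfinite f \<Longrightarrow> rfinite g \<Longrightarrow> rfinite (f + g)"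
  unfolding rfinite_def
proof
  fix x
  assume "\<forall>x. finite {h \<in> topspace (arr G). rng G h = x \<and> f h \<noteq> 0}"
    "\<forall>x. finite {h \<in> topspace (arr G). rng G h = x \<and> g h \<noteq> 0}"
  then have "finite ({h \<in> topspace (arr G). rng G h = x \<and> f h \<noteq> 0} \<union>
      {h \<in> topspace (arr G). rng G h = x \<and> g h \<noteq> 0})" by blast
  then show "finite {h \<in> topspace (arr G). rng G h = x \<and> (f + g) h \<noteq> 0}"
    by (rule rev_finite_subset) auto
qed

lemma rfinite_scale: "rfinite f \<Longrightarrow> rfinite (\<lambda>g. c * f g)"
  unfolding rfinite_def by (auto elim: rev_finite_subset)

lemma convol_add:
  assumes "rfinite f" "rfinite f'"
  shows "convol G (f + f') \<xi> = convol G f \<xi> + convol G f' \<xi>"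
proof
  fix g
  have "convol G (f + f') \<xi> g = (\<Sum>\<^sub>\<infinity>p\<in>comp_pairs G g.
      (case p of (h, k) \<Rightarrow> f h * \<xi> k) + (case p of (h, k) \<Rightarrow> f' h * \<xi> k))"
    unfolding convol_pairs by (intro infsum_cong) (auto simp: algebra_simps)
  then show "convol G (f + f') \<xi> g = (convol G f \<xi> + convol G f' \<xi>) g"
    using convol_summable[OF assms(1)] convol_summable[OF assms(2)]
    by (simp add: convol_pairs infsum_add)
qed

lemma convol_outside_fibre:
  assumes "\<xi> \<in> ell2 G x" "g \<notin> fibre G x"
  shows "convol G f \<xi> g = 0"
  unfolding convol_pairs
proof (rule infsum_0)
  fix p assume "p \<in> comp_pairs G g"
  then obtain h k where "p = (h, k)" "k \<in> topspace (arr G)" "src G k = src G g" "g \<in> topspace (arr G)"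
    by (auto simp: comp_pairs_def src_comp comp_arr)
  then have "k \<notin> fibre G x" using assms(2) by (auto simp: fibre_def)
  then show "(case p of (h, k) \<Rightarrow> f h * \<xi> k) = 0"
    using assms(1) \<open>p = (h, k)\<close> by (simp add: ell2_def)
qed

lemma Cc_on_bounded:
  assumes "open_bisection G U" "f \<in> Cc_on G U"
  obtains C where "0 \<le> C" "\<And>g. cmod (f g) \<le> C"
proof -
  define K where "K = (subtopology (arr G) U) closure_of {g \<in> U. f g \<noteq> 0}"
  have cont: "continuous_map (subtopology (arr G) U) euclidean f"
    and cpt: "compactin (subtopology (arr G) U) K" and out: "\<And>g. g \<notin> U \<Longrightarrow> f g = 0"
    using assms(2) by (auto simp: Cc_on_def K_def)
  have "compact (f ` K)" using image_compactin[OF cpt cont] by simp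
  then obtain C where C: "\<And>z. z \<in> f ` K \<Longrightarrow> cmod z \<le> C"
    using compact_imp_bounded bounded_iff by metis
  have "{g \<in> U. f g \<noteq> 0} \<subseteq> K"
    unfolding K_def using open_bisection_subset[OF assms(1)] by (intro closure_of_subset) auto
  then have "f g = 0 \<or> cmod (f g) \<le> C" for g
    using C out[of g] by blast
  then have "cmod (f g) \<le> max C 0" for g by (metis max.cobounded2 max.coboundedI1 norm_zero)
  then show thesis by (intro that[of "max C 0"]) auto
qed

text \<open>\<open>op_norm\<close> and \<open>red_norm\<close> are suprema and carry information
  only for sets bounded above. This predicate records one bound valid for all \<open>x\<close>,
  established before either supremum is evaluated.\<close>

definition conv_bd :: "('g \<Rightarrow> complex) \<Rightarrow> real \<Rightarrow> bool" where
  "conv_bd f M \<longleftrightarrow> 0 \<le> M \<and> (\<forall>x. \<forall>\<xi>\<in>ell2 G x. l2_bd G x (convol G f \<xi>) (M * l2_norm G x \<xi>))"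

text \<open>
  Left multiplication by a bisection is injective, so convolution by a function supported on a
  bisection permutes the coordinates of \<open>\<xi>\<close>, up to bounded factors.
\<close>

lemma Cc_on_conv_bd:
  assumes U: "open_bisection G U" and f: "f \<in> Cc_on G U"
  shows "rfinite f \<and> (\<exists>M. conv_bd f M)"
proof
  have out: "h \<in> U" if "f h \<noteq> 0" for h using f that by (auto simp: Cc_on_def)
  have inj_rng: "h = h'" if "h \<in> U" "h' \<in> U" "rng G h = rng G h'" for h h'
    using U that by (auto simp: open_bisection_def dest: inj_onD)
  show rf: "rfinite f"
    unfolding rfinite_def
  proof
    fix x
    have "{h \<in> topspace (arr G). rng G h = x \<and> f h \<noteq> 0} \<subseteq> {THE h. h \<in> U \<and> rng G h = x}"
      using inj_rng out by (auto intro!: the_equality[symmetric])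
    then show "finite {h \<in> topspace (arr G). rng G h = x \<and> f h \<noteq> 0}"
      using finite_subset by blast
  qed
  obtain C where C: "0 \<le> C" "\<And>g. cmod (f g) \<le> C" using Cc_on_bounded[OF U f] by blast
  have "l2_bd G x (convol G f \<xi>) (C * l2_norm G x \<xi>)" if \<xi>: "\<xi> \<in> ell2 G x" for x \<xi>
    unfolding l2_bd_def
  proof (intro allI impI)
    fix E assume E: "finite E" "E \<subseteq> fibre G x"
    define P where "P g = {p \<in> comp_pairs G g. f (fst p) \<noteq> 0}" for g
    define E' where "E' = {g \<in> E. P g \<noteq> {}}"
    have "\<forall>g\<in>E'. \<exists>q. q \<in> P g" by (auto simp: E'_def)
    from bchoice[OF this] obtain p where p: "\<And>g. g \<in> E' \<Longrightarrow> p g \<in> P g" by blast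
    define k where "k g = snd (p g)" for g
    have PD: "fst q \<in> topspace (arr G)" "snd q \<in> topspace (arr G)" "src G (fst q) = rng G (snd q)"
      "comp G (fst q) (snd q) = g" "fst q \<in> U" if "q \<in> P g" for q g
      using that out by (auto simp: P_def comp_pairs_def)
    \<comment> \<open>The left factor is fixed by its range, since \<open>U\<close> is a bisection,
      and the right factor then by cancellation. Each entry of the convolution is thus a single
      product.\<close>
    have Peq: "P g = {p g}" if "g \<in> E'" for g
    proof -
      note pD = PD[OF p[OF that]]
      have "q = p g" if q: "q \<in> P g" for q
      proof (rule prod_eqI)
        note qD = PD[OF q]
        have "rng G (fst q) = rng G (fst (p g))"
          using rng_comp[OF qD(1-3)] rng_comp[OF pD(1-3)] qD(4) pD(4) by (simp only:)
        then show fst_eq: "fst q = fst (p g)" by (rule inj_rng[OF qD(5) pD(5)])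
        have "comp G (fst q) (snd q) = comp G (fst q) (snd (p g))"
          unfolding qD(4) by (simp only: fst_eq pD(4))
        moreover have "src G (fst q) = rng G (snd (p g))" by (simp only: fst_eq pD(3))
        ultimately show "snd q = snd (p g)" by (intro cancel_left[OF qD(1,2) pD(2) qD(3)])
      qed
      then show ?thesis using p[OF that] by blast
    qed
    have conv: "convol G f \<xi> g = (if g \<in> E' then f (fst (p g)) * \<xi> (k g) else 0)" if "g \<in> E" for g
    proof -
      have "convol G f \<xi> g = (\<Sum>\<^sub>\<infinity>q\<in>P g. case q of (h, k) \<Rightarrow> f h * \<xi> k)"
        unfolding convol_pairs by (rule infsum_cong_neutral) (auto simp: P_def)
      also have "\<dots> = (if g \<in> E' then f (fst (p g)) * \<xi> (k g) else 0)"
      proof (cases "g \<in> E'")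
        case True
        then show ?thesis by (simp add: Peq k_def case_prod_beta)
      next
        case False
        then have "P g = {}" using that by (simp add: E'_def)
        then show ?thesis using False by simp
      qed
      finally show ?thesis .
    qed
    have pk: "fst (p g) \<in> topspace (arr G)" "k g \<in> topspace (arr G)" "src G (fst (p g)) = rng G (k g)"
      "comp G (fst (p g)) (k g) = g" "fst (p g) \<in> U" if "g \<in> E'" for g
      unfolding k_def by (fact PD[OF p[OF that]])+
    \<comment> \<open>Injectivity of the source on \<open>U\<close> enters here: equal right factors
      force equal left factors, so no coordinate of \<xi> is counted twice.\<close>
    have "inj_on k E'"
    proof (rule inj_onI)
      fix g g' assume g: "g \<in> E'" "g' \<in> E'" "k g = k g'"
      then have "fst (p g) = fst (p g')"
        using open_bisection_inj[OF U] pk(3,5) by metis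
      then show "g = g'" using g pk(4) by metis
    qed
    have "k ` E' \<subseteq> fibre G x"
    proof
      fix y assume "y \<in> k ` E'"
      then obtain g where g: "g \<in> E'" "y = k g" by blast
      then have "src G (k g) = src G g" using src_comp[OF pk(1-3)] pk(4) by simp
      then show "y \<in> fibre G x" using g pk(2) E(2) by (auto simp: fibre_def E'_def)
    qed
    then have sq: "(\<Sum>y\<in>k ` E'. (cmod (\<xi> y))\<^sup>2) \<le> (l2_norm G x \<xi>)\<^sup>2"
      using l2_bdD[OF ell2_bd[OF \<xi>], of "k ` E'"] E(1)
      by (simp add: L2_set_le_iff l2_norm_nonneg E'_def)
    have "(\<Sum>g\<in>E. (cmod (convol G f \<xi> g))\<^sup>2) = (\<Sum>g\<in>E'. (cmod (f (fst (p g)) * \<xi> (k g)))\<^sup>2)"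
      using E(1) conv by (intro sum.mono_neutral_cong_right) (auto simp: E'_def)
    also have "\<dots> \<le> (\<Sum>g\<in>E'. C\<^sup>2 * (cmod (\<xi> (k g)))\<^sup>2)"
      using C by (intro sum_mono) (auto simp: norm_mult power_mult_distrib intro!: mult_right_mono power_mono)
    also have "\<dots> = C\<^sup>2 * (\<Sum>y\<in>k ` E'. (cmod (\<xi> y))\<^sup>2)"
      using \<open>inj_on k E'\<close> by (simp add: sum.reindex sum_distrib_left)
    also have "\<dots> \<le> C\<^sup>2 * (l2_norm G x \<xi>)\<^sup>2"
      using sq by (intro mult_left_mono) auto
    also have "\<dots> = (C * l2_norm G x \<xi>)\<^sup>2" by (simp add: power_mult_distrib)
    finally show "L2_set (\<lambda>g. cmod (convol G f \<xi> g)) E \<le> C * l2_norm G x \<xi>"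
      using C(1) l2_norm_nonneg[of G x \<xi>] by (subst L2_set_le_iff) auto
  qed
  then show "\<exists>M. conv_bd f M" using C(1) unfolding conv_bd_def by blast
qed

lemma Cc_conv_bd:
  assumes "f \<in> Cc G"
  shows "rfinite f \<and> (\<exists>M. conv_bd f M)"
  using assms unfolding Cc_def
proof (induction rule: span_fun_induct)
  case zero
  have "convol G 0 \<xi> = 0" for \<xi> by (auto simp: convol_pairs intro!: infsum_0)
  then have "conv_bd 0 0" by (simp add: conv_bd_def l2_bd_def L2_set_def)
  then have "\<exists>M. conv_bd 0 M" by blast
  moreover have "rfinite 0" by (simp add: rfinite_def)
  ultimately show ?case by blast
next
  case (base f)
  then show ?case using Cc_on_conv_bd by blast
next
  case (add f f')
  then obtain M M' where M: "conv_bd f M" "conv_bd f' M'" by blast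
  have "conv_bd (f + f') (M + M')"
    using M add unfolding conv_bd_def by (simp add: convol_add distrib_right l2_bd_add)
  then show ?case using add rfinite_add by blast
next
  case (scale c f)
  then obtain M where M: "conv_bd f M" by blast
  have "conv_bd (\<lambda>g. c * f g) (cmod c * M)"
    using M unfolding conv_bd_def by (simp add: convol_scale mult.assoc l2_bd_scale)
  then show ?case using scale rfinite_scale by blast
qed

lemma convol_ell2: "f \<in> Cc G \<Longrightarrow> \<xi> \<in> ell2 G x \<Longrightarrow> convol G f \<xi> \<in> ell2 G x"
  using Cc_conv_bd[of f] ell2I(1)[of G x "convol G f \<xi>"] convol_outside_fibre unfolding conv_bd_def by metis

section \<open>The reduced norm\<close>

lemma convol_le_red_norm:
  assumes f: "f \<in> Cc G" and x: "x \<in> topspace (base G)" and \<xi>: "\<xi> \<in> ell2 G x" "l2_norm G x \<xi> \<le> 1"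
  shows "l2_norm G x (convol G f \<xi>) \<le> red_norm G f"
proof -
  obtain M where M: "conv_bd f M" using Cc_conv_bd[OF f] by blast
  have le: "l2_norm G y (convol G f \<eta>) \<le> M" if "\<eta> \<in> ell2 G y" "l2_norm G y \<eta> \<le> 1" for y \<eta>
  proof -
    have "l2_norm G y (convol G f \<eta>) \<le> M * l2_norm G y \<eta>"
      using M that(1) convol_outside_fibre by (intro ell2I(2)) (auto simp: conv_bd_def)
    also have "\<dots> \<le> M * 1" using M that(2) by (intro mult_left_mono) (auto simp: conv_bd_def)
    finally show ?thesis by simp
  qed
  have "l2_norm G x (convol G f \<xi>) \<le> op_norm G x (convol G f)"
    unfolding op_norm_def using \<xi> le by (intro cSUP_upper) (auto intro!: bdd_aboveI[of _ M])
  also have "\<dots> \<le> red_norm G f"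
    unfolding red_norm_def
  proof (rule cSUP_upper[OF x])
    have "op_norm G y (convol G f) \<le> M" for y
      unfolding op_norm_def using le ell2_zero[of G y] by (intro cSUP_least) auto
    then show "bdd_above ((\<lambda>x. op_norm G x (convol G f)) ` topspace (base G))"
      by (auto intro!: bdd_aboveI[of _ M])
  qed
  finally show ?thesis .
qed

lemma red_norm_le:
  assumes "\<And>x \<xi>. x \<in> topspace (base G) \<Longrightarrow> \<xi> \<in> ell2 G x \<Longrightarrow> l2_norm G x \<xi> \<le> 1 \<Longrightarrow>
    l2_norm G x (convol G f \<xi>) \<le> M"
  shows "red_norm G f \<le> M"
  unfolding red_norm_def op_norm_def
proof (intro cSUP_least base_nonempty)
  fix x show "{\<xi> \<in> ell2 G x. l2_norm G x \<xi> \<le> 1} \<noteq> {}" using ell2_zero[of G x] by auto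
qed (use assms in auto)

lemma Cc_diff: "f \<in> Cc G \<Longrightarrow> f' \<in> Cc G \<Longrightarrow> f - f' \<in> Cc G"
  unfolding Cc_def by (rule cspan.span_diff)

lemma Cc_zero: "0 \<in> Cc G"
  unfolding Cc_def by (rule cspan.span_zero)

lemma red_norm_add:
  assumes "f \<in> Cc G" "f' \<in> Cc G"
  shows "red_norm G (f + f') \<le> red_norm G f + red_norm G f'"
proof (rule red_norm_le)
  fix x \<xi> assume x: "x \<in> topspace (base G)" "\<xi> \<in> ell2 G x" "l2_norm G x \<xi> \<le> 1"
  have "l2_norm G x (convol G (f + f') \<xi>) \<le> l2_norm G x (convol G f \<xi>) + l2_norm G x (convol G f' \<xi>)"
    using Cc_conv_bd assms convol_ell2 x by (simp add: convol_add ell2_add)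
  also have "\<dots> \<le> red_norm G f + red_norm G f'"
    using x assms by (intro add_mono convol_le_red_norm)
  finally show "l2_norm G x (convol G (f + f') \<xi>) \<le> red_norm G f + red_norm G f'" .
qed

lemma red_norm_minus: "red_norm G (- f) = red_norm G f"
  by (simp add: red_norm_def op_norm_def convol_minus l2_norm_minus)

lemma red_norm_minus_commute: "red_norm G (f - f') = red_norm G (f' - f)"
  using red_norm_minus[of "f - f'"] by simp

lemma red_norm_zero: "red_norm G 0 = 0"
proof -
  have "convol G 0 \<xi> = 0" for \<xi> by (auto simp: convol_pairs intro!: infsum_0)
  moreover have "{\<xi> \<in> ell2 G x. l2_norm G x \<xi> \<le> 1} \<noteq> {}" for x using ell2_zero[of G x] by auto
  ultimately show ?thesis using base_nonempty by (simp add: red_norm_def op_norm_def ell2_zero)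
qed

lemma red_norm_nonneg:
  assumes "f \<in> Cc G"
  shows "0 \<le> red_norm G f"
proof -
  obtain x where "x \<in> topspace (base G)" using base_nonempty by blast
  then have "l2_norm G x (convol G f 0) \<le> red_norm G f"
    using convol_le_red_norm[OF assms _ ell2_zero(1)] ell2_zero(2)[of G x] by simp
  then show ?thesis using l2_norm_nonneg[of G x "convol G f 0"] by linarith
qed

text \<open>By right cancellation only one factorisation has second factor \<open>k\<close>. In
  matrix terms, the entries of the regular representation are values of \<open>f\<close>, which is
  how pointwise information reaches operator norms.\<close>

lemma convol_indicator_comp:
  assumes "h \<in> topspace (arr G)" "k \<in> topspace (arr G)" "src G h = rng G k"
  shows "convol G f (indicator {k}) (comp G h k) = f h"
proof -
  have "convol G f (indicator {k}) (comp G h k) =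
      (\<Sum>\<^sub>\<infinity>p\<in>{(h, k)}. case p of (h, k') \<Rightarrow> f h * indicator {k} k')"
    unfolding convol_pairs using assms cancel_right
    by (intro infsum_cong_neutral) (auto simp: comp_pairs_def indicator_def)
  then show ?thesis by simp
qed

lemma convol_indicator_zero:
  assumes "\<And>h. h \<in> topspace (arr G) \<Longrightarrow> src G h = rng G k \<Longrightarrow> comp G h k \<noteq> g"
  shows "convol G f (indicator {k}) g = 0"
  unfolding convol_pairs
proof (rule infsum_0)
  fix p assume "p \<in> comp_pairs G g"
  then have "snd p \<noteq> k" using assms[of "fst p"] by (auto simp: comp_pairs_def)
  then show "(case p of (h, k') \<Rightarrow> f h * indicator {k} k') = 0" by (simp add: case_prod_beta)
qed

lemma convol_indicator_idn:
  assumes "x \<in> topspace (base G)"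
  shows "convol G f (indicator {idn G x}) = (\<lambda>g. if g \<in> fibre G x then f g else 0)"
proof
  fix g
  show "convol G f (indicator {idn G x}) g = (if g \<in> fibre G x then f g else 0)"
  proof (cases "g \<in> fibre G x")
    case True
    then have g: "g \<in> topspace (arr G)" "src G g = x" by (auto simp: fibre_def)
    have "convol G f (indicator {idn G x}) (comp G g (idn G x)) = f g"
      using g assms by (intro convol_indicator_comp) (auto simp: idn_arr rng_idn)
    then show ?thesis using True comp_idn[OF g(1)] g(2) by simp
  next
    case False
    have "comp G h (idn G x) \<noteq> g" if "h \<in> topspace (arr G)" "src G h = rng G (idn G x)" for h
      using that False comp_idn[of h] assms by (auto simp: rng_idn fibre_def)
    then show ?thesis using False convol_indicator_zero by simp
  qed
qed

section \<open>Elements of the reduced C*-algebra as functions\<close>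

text \<open>By \<open>convol_indicator_idn\<close> this is the regular representation at
  \<open>x\<close> applied to the delta function at the unit. For \<open>f\<close> in
  \<open>Cc G\<close> it therefore lies in \<open>ell2 G x\<close> with norm at most
  \<open>red_norm G f\<close>.\<close>

definition on_fibre :: "('g \<Rightarrow> complex) \<Rightarrow> 'x \<Rightarrow> 'g \<Rightarrow> complex" where
  "on_fibre f x = (\<lambda>g. if g \<in> fibre G x then f g else 0)"

lemma on_fibre_ell2:
  assumes f: "f \<in> Cc G" and x: "x \<in> topspace (base G)"
  shows "on_fibre f x \<in> ell2 G x" "l2_norm G x (on_fibre f x) \<le> red_norm G f"
proof -
  have \<delta>: "idn G x \<in> fibre G x" using x by (simp add: fibre_def idn_arr src_idn)
  note ell2_indicator[OF \<delta>]
  then show "on_fibre f x \<in> ell2 G x" "l2_norm G x (on_fibre f x) \<le> red_norm G f"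
    using convol_ell2[OF f, of "indicator {idn G x}" x]
      convol_le_red_norm[OF f x, of "indicator {idn G x}"]
    by (simp_all add: convol_indicator_idn[OF x] on_fibre_def)
qed

lemma on_fibre_diff: "on_fibre (f - f') x = on_fibre f x - on_fibre f' x"
  by (auto simp: on_fibre_def)

text \<open>The value at \<open>g\<close> is a coordinate of the image of a vector of norm at most
  1, the delta function at the unit of its source. Convergence in the reduced norm therefore implies
  uniform convergence on arrows.\<close>

lemma cmod_le_red_norm:
  assumes "f \<in> Cc G" "g \<in> topspace (arr G)"
  shows "cmod (f g) \<le> red_norm G f"
proof -
  have x: "src G g \<in> topspace (base G)" using assms(2) by (rule src_base)
  have "cmod (on_fibre f (src G g) g) \<le> red_norm G f"
    by (rule order_trans[OF cmod_le_l2_norm[OF on_fibre_ell2(1)] on_fibre_ell2(2)]) (fact assms(1) x)+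
  then show ?thesis using assms(2) by (simp add: on_fibre_def fibre_def)
qed

lemma red_CauchyD:
  assumes "\<phi> \<in> red_Cauchy G" "\<epsilon> > 0"
  obtains N where "\<And>m n. m \<ge> N \<Longrightarrow> n \<ge> N \<Longrightarrow> red_norm G (\<phi> m - \<phi> n) < \<epsilon>"
  using assms unfolding red_Cauchy_def by blast

lemma red_Cauchy_Cc: "\<phi> \<in> red_Cauchy G \<Longrightarrow> \<phi> n \<in> Cc G"
  unfolding red_Cauchy_def by blast

lemma red_equiv_refl: "\<phi> \<in> red_Cauchy G \<Longrightarrow> (\<phi>, \<phi>) \<in> red_equiv G"
  unfolding red_equiv_def using red_norm_zero by simp

lemma const_Cauchy: "f \<in> Cc G \<Longrightarrow> (\<lambda>n. f) \<in> red_Cauchy G"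
  unfolding red_Cauchy_def using red_norm_zero by simp

definition lim_fun :: "(nat \<Rightarrow> 'g \<Rightarrow> complex) \<Rightarrow> 'g \<Rightarrow> complex" where
  "lim_fun \<phi> g = lim (\<lambda>n. \<phi> n g)"

lemma lim_fun_tendsto:
  assumes "\<phi> \<in> red_Cauchy G" "g \<in> topspace (arr G)"
  shows "(\<lambda>n. \<phi> n g) \<longlonglongrightarrow> lim_fun \<phi> g"
proof -
  have "Cauchy (\<lambda>n. \<phi> n g)"
  proof (rule metric_CauchyI)
    fix e :: real assume "0 < e"
    then obtain N where N: "\<And>m n. m \<ge> N \<Longrightarrow> n \<ge> N \<Longrightarrow> red_norm G (\<phi> m - \<phi> n) < e"
      using red_CauchyD[OF assms(1)] by blast
    have "dist (\<phi> m g) (\<phi> n g) < e" if "m \<ge> N" "n \<ge> N" for m n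
    proof -
      have "cmod ((\<phi> m - \<phi> n) g) \<le> red_norm G (\<phi> m - \<phi> n)"
        using assms by (intro cmod_le_red_norm Cc_diff red_Cauchy_Cc)
      then show ?thesis using N[OF that] by (simp add: dist_norm)
    qed
    then show "\<exists>M. \<forall>m\<ge>M. \<forall>n\<ge>M. dist (\<phi> m g) (\<phi> n g) < e" by blast
  qed
  then show ?thesis
    unfolding lim_fun_def by (simp add: Cauchy_convergent_iff convergent_LIMSEQ_iff)
qed

text \<open>For fixed \<open>n\<close> and a finite set \<open>E\<close> the Cauchy bound holds for
  every large \<open>m\<close>, and letting \<open>m\<close> tend to infinity inside the finite sum
  replaces \<open>\<phi> m\<close> by its pointwise limit. This makes the pointwise limit also the
  limit in \<open>ell2 G x\<close>.\<close>

lemma l2_bd_limit: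
  assumes \<phi>: "\<phi> \<in> red_Cauchy G" and x: "x \<in> topspace (base G)"
    and N: "\<And>m n. m \<ge> N \<Longrightarrow> n \<ge> N \<Longrightarrow> red_norm G (\<phi> m - \<phi> n) < \<epsilon>" and n: "n \<ge> N"
  shows "l2_bd G x (on_fibre (\<phi> n) x - on_fibre (lim_fun \<phi>) x) \<epsilon>"
  unfolding l2_bd_def
proof (intro allI impI)
  fix E assume E: "finite E" "E \<subseteq> fibre G x"
  have lim: "(\<lambda>m. L2_set (\<lambda>g. cmod ((on_fibre (\<phi> n) x - on_fibre (\<phi> m) x) g)) E)
      \<longlonglongrightarrow> L2_set (\<lambda>g. cmod ((on_fibre (\<phi> n) x - on_fibre (lim_fun \<phi>) x) g)) E"
    unfolding L2_set_def
  proof (intro tendsto_real_sqrt tendsto_sum tendsto_power tendsto_norm)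
    fix g assume "g \<in> E"
    then have "g \<in> fibre G x" "g \<in> topspace (arr G)" using E by (auto simp: fibre_def)
    then show "(\<lambda>m. (on_fibre (\<phi> n) x - on_fibre (\<phi> m) x) g)
        \<longlonglongrightarrow> (on_fibre (\<phi> n) x - on_fibre (lim_fun \<phi>) x) g"
      using lim_fun_tendsto[OF \<phi>] by (auto simp: on_fibre_def intro!: tendsto_intros)
  qed
  have "L2_set (\<lambda>g. cmod ((on_fibre (\<phi> n) x - on_fibre (\<phi> m) x) g)) E \<le> \<epsilon>" if "m \<ge> N" for m
  proof -
    have Cc: "\<phi> n - \<phi> m \<in> Cc G" using \<phi> by (intro Cc_diff red_Cauchy_Cc)
    have "L2_set (\<lambda>g. cmod ((on_fibre (\<phi> n) x - on_fibre (\<phi> m) x) g)) E \<le> l2_norm G x (on_fibre (\<phi> n - \<phi> m) x)"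
      unfolding on_fibre_diff[symmetric] by (rule l2_bdD[OF ell2_bd[OF on_fibre_ell2(1)[OF Cc x]] E])
    also have "\<dots> \<le> red_norm G (\<phi> n - \<phi> m)" by (rule on_fibre_ell2(2)[OF Cc x])
    also have "\<dots> \<le> \<epsilon>" using N[OF n that] by simp
    finally show ?thesis .
  qed
  then show "L2_set (\<lambda>g. cmod ((on_fibre (\<phi> n) x - on_fibre (lim_fun \<phi>) x) g)) E \<le> \<epsilon>"
    by (intro LIMSEQ_le_const2[OF lim]) blast
qed

lemma on_fibre_lim_ell2:
  assumes \<phi>: "\<phi> \<in> red_Cauchy G" and x: "x \<in> topspace (base G)"
  shows "on_fibre (lim_fun \<phi>) x \<in> ell2 G x"
proof -
  obtain N where N: "\<And>m n. m \<ge> N \<Longrightarrow> n \<ge> N \<Longrightarrow> red_norm G (\<phi> m - \<phi> n) < 1"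
    using red_CauchyD[OF \<phi>, of 1] by auto
  have "on_fibre (\<phi> N) x - on_fibre (lim_fun \<phi>) x \<in> ell2 G x"
    by (rule ell2I(1)[OF _ l2_bd_limit[OF \<phi> x N order_refl]]) (auto simp: on_fibre_def)
  from ell2_diff[OF on_fibre_ell2(1)[OF red_Cauchy_Cc[OF \<phi>, of N] x] this] show ?thesis by simp
qed

lemma on_fibre_lim_tendsto:
  assumes \<phi>: "\<phi> \<in> red_Cauchy G" and x: "x \<in> topspace (base G)"
  shows "(\<lambda>n. l2_norm G x (on_fibre (\<phi> n) x - on_fibre (lim_fun \<phi>) x)) \<longlonglongrightarrow> 0"
proof (rule LIMSEQ_I)
  fix r :: real assume "0 < r"
  then obtain N where N: "\<And>m n. m \<ge> N \<Longrightarrow> n \<ge> N \<Longrightarrow> red_norm G (\<phi> m - \<phi> n) < r / 2"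
    using red_CauchyD[OF \<phi>, of "r / 2"] by auto
  have "l2_norm G x (on_fibre (\<phi> n) x - on_fibre (lim_fun \<phi>) x) \<le> r / 2" if "n \<ge> N" for n
    by (rule ell2I(2)[OF _ l2_bd_limit[OF \<phi> x N that]]) (auto simp: on_fibre_def)
  then show "\<exists>no. \<forall>n\<ge>no. norm (l2_norm G x (on_fibre (\<phi> n) x - on_fibre (lim_fun \<phi>) x) - 0) < r"
    using \<open>0 < r\<close> by (intro exI[of _ N]) (fastforce simp: l2_norm_nonneg)
qed

text \<open>The description in \<open>cstar_rep\<close> quantifies over all representatives of the
  class; they differ from \<phi> by null sequences in the reduced norm, so they share its limit.
  Uniqueness holds because convergence in \<open>l2_norm\<close> forces convergence of each
  coordinate.\<close>

lemma cstar_rep_idn: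
  assumes \<phi>: "\<phi> \<in> red_Cauchy G" and x: "x \<in> topspace (base G)"
  shows "cstar_rep G x (red_equiv G `` {\<phi>}) (indicator {idn G x}) = on_fibre (lim_fun \<phi>) x"
  unfolding cstar_rep_def convol_indicator_idn[OF x] on_fibre_def[symmetric]
proof (rule the_equality)
  show "on_fibre (lim_fun \<phi>) x \<in> ell2 G x \<and>
      (\<forall>\<psi>\<in>red_equiv G `` {\<phi>}. (\<lambda>n. l2_norm G x (on_fibre (\<psi> n) x - on_fibre (lim_fun \<phi>) x)) \<longlonglongrightarrow> 0)"
  proof (intro conjI ballI on_fibre_lim_ell2 assms)
    fix \<psi> assume "\<psi> \<in> red_equiv G `` {\<phi>}"
    then have \<psi>: "\<psi> \<in> red_Cauchy G" and lim: "(\<lambda>n. red_norm G (\<phi> n - \<psi> n)) \<longlonglongrightarrow> 0"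
      by (auto simp: red_equiv_def)
    have le: "l2_norm G x (on_fibre (\<psi> n) x - on_fibre (lim_fun \<phi>) x) \<le>
        red_norm G (\<phi> n - \<psi> n) + l2_norm G x (on_fibre (\<phi> n) x - on_fibre (lim_fun \<phi>) x)" for n
    proof -
      have Cc: "\<psi> n - \<phi> n \<in> Cc G" using \<phi> \<psi> by (intro Cc_diff red_Cauchy_Cc)
      have "on_fibre (\<phi> n) x - on_fibre (lim_fun \<phi>) x \<in> ell2 G x"
        by (intro ell2_diff on_fibre_ell2 on_fibre_lim_ell2 red_Cauchy_Cc \<phi> x)
      from ell2_add(2)[OF on_fibre_ell2(1)[OF Cc x] this] on_fibre_ell2(2)[OF Cc x]
      show ?thesis by (simp add: on_fibre_diff red_norm_minus_commute[of "\<psi> n"])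
    qed
    show "(\<lambda>n. l2_norm G x (on_fibre (\<psi> n) x - on_fibre (lim_fun \<phi>) x)) \<longlonglongrightarrow> 0"
    proof (rule tendsto_sandwich[OF _ _ tendsto_const])
      show "(\<lambda>n. red_norm G (\<phi> n - \<psi> n) + l2_norm G x (on_fibre (\<phi> n) x - on_fibre (lim_fun \<phi>) x)) \<longlonglongrightarrow> 0"
        using tendsto_add[OF lim on_fibre_lim_tendsto[OF \<phi> x]] by simp
    qed (simp_all add: le l2_norm_nonneg)
  qed
next
  fix \<eta>
  assume \<eta>: "\<eta> \<in> ell2 G x \<and> (\<forall>\<psi>\<in>red_equiv G `` {\<phi>}. (\<lambda>n. l2_norm G x (on_fibre (\<psi> n) x - \<eta>)) \<longlonglongrightarrow> 0)"
  have "\<phi> \<in> red_equiv G `` {\<phi>}" using red_equiv_refl[OF \<phi>] by simp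
  then have lim: "(\<lambda>n. l2_norm G x (on_fibre (\<phi> n) x - \<eta>)) \<longlonglongrightarrow> 0" using \<eta> by blast
  show "\<eta> = on_fibre (lim_fun \<phi>) x"
  proof
    fix g
    show "\<eta> g = on_fibre (lim_fun \<phi>) x g"
    proof (cases "g \<in> fibre G x")
      case True
      have "cmod (\<phi> n g - \<eta> g) \<le> l2_norm G x (on_fibre (\<phi> n) x - \<eta>)" for n
      proof -
        have "on_fibre (\<phi> n) x - \<eta> \<in> ell2 G x"
          using \<eta> by (intro ell2_diff on_fibre_ell2 red_Cauchy_Cc \<phi> x) auto
        from cmod_le_l2_norm[OF this, of g] show ?thesis using True by (simp add: on_fibre_def)
      qed
      then have "(\<lambda>n. \<phi> n g - \<eta> g) \<longlonglongrightarrow> 0"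
        using lim by (intro Lim_null_comparison[of "\<lambda>n. \<phi> n g - \<eta> g"]) auto
      then have "(\<lambda>n. \<phi> n g) \<longlonglongrightarrow> \<eta> g" by (simp add: LIM_zero_iff)
      moreover have "(\<lambda>n. \<phi> n g) \<longlonglongrightarrow> lim_fun \<phi> g"
        using True by (intro lim_fun_tendsto \<phi>) (simp add: fibre_def)
      ultimately have "\<eta> g = lim_fun \<phi> g" by (rule LIMSEQ_unique)
      then show ?thesis using True by (simp add: on_fibre_def)
    next
      case False
      then show ?thesis using \<eta> by (simp add: on_fibre_def ell2_def)
    qed
  qed
qed

lemma cstar_fun_class:
  assumes \<phi>: "\<phi> \<in> red_Cauchy G" and g: "g \<in> topspace (arr G)"
  shows "cstar_fun G (red_equiv G `` {\<phi>}) g = lim_fun \<phi> g"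
proof -
  have fib: "g \<in> fibre G (src G g)" using g by (simp add: fibre_def)
  have "cstar_fun G (red_equiv G `` {\<phi>}) g =
      (\<Sum>\<^sub>\<infinity>h\<in>fibre G (src G g). on_fibre (lim_fun \<phi>) (src G g) h * cnj (indicator {g} h))"
    by (simp add: cstar_fun_def cstar_rep_idn[OF \<phi> src_base[OF g]] l2_inner_def)
  also have "\<dots> = (\<Sum>\<^sub>\<infinity>h\<in>{g}. on_fibre (lim_fun \<phi>) (src G g) h)"
    using fib by (intro infsum_cong_neutral) (auto simp: indicator_def)
  finally show ?thesis using fib by (simp add: on_fibre_def)
qed

lemma cstar_fun_const:
  assumes "f \<in> Cc G" "g \<in> topspace (arr G)"
  shows "cstar_fun G (red_equiv G `` {\<lambda>n. f}) g = f g"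
  using cstar_fun_class[OF const_Cauchy[OF assms(1)] assms(2)] by (simp add: lim_fun_def)

lemma cstar_fun_zero: "g \<in> topspace (arr G) \<Longrightarrow> cstar_fun G (cstar_zero G) g = 0"
  using cstar_fun_const[OF Cc_zero] by (simp add: cstar_zero_def)

lemma cstar_zero_sing: "cstar_zero G \<in> sing_ideal G"
proof -
  have "supp_open G (cstar_fun G (cstar_zero G)) = {}"
    by (auto simp: supp_open_def cstar_fun_zero)
  moreover have "cstar_zero G \<in> Cstar_red G"
    unfolding cstar_zero_def Cstar_red_def by (intro quotientI const_Cauchy Cc_zero)
  ultimately show ?thesis by (simp add: sing_ideal_def)
qed

text \<open>A late member of a representing Cauchy sequence is close in the reduced norm to all
  later ones, hence uniformly close to their pointwise limit. This is the form in which elements of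
  the completion enter the local analysis of J.\<close>

lemma cstar_fun_approx:
  assumes F: "F \<in> Cstar_red G" and "\<epsilon> > 0"
  obtains \<phi> where "\<phi> \<in> Cc G" "\<And>g. g \<in> topspace (arr G) \<Longrightarrow> cmod (cstar_fun G F g - \<phi> g) \<le> \<epsilon>"
proof -
  obtain \<phi> where \<phi>: "\<phi> \<in> red_Cauchy G" and F': "F = red_equiv G `` {\<phi>}"
    using F by (auto simp: Cstar_red_def elim: quotientE)
  obtain N where N: "\<And>m n. m \<ge> N \<Longrightarrow> n \<ge> N \<Longrightarrow> red_norm G (\<phi> m - \<phi> n) < \<epsilon>"
    using red_CauchyD[OF \<phi> \<open>\<epsilon> > 0\<close>] by blast
  have "cmod (cstar_fun G F g - \<phi> N g) \<le> \<epsilon>" if g: "g \<in> topspace (arr G)" for g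
  proof -
    have "(\<lambda>n. cmod (\<phi> n g - \<phi> N g)) \<longlonglongrightarrow> cmod (lim_fun \<phi> g - \<phi> N g)"
      by (intro tendsto_intros lim_fun_tendsto \<phi> g)
    moreover have "cmod (\<phi> n g - \<phi> N g) \<le> \<epsilon>" if "n \<ge> N" for n
      using cmod_le_red_norm[OF Cc_diff[OF red_Cauchy_Cc[OF \<phi>] red_Cauchy_Cc[OF \<phi>]] g, of n N]
        N[OF that order_refl] by simp
    ultimately have "cmod (lim_fun \<phi> g - \<phi> N g) \<le> \<epsilon>"
      by (intro LIMSEQ_le_const2[where a = \<epsilon>]) auto
    then show ?thesis by (simp add: F' cstar_fun_class[OF \<phi> g])
  qed
  then show thesis using that red_Cauchy_Cc[OF \<phi>] by blast
qed

section \<open>Elements of the reduced C*-algebra are determined by their functions\<close>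

lemma convol_restrict:
  assumes "rfinite f" "finite E"
  obtains F where "finite F" "\<And>\<xi> g. g \<in> E \<Longrightarrow> convol G f (\<lambda>k. if k \<in> F then \<xi> k else 0) g = convol G f \<xi> g"
proof -
  \<comment> \<open>These are the right factors of members of \<open>E\<close> whose left factor
    lies in the support of \<open>f\<close>. They are finitely many and do not depend on
    \<xi>.\<close>
  define F where "F = (\<Union>g\<in>E. snd ` {p \<in> comp_pairs G g. f (fst p) \<noteq> 0})"
  have "finite F" unfolding F_def using assms finite_comp_pairs by blast
  moreover have "convol G f (\<lambda>k. if k \<in> F then \<xi> k else 0) g = convol G f \<xi> g" if "g \<in> E" for \<xi> g
    unfolding convol_pairs
  proof (rule infsum_cong)
    fix p assume "p \<in> comp_pairs G g"
    then have "f (fst p) \<noteq> 0 \<Longrightarrow> snd p \<in> F" using that unfolding F_def by blast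
    then show "(case p of (h, k) \<Rightarrow> f h * (if k \<in> F then \<xi> k else 0)) = (case p of (h, k) \<Rightarrow> f h * \<xi> k)"
      by (auto simp: case_prod_beta)
  qed
  ultimately show thesis using that by blast
qed

lemma convol_finite_support:
  assumes f: "rfinite f" and F: "finite F"
  shows "convol G f (\<lambda>k. if k \<in> F then \<xi> k else 0) g = (\<Sum>k\<in>F. \<xi> k * convol G f (indicator {k}) g)"
proof -
  define P where "P = {p \<in> comp_pairs G g. f (fst p) \<noteq> 0}"
  have conv: "convol G f \<eta> g = (\<Sum>p\<in>P. f (fst p) * \<eta> (snd p))" for \<eta>
  proof -
    have "convol G f \<eta> g = (\<Sum>\<^sub>\<infinity>p\<in>P. f (fst p) * \<eta> (snd p))"
      unfolding convol_pairs by (rule infsum_cong_neutral) (auto simp: P_def)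
    then show ?thesis using finite_comp_pairs[OF f, of g] by (simp add: P_def)
  qed
  have "f (fst p) * (if snd p \<in> F then \<xi> (snd p) else 0) =
      (\<Sum>k\<in>F. \<xi> k * (f (fst p) * indicator {k} (snd p)))" for p
  proof -
    have "(\<Sum>k\<in>F. \<xi> k * (f (fst p) * indicator {k} (snd p))) =
        (\<Sum>k\<in>F. if snd p = k then f (fst p) * \<xi> (snd p) else 0)"
      by (intro sum.cong) (auto simp: indicator_def)
    then show ?thesis using F by simp
  qed
  then show ?thesis
    unfolding conv sum_distrib_left by (subst sum.swap) simp
qed

text \<open>
  For finitely supported \<open>\<xi>\<close>, the vector \<open>\<pi>\<^sub>x(\<phi>\<^sub>n) \<xi>\<close> is the entrywise limit of \<open>\<pi>\<^sub>x(\<phi>\<^sub>n - \<phi>\<^sub>m) \<xi>\<close>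
  as \<open>m\<close> grows, because the entries of \<open>\<pi>\<^sub>x(\<phi>\<^sub>m)\<close> are values of \<open>\<phi>\<^sub>m\<close>.
\<close>

lemma red_norm_tendsto_zero:
  assumes \<phi>: "\<phi> \<in> red_Cauchy G" and zero: "\<And>g. g \<in> topspace (arr G) \<Longrightarrow> lim_fun \<phi> g = 0"
  shows "(\<lambda>n. red_norm G (\<phi> n)) \<longlonglongrightarrow> 0"
proof (rule LIMSEQ_I)
  fix r :: real assume "0 < r"
  then obtain N where N: "\<And>m n. m \<ge> N \<Longrightarrow> n \<ge> N \<Longrightarrow> red_norm G (\<phi> m - \<phi> n) < r / 2"
    using red_CauchyD[OF \<phi>, of "r / 2"] by auto
  note Cc = red_Cauchy_Cc[OF \<phi>]
  have rf: "rfinite (\<phi> n)" for n using Cc_conv_bd[OF Cc] by blast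
  have delta: "(\<lambda>m. convol G (\<phi> m) (indicator {k}) g) \<longlonglongrightarrow> 0" if k: "k \<in> topspace (arr G)" for k g
  proof (cases "\<exists>h\<in>topspace (arr G). src G h = rng G k \<and> comp G h k = g")
    case True
    then obtain h where h: "h \<in> topspace (arr G)" "src G h = rng G k" "g = comp G h k" by blast
    show ?thesis
      using lim_fun_tendsto[OF \<phi> h(1)] zero[OF h(1)] convol_indicator_comp[OF h(1) k h(2)] h(3) by simp
  next
    case False
    then show ?thesis using convol_indicator_zero[of k g] by simp
  qed
  have "red_norm G (\<phi> n) \<le> r / 2" if n: "n \<ge> N" for n
  proof (rule red_norm_le)
    fix x \<xi> assume x: "x \<in> topspace (base G)" and \<xi>: "\<xi> \<in> ell2 G x" "l2_norm G x \<xi> \<le> 1"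
    have "l2_bd G x (convol G (\<phi> n) \<xi>) (r / 2)"
      unfolding l2_bd_def
    proof (intro allI impI)
      fix E assume E: "finite E" "E \<subseteq> fibre G x"
      obtain F where F: "finite F"
        "\<And>\<xi> g. g \<in> E \<Longrightarrow> convol G (\<phi> n) (\<lambda>k. if k \<in> F then \<xi> k else 0) g = convol G (\<phi> n) \<xi> g"
        using convol_restrict[OF rf E(1)] by blast
      define \<eta> where "\<eta> = (\<lambda>k. if k \<in> F then \<xi> k else 0)"
      have \<eta>: "\<eta> \<in> ell2 G x" "l2_norm G x \<eta> \<le> 1"
        using ell2_restrict[OF \<xi>(1), of F] \<xi>(2) by (auto simp: \<eta>_def)
      have "(\<lambda>m. convol G (\<phi> m) \<eta> g) \<longlonglongrightarrow> 0" for g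
      proof -
        have "(\<lambda>m. \<xi> k * convol G (\<phi> m) (indicator {k}) g) \<longlonglongrightarrow> 0" for k
        proof (cases "k \<in> topspace (arr G)")
          case True
          then show ?thesis using tendsto_mult_right_zero[OF delta] by blast
        next
          case False
          then have "\<xi> k = 0" using \<xi>(1) by (auto simp: ell2_def fibre_def)
          then show ?thesis by simp
        qed
        then show ?thesis
          unfolding \<eta>_def convol_finite_support[OF rf F(1)] by (intro tendsto_null_sum)
      qed
      then have lim: "(\<lambda>m. L2_set (\<lambda>g. cmod (convol G (\<phi> m) \<eta> g)) E) \<longlonglongrightarrow> L2_set (\<lambda>g. cmod 0) E"
        unfolding L2_set_def by (intro tendsto_real_sqrt tendsto_sum tendsto_power tendsto_norm)
      \<comment> \<open>Truncating \<xi> to \<eta> changes nothing on \<open>E\<close> and does not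
        increase the norm. With \<open>\<phi> n\<close> split as
        \<open>(\<phi> n - \<phi> m) + \<phi> m\<close>, the first summand is controlled by the
        Cauchy property, and the second tends to 0 on the finite set \<open>E\<close> as
        \<open>m\<close> grows.\<close>
      have le: "L2_set (\<lambda>g. cmod (convol G (\<phi> n) \<xi> g)) E \<le> r / 2 + L2_set (\<lambda>g. cmod (convol G (\<phi> m) \<eta> g)) E"
        if m: "m \<ge> N" for m
      proof -
        have C: "\<phi> n - \<phi> m \<in> Cc G" using Cc Cc_diff by blast
        have rf': "rfinite (\<phi> n - \<phi> m)" using Cc_conv_bd[OF C] by blast
        have split: "convol G (\<phi> n) \<xi> g = convol G (\<phi> n - \<phi> m) \<eta> g + convol G (\<phi> m) \<eta> g" if "g \<in> E" for g
          using convol_add[OF rf' rf[of m], of \<eta>] F(2)[OF that, of \<xi>] by (simp add: \<eta>_def)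
        have "L2_set (\<lambda>g. cmod (convol G (\<phi> n) \<xi> g)) E \<le>
            L2_set (\<lambda>g. cmod (convol G (\<phi> n - \<phi> m) \<eta> g) + cmod (convol G (\<phi> m) \<eta> g)) E"
          using split by (intro L2_set_mono) (auto intro: norm_triangle_ineq)
        also have "\<dots> \<le> L2_set (\<lambda>g. cmod (convol G (\<phi> n - \<phi> m) \<eta> g)) E +
            L2_set (\<lambda>g. cmod (convol G (\<phi> m) \<eta> g)) E"
          by (rule L2_set_triangle_ineq)
        also have "L2_set (\<lambda>g. cmod (convol G (\<phi> n - \<phi> m) \<eta> g)) E \<le> l2_norm G x (convol G (\<phi> n - \<phi> m) \<eta>)"
          by (rule l2_bdD[OF ell2_bd[OF convol_ell2[OF C \<eta>(1)]] E])
        also have "\<dots> \<le> red_norm G (\<phi> n - \<phi> m)" by (rule convol_le_red_norm[OF C x \<eta>])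
        also have "\<dots> \<le> r / 2" using N[OF n m] by simp
        finally show ?thesis by simp
      qed
      have "(\<lambda>m. r / 2 + L2_set (\<lambda>g. cmod (convol G (\<phi> m) \<eta> g)) E) \<longlonglongrightarrow> r / 2 + 0"
        using lim by (intro tendsto_add tendsto_const) (simp add: L2_set_def)
      then show "L2_set (\<lambda>g. cmod (convol G (\<phi> n) \<xi> g)) E \<le> r / 2"
        using le by (intro LIMSEQ_le_const[where a = "L2_set (\<lambda>g. cmod (convol G (\<phi> n) \<xi> g)) E"]) auto
    qed
    then show "l2_norm G x (convol G (\<phi> n) \<xi>) \<le> r / 2"
      using convol_outside_fibre[OF \<xi>(1)] by (intro ell2I(2)) auto
  qed
  then show "\<exists>no. \<forall>n\<ge>no. norm (red_norm G (\<phi> n) - 0) < r"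
    using \<open>0 < r\<close> red_norm_nonneg[OF Cc] by (intro exI[of _ N]) fastforce
qed

text \<open>A representing sequence tends to 0 in the reduced norm by
  \<open>red_norm_tendsto_zero\<close>, and the triangle inequality shows that it has the same
  equivalent sequences as the zero sequence. This is the injectivity of the passage from elements of
  the completion to functions.\<close>

lemma cstar_zeroI:
  assumes F: "F \<in> Cstar_red G" and zero: "\<And>g. g \<in> topspace (arr G) \<Longrightarrow> cstar_fun G F g = 0"
  shows "F = cstar_zero G"
proof -
  obtain \<phi> where \<phi>: "\<phi> \<in> red_Cauchy G" and F': "F = red_equiv G `` {\<phi>}"
    using F by (auto simp: Cstar_red_def elim: quotientE)
  have lim: "(\<lambda>n. red_norm G (\<phi> n)) \<longlonglongrightarrow> 0"
    using zero cstar_fun_class[OF \<phi>] by (intro red_norm_tendsto_zero[OF \<phi>]) (simp add: F')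
  have 1: "(\<lambda>n. red_norm G (\<psi> n)) \<longlonglongrightarrow> 0"
    if "\<psi> \<in> red_Cauchy G" "(\<lambda>n. red_norm G (\<phi> n - \<psi> n)) \<longlonglongrightarrow> 0" for \<psi>
  proof (rule tendsto_sandwich[OF _ _ tendsto_const])
    show "(\<lambda>n. red_norm G (\<phi> n - \<psi> n) + red_norm G (\<phi> n)) \<longlonglongrightarrow> 0"
      using tendsto_add[OF that(2) lim] by simp
    have "red_norm G (\<psi> n) \<le> red_norm G (\<phi> n - \<psi> n) + red_norm G (\<phi> n)" for n
      using red_norm_add[OF Cc_diff[OF red_Cauchy_Cc[OF that(1)] red_Cauchy_Cc[OF \<phi>]] red_Cauchy_Cc[OF \<phi>], of n n n]
      by (simp add: red_norm_minus_commute[of "\<psi> n"])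
    then show "\<forall>\<^sub>F n in sequentially. red_norm G (\<psi> n) \<le> red_norm G (\<phi> n - \<psi> n) + red_norm G (\<phi> n)"
      by simp
  qed (use red_norm_nonneg red_Cauchy_Cc[OF that(1)] in simp)
  have 2: "(\<lambda>n. red_norm G (\<phi> n - \<psi> n)) \<longlonglongrightarrow> 0"
    if "\<psi> \<in> red_Cauchy G" "(\<lambda>n. red_norm G (\<psi> n)) \<longlonglongrightarrow> 0" for \<psi>
  proof (rule tendsto_sandwich[OF _ _ tendsto_const])
    show "(\<lambda>n. red_norm G (\<phi> n) + red_norm G (\<psi> n)) \<longlonglongrightarrow> 0"
      using tendsto_add[OF lim that(2)] by simp
    have "red_norm G (\<phi> n - \<psi> n) \<le> red_norm G (\<phi> n) + red_norm G (\<psi> n)" for n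
      using red_norm_add[OF red_Cauchy_Cc[OF \<phi>] Cc_diff[OF Cc_zero red_Cauchy_Cc[OF that(1)]], of n n]
      by (simp add: red_norm_minus)
    then show "\<forall>\<^sub>F n in sequentially. red_norm G (\<phi> n - \<psi> n) \<le> red_norm G (\<phi> n) + red_norm G (\<psi> n)"
      by simp
  qed (use red_norm_nonneg Cc_diff red_Cauchy_Cc[OF that(1)] red_Cauchy_Cc[OF \<phi>] in simp)
  have "(\<phi>, \<psi>) \<in> red_equiv G \<longleftrightarrow> (\<lambda>n. 0, \<psi>) \<in> red_equiv G" for \<psi>
    using 1[of \<psi>] 2[of \<psi>] \<phi> const_Cauchy[OF Cc_zero]
    unfolding red_equiv_def by (auto simp: red_norm_minus)
  then show ?thesis unfolding F' cstar_zero_def by auto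
qed

section \<open>Singular elements\<close>

text \<open>The combinatorial pattern of \<open>K\<close> over \<open>x\<close>. By
  \<open>coincidence_sections\<close> it tells which members pass through a given point over
  \<open>x\<close> of a member of \<open>K\<close>, so it determines the value there of any function
  given by coefficients on \<open>K\<close>.\<close>

definition coincidence :: "'g set set \<Rightarrow> 'x \<Rightarrow> ('g set \<times> 'g set) set" where
  "coincidence K x = {p \<in> K \<times> K. x \<in> src G ` (fst p \<inter> snd p)}"

text \<open>Meeting over \<open>x\<close> is an open condition on \<open>x\<close>, so near a given
  unit the pattern can only grow. At a unit of \<open>W\<close> where it has the largest number of
  pairs it cannot grow and is locally constant.\<close>

lemma coincidence_locally_constant:
  assumes K: "finite K" "\<And>V. V \<in> K \<Longrightarrow> openin (arr G) V"
    and W: "openin (base G) W" "W \<noteq> {}"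
  shows "\<exists>W' y. openin (base G) W' \<and> y \<in> W' \<and> W' \<subseteq> W \<and>
    (\<forall>x\<in>W'. coincidence K x = coincidence K y)"
proof -
  have fin: "finite (coincidence K x)" for x
    using K(1) by (simp add: coincidence_def)
  have "card (coincidence K x) \<le> card (K \<times> K)" for x
    using K(1) by (intro card_mono) (auto simp: coincidence_def)
  moreover obtain x where "x \<in> W" using W(2) by blast
  ultimately have "\<exists>y. y \<in> W \<and> (\<forall>x. x \<in> W \<longrightarrow> card (coincidence K x) \<le> card (coincidence K y))"
    by (intro ex_has_greatest_nat[of _ x _ "Suc (card (K \<times> K))"]) (simp_all add: less_Suc_eq_le)
  then obtain y where y: "y \<in> W" "\<And>x. x \<in> W \<Longrightarrow> card (coincidence K x) \<le> card (coincidence K y)" by blast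
  define W' where "W' = (\<Inter>p\<in>coincidence K y. src G ` (fst p \<inter> snd p)) \<inter> topspace (base G) \<inter> W"
  have "openin (base G) ((\<Inter>p\<in>coincidence K y. src G ` (fst p \<inter> snd p)) \<inter> topspace (base G))"
    using K(2) by (intro openin_INT fin openin_src_image openin_Int) (auto simp: coincidence_def)
  then have "openin (base G) W'" unfolding W'_def using W(1) by (rule openin_Int)
  moreover have "y \<in> W'" using y(1) openin_subset[OF W(1)] by (auto simp: W'_def coincidence_def)
  moreover have "coincidence K x = coincidence K y" if "x \<in> W'" for x
  proof -
    have "coincidence K y \<subseteq> coincidence K x"
      using that by (auto simp: W'_def coincidence_def)
    then show ?thesis
      using card_seteq[OF fin[of x]] y(2)[of x] that by (auto simp: W'_def)
  qed
  moreover have "W' \<subseteq> W" by (simp add: W'_def)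
  ultimately show ?thesis by (intro exI[of _ W'] exI[of _ y] conjI ballI)
qed

lemma coincidence_sections:
  assumes K: "\<And>V. V \<in> K \<Longrightarrow> open_bisection G V" and V: "V \<in> K" "g \<in> V"
  shows "{V' \<in> K. g \<in> V'} = {V'. (V, V') \<in> coincidence K (src G g)}"
proof (intro equalityI subsetI)
  fix V' assume "V' \<in> {V' \<in> K. g \<in> V'}"
  then show "V' \<in> {V'. (V, V') \<in> coincidence K (src G g)}"
    using V by (auto simp: coincidence_def)
next
  fix V' assume "V' \<in> {V'. (V, V') \<in> coincidence K (src G g)}"
  then obtain h where "V' \<in> K" "h \<in> V" "h \<in> V'" "src G g = src G h"
    by (auto simp: coincidence_def)
  then show "V' \<in> {V' \<in> K. g \<in> V'}"
    using open_bisection_inj[OF K[OF V(1)] V(2)] by blast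
qed

lemma src_supp_empty_interior:
  assumes "f \<in> alg_sing_ideal G"
  shows "base G interior_of (src G ` supp_open G f) = {}"
proof (rule ccontr)
  assume "\<not> ?thesis"
  then obtain W where W: "openin (base G) W" "W \<noteq> {}" "W \<subseteq> src G ` supp_open G f"
    by (auto simp: interior_of_def)
  have f_st: "f \<in> steinberg G" and sing: "arr G interior_of (supp_open G f) = {}"
    using assms by (auto simp: alg_sing_ideal_def)
  obtain K a where K: "finite K" "\<And>V. V \<in> K \<Longrightarrow> open_bisection G V"
      "\<And>g. f g = (\<Sum>V\<in>{V \<in> K. g \<in> V}. a V)"
    using steinberg_eq_sum[OF f_st] by metis
  have open_K: "openin (arr G) V" if "V \<in> K" for V
    using K(2)[OF that] by (simp add: open_bisection_def)
  obtain W' y where W': "openin (base G) W'" "y \<in> W'" "W' \<subseteq> W"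
      "\<forall>x\<in>W'. coincidence K x = coincidence K y"
    using coincidence_locally_constant[OF K(1) open_K W(1,2)] by blast
  have "y \<in> src G ` supp_open G f" using W(3) W'(2,3) by blast
  then obtain g where g: "f g \<noteq> 0" "src G g = y" by (auto simp: supp_open_def)
  have "\<not> (\<forall>V\<in>K. g \<notin> V)"
  proof
    assume "\<forall>V\<in>K. g \<notin> V"
    then have none: "{V \<in> K. g \<in> V} = {}" by blast
    show False using g(1) K(3)[of g] unfolding none by simp
  qed
  then obtain V where V: "V \<in> K" "g \<in> V" by blast
  \<comment> \<open>Along \<open>V\<close> over \<open>W'\<close> the same members of
    \<open>K\<close> contain each point, so \<open>f\<close> keeps the value \<open>f g\<close>. The
    slice is then an open part of the support, which a singular \<open>f\<close> does not
    allow.\<close>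
  have "f h = f g" if "h \<in> restr G V W'" for h
  proof -
    have h: "h \<in> V" "src G h \<in> W'" using that by (auto simp: restr_def)
    have "{V' \<in> K. h \<in> V'} = {V' \<in> K. g \<in> V'}"
      using coincidence_sections[OF K(2) V] coincidence_sections[OF K(2) V(1) h(1)] bspec[OF W'(4) h(2)] g(2)
      by simp
    then show ?thesis unfolding K(3) by (simp only:)
  qed
  then have "restr G V W' \<subseteq> supp_open G f"
    using g(1) steinberg_supp[OF f_st] by fastforce
  moreover have "openin (arr G) (restr G V W')"
    using K(2)[OF V(1)] W'(1) by (intro openin_restr) (auto simp: open_bisection_def)
  moreover have "g \<in> restr G V W'" using V g W' by (simp add: restr_def)
  ultimately show False using sing by (auto simp: interior_of_def)
qed

text \<open>On \<open>U\<close> the indicator is the constant 1, with the compact set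
  \<open>U\<close> as its support. Closure is taken relative to \<open>U\<close>, so it does not
  matter that a compact open set may fail to be closed in a non-Hausdorff arrow space.\<close>

lemma steinberg_Cc: "f \<in> steinberg G \<Longrightarrow> f \<in> Cc G"
proof -
  have "indicator U \<in> Cc_on G U" if "open_bisection G U" "compactin (arr G) U" for U
  proof -
    have top: "topspace (subtopology (arr G) U) = U"
      using open_bisection_subset[OF that(1)] by auto
    have "continuous_map (subtopology (arr G) U) euclidean (indicator U :: _ \<Rightarrow> complex)"
      by (rule continuous_map_eq[of _ _ "\<lambda>_. 1"]) (auto simp: top)
    moreover have "{g \<in> U. (indicator U g :: complex) \<noteq> 0} = U" by (auto simp: indicator_def)
    moreover have "(subtopology (arr G) U) closure_of U = U"
      using closure_of_topspace[of "subtopology (arr G) U"] top by simp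
    ultimately show ?thesis
      using that(2) by (auto simp: Cc_on_def compactin_subtopology)
  qed
  then have "{indicator U | U. open_bisection G U \<and> compactin (arr G) U} \<subseteq> \<Union>{Cc_on G U | U. open_bisection G U}"
    by blast
  then show "f \<in> steinberg G \<Longrightarrow> f \<in> Cc G"
    unfolding steinberg_def Cc_def using cspan.span_mono by blast
qed

lemma alg_sing_zero_if_sing_zero:
  assumes "sing_ideal G = {cstar_zero G}"
  shows "alg_sing_ideal G = {0}"
proof (intro equalityI subsetI)
  fix f assume f: "f \<in> alg_sing_ideal G"
  then have f_st: "f \<in> steinberg G" by (simp add: alg_sing_ideal_def)
  then have Cc: "f \<in> Cc G" by (rule steinberg_Cc)
  define F where "F = red_equiv G `` {\<lambda>n. f}"
  have "supp_open G (cstar_fun G F) = supp_open G f"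
    by (auto simp: supp_open_def F_def cstar_fun_const[OF Cc])
  moreover have "F \<in> Cstar_red G"
    unfolding F_def Cstar_red_def by (intro quotientI const_Cauchy Cc)
  ultimately have "F \<in> sing_ideal G"
    using src_supp_empty_interior[OF f] by (simp add: sing_ideal_def)
  then have "F = cstar_zero G" using assms by simp
  then have "f g = 0" if "g \<in> topspace (arr G)" for g
    using cstar_fun_const[OF Cc that] cstar_fun_zero[OF that] by (simp add: F_def)
  then have "f g = 0" for g
    using steinberg_supp[OF f_st, of g] by (auto simp: supp_open_def)
  then show "f \<in> {0}" by auto
next
  show "f \<in> alg_sing_ideal G" if "f \<in> {0}" for f
    using that by (auto simp: alg_sing_ideal_def steinberg_def supp_open_def intro: cspan.span_zero)
qed

end

section \<open>Words and cylinders\<close>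

definition cyl :: "'a list \<Rightarrow> 'a word set" where
  "cyl v = {\<omega>. prefix (length v) \<omega> = v}"

lemma prefix_extend: "n \<le> m \<Longrightarrow> \<exists>z. prefix m \<omega> = prefix n \<omega> @ z"
  using subsequence_append[where i = n and j = "m - n" and w = \<omega>] by auto

lemma cyl_iff: "\<omega> \<in> cyl v \<longleftrightarrow> (\<exists>\<eta>. \<omega> = v \<frown> \<eta>)"
proof
  assume "\<omega> \<in> cyl v"
  then have "\<omega> = v \<frown> suffix (length v) \<omega>" using prefix_suffix[of \<omega> "length v"] by (simp add: cyl_def)
  then show "\<exists>\<eta>. \<omega> = v \<frown> \<eta>" by blast
next
  assume "\<exists>\<eta>. \<omega> = v \<frown> \<eta>"
  then show "\<omega> \<in> cyl v" by (auto simp: cyl_def)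
qed

lemma bd_dom_cyl: "bd_dom (u, \<gamma>, v) = cyl v"
  using cyl_iff[of _ v] by auto

lemma cyl_append: "\<omega> \<in> cyl (v @ z) \<Longrightarrow> \<omega> \<in> cyl v"
  by (auto simp: cyl_iff conc_conc[symmetric] simp del: conc_conc)

lemma cyl_prefix: "\<omega> \<in> cyl (prefix n \<omega>)"
  by (simp add: cyl_def)

lemma cyl_prefix_mono: "n \<le> m \<Longrightarrow> cyl (prefix m \<omega>) \<subseteq> cyl (prefix n \<omega>)"
  using prefix_extend[of n m \<omega>] cyl_append by fastforce

lemma cyl_prefix_le:
  assumes "\<omega> \<in> cyl v" "length v \<le> n"
  obtains z where "prefix n \<omega> = v @ z"
  using prefix_extend[OF assms(2), of \<omega>] assms(1) by (auto simp: cyl_def)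

lemma word_eqI:
  assumes "\<And>m. \<exists>q. m \<le> length q \<and> \<omega> \<in> cyl q \<and> \<omega>' \<in> cyl q"
  shows "\<omega> = \<omega>'"
proof
  fix i
  obtain q where q: "Suc i \<le> length q" "\<omega> \<in> cyl q" "\<omega>' \<in> cyl q" using assms by blast
  have nth: "\<zeta> i = q ! i" if "\<zeta> \<in> cyl q" for \<zeta>
  proof -
    have "prefix (length q) \<zeta> ! i = \<zeta> i" using q(1) by simp
    moreover have "prefix (length q) \<zeta> = q" using that by (simp add: cyl_def)
    ultimately show ?thesis by (simp only:)
  qed
  show "\<omega> i = \<omega>' i" unfolding nth[OF q(2)] nth[OF q(3)] ..
qed

lemma cyl_iff_nth: "\<omega> \<in> cyl v \<longleftrightarrow> (\<forall>i<length v. \<omega> i = v ! i)"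
proof
  assume \<omega>: "\<omega> \<in> cyl v"
  show "\<forall>i<length v. \<omega> i = v ! i"
  proof (intro allI impI)
    fix i assume "i < length v"
    then have "prefix (length v) \<omega> ! i = \<omega> i" by simp
    moreover have "prefix (length v) \<omega> = v" using \<omega> by (simp add: cyl_def)
    ultimately show "\<omega> i = v ! i" by (simp only:)
  qed
next
  assume "\<forall>i<length v. \<omega> i = v ! i"
  then have "prefix (length v) \<omega> = v" by (intro nth_equalityI) simp_all
  then show "\<omega> \<in> cyl v" by (simp add: cyl_def)
qed

lemma openin_cyl: "openin word_space (cyl v)"
proof -
  have "cyl v = (\<Pi>\<^sub>E i\<in>UNIV. if i < length v then {v ! i} else UNIV)"
  proof -
    have "x \<in> (if b then {y} else UNIV) \<longleftrightarrow> (b \<longrightarrow> x = y)" for b and x y :: 'a by simp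
    then show ?thesis by (auto simp: cyl_iff_nth PiE_iff simp del: split_paired_All)
  qed
  moreover have "finite {i. (if i < length v then {v ! i} else UNIV) \<noteq> UNIV}"
    by (rule finite_subset[of _ "{..<length v}"]) auto
  ultimately show ?thesis
    unfolding word_space_def by (simp add: openin_PiE_gen)
qed

lemma openin_word_cyl:
  assumes "openin word_space W" "\<omega> \<in> W"
  obtains n where "cyl (prefix n \<omega>) \<subseteq> W"
proof -
  obtain U where U: "finite {i. U i \<noteq> UNIV}" "\<omega> \<in> Pi\<^sub>E UNIV U" "Pi\<^sub>E UNIV U \<subseteq> W"
    using assms unfolding word_space_def openin_product_topology_alt by auto
  obtain n where n: "\<And>i. U i \<noteq> UNIV \<Longrightarrow> i < n"
    using U(1) finite_nat_set_iff_bounded by auto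
  have "cyl (prefix n \<omega>) \<subseteq> Pi\<^sub>E UNIV U"
  proof
    fix \<omega>' assume "\<omega>' \<in> cyl (prefix n \<omega>)"
    then have "\<omega>' i = \<omega> i" if "i < n" for i
      using that by (simp add: cyl_iff_nth)
    moreover have "\<omega> i \<in> U i" for i using U(2) by auto
    ultimately have "\<omega>' i \<in> U i" for i using n[of i] by (cases "U i = UNIV") auto
    then show "\<omega>' \<in> Pi\<^sub>E UNIV U" by auto
  qed
  then show thesis using that U(3) by blast
qed

lemma topspace_word_space: "topspace word_space = UNIV"
  by (simp add: word_space_def)

lemma Hausdorff_word_space: "Hausdorff_space word_space"
  by (simp add: word_space_def Hausdorff_space_product_topology Hausdorff_space_discrete_topology)

lemma compact_word_space: "compact_space (word_space :: 'a :: finite word topology)"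
  by (simp add: word_space_def compact_space_product_topology compact_space_discrete_topology)

lemma compactin_cyl: "compactin word_space (cyl (v :: 'a :: finite list))"
proof -
  have "\<omega> \<in> topspace word_space - \<Union>(cyl ` {w. length w = length v \<and> w \<noteq> v}) \<longleftrightarrow> \<omega> \<in> cyl v" for \<omega> :: "'a word"
    by (auto simp: topspace_word_space cyl_def)
  then have eq: "cyl v = topspace word_space - \<Union>(cyl ` {w. length w = length v \<and> w \<noteq> v})" by blast
  have "openin word_space (\<Union>(cyl ` {w. length w = length v \<and> w \<noteq> v}))"
    by (intro openin_Union) (auto simp: openin_cyl)
  then have "closedin word_space (cyl v)"
    by (subst eq) (rule closedin_diff[OF closedin_topspace])
  then show ?thesis using compact_word_space closedin_compact_space by blast
qed

section \<open>Germs of a self-similar group\<close>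

declare pbij.simps [simp del] bd_dom.simps [simp del] bd_act.simps [simp del]

locale self_similar_group =
  fixes \<Gamma> :: "('a :: finite list \<Rightarrow> 'a list) set"
  assumes self_similar: "self_similar \<Gamma>"
begin

abbreviation S where "S \<equiv> triples \<Gamma>"

lemma \<Gamma>_subgroup: "subgroup \<Gamma> tree_Aut"
  using self_similar by (simp add: self_similar_def)

lemma \<Gamma>_Aut: "\<gamma> \<in> \<Gamma> \<Longrightarrow> \<gamma> \<in> carrier tree_Aut"
  by (rule subgroup.mem_carrier[OF \<Gamma>_subgroup])

lemma \<Gamma>_bij: "\<gamma> \<in> \<Gamma> \<Longrightarrow> bij \<gamma>"
  by (drule \<Gamma>_Aut) (simp add: tree_Aut_def)

lemma \<Gamma>_id: "id \<in> \<Gamma>"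
  using subgroup.one_closed[OF \<Gamma>_subgroup] by (simp add: tree_Aut_def)

lemma \<Gamma>_comp: "\<gamma> \<in> \<Gamma> \<Longrightarrow> \<delta> \<in> \<Gamma> \<Longrightarrow> \<gamma> \<circ> \<delta> \<in> \<Gamma>"
  using subgroup.m_closed[OF \<Gamma>_subgroup, of \<gamma> \<delta>] by (simp add: tree_Aut_def)

lemma sect:
  assumes "\<gamma> \<in> \<Gamma>"
  shows "sect \<gamma> x \<in> \<Gamma>" "\<gamma> (x @ w) = \<gamma> x @ sect \<gamma> x w"
proof -
  obtain \<delta> where \<delta>: "\<delta> \<in> \<Gamma>" "\<And>w. \<gamma> (x @ w) = \<gamma> x @ \<delta> w"
    using self_similar assms unfolding self_similar_def by blast
  have "sect \<gamma> x = \<delta>" by (rule sect_eq) (rule \<delta>(2))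
  then show "sect \<gamma> x \<in> \<Gamma>" "\<gamma> (x @ w) = \<gamma> x @ sect \<gamma> x w" using \<delta> by auto
qed

lemma \<Gamma>_Nil: "\<gamma> \<in> \<Gamma> \<Longrightarrow> \<gamma> [] = []"
  by (drule \<Gamma>_Aut) (simp add: tree_Aut_def)

lemma \<Gamma>_length: "\<gamma> \<in> \<Gamma> \<Longrightarrow> length (\<gamma> w) = length w"
proof (induction w arbitrary: \<gamma>)
  case Nil
  then show ?case by (simp add: \<Gamma>_Nil)
next
  case (Cons a w)
  have "\<forall>u v. tree_adj (\<gamma> u) (\<gamma> v) = tree_adj u v"
    using \<Gamma>_Aut[OF Cons.prems] by (simp add: tree_Aut_def)
  then have "tree_adj (\<gamma> []) (\<gamma> [a]) = tree_adj [] [a]" by blast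
  then have "length (\<gamma> [a]) = 1" using \<Gamma>_Nil[OF Cons.prems] by (auto simp: tree_adj_def)
  then show ?case
    using sect(2)[OF Cons.prems, of "[a]" w] Cons.IH[OF sect(1)[OF Cons.prems, of "[a]"]] by simp
qed

lemma prefix_bd_map:
  assumes "\<gamma> \<in> \<Gamma>"
  shows "prefix n (bd_map \<gamma> \<omega>) = \<gamma> (prefix n \<omega>)"
proof (rule nth_equalityI)
  show "length (prefix n (bd_map \<gamma> \<omega>)) = length (\<gamma> (prefix n \<omega>))" by (simp add: \<Gamma>_length[OF assms])
  fix i assume "i < length (prefix n (bd_map \<gamma> \<omega>))"
  then have i: "Suc i \<le> n" by simp
  obtain z where z: "prefix n \<omega> = prefix (Suc i) \<omega> @ z" using prefix_extend[OF i] by blast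
  have "i < length (\<gamma> (prefix (Suc i) \<omega>))" unfolding \<Gamma>_length[OF assms] by simp
  then have "\<gamma> (prefix n \<omega>) ! i = \<gamma> (prefix (Suc i) \<omega>) ! i"
    unfolding z sect(2)[OF assms, of "prefix (Suc i) \<omega>"] by (rule nth_append_left)
  then show "prefix n (bd_map \<gamma> \<omega>) ! i = \<gamma> (prefix n \<omega>) ! i"
    using i by (simp add: bd_map_def)
qed

lemma triples_iff: "(u, \<gamma>, v) \<in> S \<longleftrightarrow> \<gamma> \<in> \<Gamma>"
  by (auto simp: triples_def)

lemma pbij_append: "pbij (u, \<gamma>, v) (v @ w) = Some (u @ \<gamma> w)"
  by (simp add: pbij.simps)

lemma pbij_SomeE:
  assumes "pbij (u, \<gamma>, v) x = Some y"
  obtains w where "x = v @ w" "y = u @ \<gamma> w"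
  using assms by (auto simp: pbij.simps split: if_splits)

lemma pbij_extend:
  assumes "s \<in> S" "pbij s p = Some q"
  obtains \<delta> where "\<delta> \<in> \<Gamma>" "\<And>x. pbij s (p @ x) = Some (q @ \<delta> x)"
proof -
  obtain u \<gamma> v where s: "s = (u, \<gamma>, v)" "\<gamma> \<in> \<Gamma>" using assms(1) by (auto simp: triples_def)
  obtain w where w: "p = v @ w" "q = u @ \<gamma> w" using pbij_SomeE assms(2) s(1) by blast
  have "pbij s (p @ x) = Some (q @ sect \<gamma> w x)" for x
    using pbij_append[of u \<gamma> v "w @ x"] sect(2)[OF s(2)] by (simp add: w s(1))
  then show thesis using that sect(1)[OF s(2)] by blast
qed

lemma pbij_inj:
  assumes "s \<in> S" "pbij s x = Some z" "pbij s y = Some z"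
  shows "x = y"
proof -
  obtain u \<gamma> v where s: "s = (u, \<gamma>, v)" "\<gamma> \<in> \<Gamma>" using assms(1) by (auto simp: triples_def)
  obtain w w' where "x = v @ w" "z = u @ \<gamma> w" "y = v @ w'" "z = u @ \<gamma> w'"
    using pbij_SomeE assms(2,3) s(1) by metis
  then show ?thesis using \<Gamma>_bij[OF s(2)] by (auto dest: bij_is_inj injD)
qed

text \<open>Links the boundary action with the action on finite words: applied to prefixes, it
  determines \<open>bd_act\<close> through \<open>pbij\<close>, so that arguments about germs can
  take place on the tree.\<close>

lemma pbij_cyl:
  assumes "s \<in> S" "\<omega> \<in> cyl p" "pbij s p = Some q"
  shows "\<omega> \<in> bd_dom s" "bd_act s \<omega> \<in> cyl q"
proof -
  obtain u \<gamma> v where s: "s = (u, \<gamma>, v)" "\<gamma> \<in> \<Gamma>" using assms(1) by (auto simp: triples_def)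
  obtain w where w: "p = v @ w" "q = u @ \<gamma> w" using pbij_SomeE assms(3) s(1) by blast
  then show "\<omega> \<in> bd_dom s" using assms(2) cyl_append by (simp add: s(1) bd_dom_cyl)
  obtain \<eta> where "\<omega> = v \<frown> w \<frown> \<eta>" using assms(2) by (auto simp: w cyl_iff)
  then have suf: "suffix (length v) \<omega> = w \<frown> \<eta>" by simp
  have act: "bd_act s \<omega> = u \<frown> bd_map \<gamma> (w \<frown> \<eta>)"
    unfolding s(1) bd_act.simps suf ..
  have "bd_map \<gamma> (w \<frown> \<eta>) \<in> cyl (\<gamma> w)"
    using prefix_bd_map[OF s(2), where n = "length w" and \<omega> = "w \<frown> \<eta>"] by (simp add: cyl_def \<Gamma>_length[OF s(2)])
  then obtain \<zeta> where "bd_map \<gamma> (w \<frown> \<eta>) = \<gamma> w \<frown> \<zeta>" by (auto simp: cyl_iff)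
  then show "bd_act s \<omega> \<in> cyl q" unfolding act by (auto simp: w cyl_iff)
qed

text \<open>The images of prefixes become long as well. The parameter \<open>m\<close> is used to
  reach a depth at which another triple is defined, or at which two triples agree.\<close>

lemma pbij_prefix:
  assumes "s \<in> S" "\<omega> \<in> bd_dom s"
  obtains N where "\<And>n. n \<ge> N \<Longrightarrow> \<exists>q. pbij s (prefix n \<omega>) = Some q \<and> m \<le> length q"
proof -
  obtain u \<gamma> v where s: "s = (u, \<gamma>, v)" "\<gamma> \<in> \<Gamma>" using assms(1) by (auto simp: triples_def)
  have "\<exists>q. pbij s (prefix n \<omega>) = Some q \<and> m \<le> length q" if n: "n \<ge> m + length v" for n
  proof -
    have "\<omega> \<in> cyl v" using assms(2) by (simp add: s(1) bd_dom_cyl)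
    then obtain z where z: "prefix n \<omega> = v @ z" using cyl_prefix_le[of \<omega> v n] n by auto
    have "length (prefix n \<omega>) = n" by simp
    then have "m \<le> length z" using n unfolding z by simp
    then show ?thesis unfolding z s(1) pbij_append by (simp add: \<Gamma>_length[OF s(2)])
  qed
  then show thesis using that by blast
qed

text \<open>
  Two elements of the inverse semigroup have the same germ at \<open>\<omega>\<close> if and only if, as partial
  bijections of the tree, they agree on all extensions of some prefix of \<open>\<omega>\<close>.
\<close>

definition agree :: "'a triple \<Rightarrow> 'a triple \<Rightarrow> 'a list \<Rightarrow> bool" where
  "agree s t p \<longleftrightarrow> (\<forall>x. pbij s (p @ x) = pbij t (p @ x))"

lemma agree_append: "agree s t p \<Longrightarrow> agree s t (p @ z)"
  by (simp add: agree_def)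

lemma agree_prefix: "agree s t (prefix n \<omega>) \<Longrightarrow> n \<le> m \<Longrightarrow> agree s t (prefix m \<omega>)"
  using prefix_extend[of n m \<omega>] agree_append by metis

lemma agree_cyl:
  assumes "agree s t (prefix n \<omega>)" "\<omega> \<in> cyl p" "n \<le> length p"
  shows "agree s t p"
  using agree_prefix[OF assms(1,3)] assms(2) by (simp add: cyl_def)

text \<open>Once a prefix contains both source words, the empty extension gives equality of the
  images, and cancelling these gives equality of the sections; conversely, these two equalities
  determine the values at all extensions.\<close>

lemma germ_rel_iff:
  "((s, \<omega>), (t, \<omega>')) \<in> germ_rel \<Gamma> \<longleftrightarrow> s \<in> S \<and> t \<in> S \<and> \<omega> \<in> bd_dom s \<and>
    \<omega> \<in> bd_dom t \<and> \<omega>' = \<omega> \<and> (\<exists>n. agree s t (prefix n \<omega>))"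
proof -
  obtain u1 \<gamma>1 v1 u2 \<gamma>2 v2 where s: "s = (u1, \<gamma>1, v1)" and t: "t = (u2, \<gamma>2, v2)"
    using prod_cases3 by metis
  have "(\<exists>w z1 z2 \<eta>. \<omega> = w \<frown> \<eta> \<and> w = v1 @ z1 \<and> w = v2 @ z2 \<and>
      u1 @ \<gamma>1 z1 = u2 @ \<gamma>2 z2 \<and> sect \<gamma>1 z1 = sect \<gamma>2 z2) \<longleftrightarrow> (\<exists>n. agree s t (prefix n \<omega>))"
    if \<Gamma>: "\<gamma>1 \<in> \<Gamma>" "\<gamma>2 \<in> \<Gamma>" and dom: "\<omega> \<in> cyl v1" "\<omega> \<in> cyl v2"
  proof
    assume "\<exists>w z1 z2 \<eta>. \<omega> = w \<frown> \<eta> \<and> w = v1 @ z1 \<and> w = v2 @ z2 \<and>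
      u1 @ \<gamma>1 z1 = u2 @ \<gamma>2 z2 \<and> sect \<gamma>1 z1 = sect \<gamma>2 z2"
    then obtain w z1 z2 \<eta> where w: "\<omega> = w \<frown> \<eta>" "w = v1 @ z1" "w = v2 @ z2"
      and eq: "u1 @ \<gamma>1 z1 = u2 @ \<gamma>2 z2" "sect \<gamma>1 z1 = sect \<gamma>2 z2" by blast
    have "pbij s (w @ x) = Some (u1 @ \<gamma>1 z1 @ sect \<gamma>1 z1 x)" for x
      using pbij_append[of u1 \<gamma>1 v1 "z1 @ x"] sect(2)[OF \<Gamma>(1)] by (simp add: w(2) s)
    moreover have "pbij t (w @ x) = Some (u2 @ \<gamma>2 z2 @ sect \<gamma>2 z2 x)" for x
      using pbij_append[of u2 \<gamma>2 v2 "z2 @ x"] sect(2)[OF \<Gamma>(2)] by (simp add: w(3) t)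
    ultimately have "agree s t w"
      unfolding agree_def using eq by (metis append_assoc)
    moreover have "prefix (length w) \<omega> = w" by (simp add: w(1))
    ultimately show "\<exists>n. agree s t (prefix n \<omega>)" by metis
  next
    assume "\<exists>n. agree s t (prefix n \<omega>)"
    then obtain n where n: "agree s t (prefix n \<omega>)" by blast
    define m where "m = max n (max (length v1) (length v2))"
    define w where "w = prefix m \<omega>"
    have ag: "agree s t w" unfolding w_def by (rule agree_prefix[OF n]) (simp add: m_def)
    have "length v1 \<le> m" by (simp add: m_def)
    then obtain z1 where z1: "w = v1 @ z1" unfolding w_def using cyl_prefix_le[OF dom(1)] by blast
    have "length v2 \<le> m" by (simp add: m_def)
    then obtain z2 where z2: "w = v2 @ z2" unfolding w_def using cyl_prefix_le[OF dom(2)] by blast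
    have 1: "pbij s (w @ x) = Some (u1 @ \<gamma>1 z1 @ sect \<gamma>1 z1 x)" for x
      using pbij_append[of u1 \<gamma>1 v1 "z1 @ x"] sect(2)[OF \<Gamma>(1)] by (simp add: z1 s)
    have 2: "pbij t (w @ x) = Some (u2 @ \<gamma>2 z2 @ sect \<gamma>2 z2 x)" for x
      using pbij_append[of u2 \<gamma>2 v2 "z2 @ x"] sect(2)[OF \<Gamma>(2)] by (simp add: z2 t)
    have eq: "(u1 @ \<gamma>1 z1) @ sect \<gamma>1 z1 x = (u2 @ \<gamma>2 z2) @ sect \<gamma>2 z2 x" for x
      using ag 1[of x] 2[of x] unfolding agree_def by simp
    \<comment> \<open>Sections fix the root, so the empty extension isolates the two leading
      words.\<close>
    have "u1 @ \<gamma>1 z1 = u2 @ \<gamma>2 z2"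
      using eq[of "[]"] \<Gamma>_Nil[OF sect(1)[OF \<Gamma>(1)]] \<Gamma>_Nil[OF sect(1)[OF \<Gamma>(2)]] by simp
    moreover then have "sect \<gamma>1 z1 = sect \<gamma>2 z2"
      using eq by (metis ext same_append_eq)
    ultimately show "\<exists>w z1 z2 \<eta>. \<omega> = w \<frown> \<eta> \<and> w = v1 @ z1 \<and> w = v2 @ z2 \<and>
      u1 @ \<gamma>1 z1 = u2 @ \<gamma>2 z2 \<and> sect \<gamma>1 z1 = sect \<gamma>2 z2"
      using z1 z2 prefix_suffix[of \<omega> m] unfolding w_def by metis
  qed
  then show ?thesis
    unfolding germ_rel_def s t by (auto simp: triples_iff bd_dom_cyl)
qed

lemma germ_eq_iff:
  assumes "s \<in> S" "t \<in> S" "\<omega> \<in> bd_dom s" "\<omega>' \<in> bd_dom t"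
  shows "germ \<Gamma> s \<omega> = germ \<Gamma> t \<omega>' \<longleftrightarrow> \<omega>' = \<omega> \<and> (\<exists>n. agree s t (prefix n \<omega>))"
proof
  assume "germ \<Gamma> s \<omega> = germ \<Gamma> t \<omega>'"
  moreover have "(t, \<omega>') \<in> germ \<Gamma> t \<omega>'"
    using assms by (auto simp: germ_def germ_rel_iff agree_def)
  ultimately have "(t, \<omega>') \<in> germ \<Gamma> s \<omega>" by simp
  then show "\<omega>' = \<omega> \<and> (\<exists>n. agree s t (prefix n \<omega>))" by (auto simp: germ_def germ_rel_iff)
next
  assume r: "\<omega>' = \<omega> \<and> (\<exists>n. agree s t (prefix n \<omega>))"
  then obtain n where n: "agree s t (prefix n \<omega>)" by blast
  have "(\<exists>k. agree s \<rho> (prefix k \<omega>)) \<longleftrightarrow> (\<exists>k. agree t \<rho> (prefix k \<omega>))" for \<rho>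
  proof
    assume "\<exists>k. agree s \<rho> (prefix k \<omega>)"
    then obtain k where "agree s \<rho> (prefix k \<omega>)" by blast
    then have "agree s \<rho> (prefix (max n k) \<omega>)" "agree s t (prefix (max n k) \<omega>)"
      using n agree_prefix by auto
    then show "\<exists>k. agree t \<rho> (prefix k \<omega>)" unfolding agree_def by metis
  next
    assume "\<exists>k. agree t \<rho> (prefix k \<omega>)"
    then obtain k where "agree t \<rho> (prefix k \<omega>)" by blast
    then have "agree t \<rho> (prefix (max n k) \<omega>)" "agree s t (prefix (max n k) \<omega>)"
      using n agree_prefix by auto
    then show "\<exists>k. agree s \<rho> (prefix k \<omega>)" unfolding agree_def by metis
  qed
  then have "(\<rho>, \<zeta>) \<in> germ \<Gamma> s \<omega> \<longleftrightarrow> (\<rho>, \<zeta>) \<in> germ \<Gamma> t \<omega>'" for \<rho> \<zeta>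
    using r assms unfolding germ_def by (auto simp: germ_rel_iff)
  then show "germ \<Gamma> s \<omega> = germ \<Gamma> t \<omega>'" by auto
qed

lemma germ_mem_iff: "(t, \<omega>') \<in> germ \<Gamma> s \<omega> \<longleftrightarrow> s \<in> S \<and> t \<in> S \<and> \<omega> \<in> bd_dom s \<and>
    \<omega> \<in> bd_dom t \<and> \<omega>' = \<omega> \<and> (\<exists>n. agree s t (prefix n \<omega>))"
  by (simp add: germ_def germ_rel_iff)

lemma germ_self: "s \<in> S \<Longrightarrow> \<omega> \<in> bd_dom s \<Longrightarrow> (s, \<omega>) \<in> germ \<Gamma> s \<omega>"
  by (auto simp: germ_mem_iff agree_def)

lemma agree_bd_act:
  assumes "s \<in> S" "t \<in> S" "\<omega> \<in> bd_dom s" and n: "agree s t (prefix n \<omega>)"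
  shows "bd_act s \<omega> = bd_act t \<omega>"
proof (rule word_eqI)
  fix m
  obtain N where N: "\<And>n. n \<ge> N \<Longrightarrow> \<exists>q. pbij s (prefix n \<omega>) = Some q \<and> m \<le> length q"
    using pbij_prefix[OF assms(1,3)] by blast
  obtain q where q: "pbij s (prefix (max n N) \<omega>) = Some q" "m \<le> length q" using N[of "max n N"] by auto
  have "agree s t (prefix (max n N) \<omega>)" using n by (rule agree_prefix) simp
  then have "pbij s (prefix (max n N) \<omega> @ []) = pbij t (prefix (max n N) \<omega> @ [])"
    unfolding agree_def by blast
  then have "pbij t (prefix (max n N) \<omega>) = Some q" using q(1) by simp
  then show "\<exists>q. m \<le> length q \<and> bd_act s \<omega> \<in> cyl q \<and> bd_act t \<omega> \<in> cyl q"
    using q pbij_cyl(2)[OF _ cyl_prefix] assms(1,2) by blast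
qed

lemma germ_src: "s \<in> S \<Longrightarrow> \<omega> \<in> bd_dom s \<Longrightarrow> germ_src (germ \<Gamma> s \<omega>) = \<omega>"
  unfolding germ_src_def using germ_self by (intro the_equality) (blast, auto simp: germ_mem_iff)

lemma germ_rng:
  assumes "s \<in> S" "\<omega> \<in> bd_dom s"
  shows "germ_rng (germ \<Gamma> s \<omega>) = bd_act s \<omega>"
  unfolding germ_rng_def
proof (rule the_equality)
  show "\<exists>s' \<omega>'. (s', \<omega>') \<in> germ \<Gamma> s \<omega> \<and> bd_act s \<omega> = bd_act s' \<omega>'"
    using germ_self[OF assms] by blast
  fix \<eta> assume "\<exists>s' \<omega>'. (s', \<omega>') \<in> germ \<Gamma> s \<omega> \<and> \<eta> = bd_act s' \<omega>'"
  then obtain t \<omega>' n where "t \<in> S" "\<omega>' = \<omega>" "agree s t (prefix n \<omega>)" "\<eta> = bd_act t \<omega>'"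
    by (auto simp: germ_mem_iff)
  then show "\<eta> = bd_act s \<omega>" using agree_bd_act[OF assms(1) _ assms(2)] by simp
qed

subsection \<open>The product of germs\<close>

definition composite :: "'a triple \<Rightarrow> 'a triple \<Rightarrow> 'a triple \<Rightarrow> 'a word \<Rightarrow> bool" where
  "composite s t \<rho> \<omega> \<longleftrightarrow> s \<in> S \<and> t \<in> S \<and> \<rho> \<in> S \<and> \<omega> \<in> bd_dom t \<and>
     bd_act t \<omega> \<in> bd_dom s \<and> pbij \<rho> = pbij s \<circ>\<^sub>m pbij t"

lemma compositeD:
  assumes "composite s t \<rho> \<omega>"
  shows "s \<in> S" "t \<in> S" "\<rho> \<in> S" "\<omega> \<in> bd_dom t" "bd_act t \<omega> \<in> bd_dom s"
    "pbij \<rho> = pbij s \<circ>\<^sub>m pbij t"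
  using assms by (simp_all add: composite_def)

lemma pbij_comp_dom:
  assumes comp: "composite s t \<rho> \<omega>"
  shows "\<exists>N. \<forall>n\<ge>N. (\<exists>q. pbij t (prefix n \<omega>) = Some q \<and> m \<le> length q) \<and>
    (\<exists>r. pbij \<rho> (prefix n \<omega>) = Some r \<and> m \<le> length r \<and> bd_act s (bd_act t \<omega>) \<in> cyl r)"
proof -
  note a = compositeD[OF comp]
  obtain M where M: "\<And>n. n \<ge> M \<Longrightarrow> \<exists>q. pbij s (prefix n (bd_act t \<omega>)) = Some q \<and> m \<le> length q"
    using pbij_prefix[OF a(1,5)] by blast
  obtain N where N: "\<And>n. n \<ge> N \<Longrightarrow> \<exists>q. pbij t (prefix n \<omega>) = Some q \<and> max m M \<le> length q"
    using pbij_prefix[OF a(2,4)] by blast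
  have "\<exists>r. pbij \<rho> (prefix n \<omega>) = Some r \<and> m \<le> length r \<and> bd_act s (bd_act t \<omega>) \<in> cyl r" if "n \<ge> N" for n
  proof -
    obtain q where q: "pbij t (prefix n \<omega>) = Some q" "max m M \<le> length q" using N[OF \<open>n \<ge> N\<close>] by blast
    have c: "bd_act t \<omega> \<in> cyl q" by (rule pbij_cyl(2)[OF a(2) cyl_prefix q(1)])
    then have "prefix (length q) (bd_act t \<omega>) = q" by (simp add: cyl_def)
    moreover have "M \<le> length q" using q(2) by simp
    ultimately obtain r where r: "pbij s q = Some r" "m \<le> length r" using M by metis
    have "bd_act s (bd_act t \<omega>) \<in> cyl r" by (rule pbij_cyl(2)[OF a(1) c r(1)])
    moreover have "pbij \<rho> (prefix n \<omega>) = Some r" by (simp add: a(6) q(1) r(1) map_comp_def)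
    ultimately show ?thesis using r by blast
  qed
  moreover have "\<exists>q. pbij t (prefix n \<omega>) = Some q \<and> m \<le> length q" if "n \<ge> N" for n
    using N[OF that] by auto
  ultimately show ?thesis by blast
qed

lemma comp_dom:
  assumes comp: "composite s t \<rho> \<omega>"
  shows "\<omega> \<in> bd_dom \<rho>" "bd_act \<rho> \<omega> = bd_act s (bd_act t \<omega>)"
proof -
  note \<rho> = compositeD(3)[OF comp]
  have ex: "\<exists>N r. pbij \<rho> (prefix N \<omega>) = Some r \<and> m \<le> length r \<and> bd_act s (bd_act t \<omega>) \<in> cyl r" for m
    using pbij_comp_dom[OF comp, of m] by blast
  from ex[of 0] obtain N r where "pbij \<rho> (prefix N \<omega>) = Some r" by blast
  then show "\<omega> \<in> bd_dom \<rho>" by (rule pbij_cyl(1)[OF \<rho> cyl_prefix])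
  show "bd_act \<rho> \<omega> = bd_act s (bd_act t \<omega>)"
  proof (rule word_eqI)
    fix m
    from ex obtain N r where r: "pbij \<rho> (prefix N \<omega>) = Some r" "m \<le> length r" "bd_act s (bd_act t \<omega>) \<in> cyl r"
      by blast
    then show "\<exists>q. m \<le> length q \<and> bd_act \<rho> \<omega> \<in> cyl q \<and> bd_act s (bd_act t \<omega>) \<in> cyl q"
      using pbij_cyl(2)[OF \<rho> cyl_prefix r(1)] by blast
  qed
qed

text \<open>The definite description requires independence of representatives. If \<open>t\<close>
  and \<open>t'\<close> agree below a prefix of \<omega>, and \<open>s\<close> and \<open>s'\<close>
  below a prefix of its image, then a prefix \<open>p\<close> is taken so long that its image
  \<open>q\<close> reaches the second depth; both composites agree below \<open>p\<close>.\<close>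

lemma germ_comp_eq:
  assumes comp: "composite s t \<rho> \<omega>"
  shows "germ_comp \<Gamma> (germ \<Gamma> s (bd_act t \<omega>)) (germ \<Gamma> t \<omega>) = germ \<Gamma> \<rho> \<omega>"
proof -
  note a = compositeD[OF comp]
  have eq: "k = germ \<Gamma> \<rho> \<omega>"
    if comp': "composite s' t' \<rho>' \<omega>'" and g: "germ \<Gamma> s (bd_act t \<omega>) = germ \<Gamma> s' (bd_act t' \<omega>')"
      and h: "germ \<Gamma> t \<omega> = germ \<Gamma> t' \<omega>'" and k: "k = germ \<Gamma> \<rho>' \<omega>'" for s' t' \<rho>' \<omega>' k
  proof -
    note a' = compositeD[OF comp']
    obtain n1 where \<omega>': "\<omega>' = \<omega>" and n1: "agree t t' (prefix n1 \<omega>)"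
      using h germ_eq_iff[OF a(2) a'(2) a(4) a'(4)] by blast
    obtain m where m: "agree s s' (prefix m (bd_act t \<omega>))"
      using g germ_eq_iff[OF a(1) a'(1) a(5) a'(5)] by blast
    obtain N where N: "\<And>n. n \<ge> N \<Longrightarrow> \<exists>q. pbij t (prefix n \<omega>) = Some q \<and> m \<le> length q"
      using pbij_prefix[OF a(2,4)] by blast
    define p where "p = prefix (max n1 N) \<omega>"
    obtain q where q: "pbij t p = Some q" "m \<le> length q" using N[of "max n1 N"] by (auto simp: p_def)
    have "bd_act t \<omega> \<in> cyl q" by (rule pbij_cyl(2)[OF a(2) _ q(1)]) (simp add: p_def cyl_prefix)
    then have agq: "agree s s' q" by (rule agree_cyl[OF m _ q(2)])
    have agp: "agree t t' p" unfolding p_def by (rule agree_prefix[OF n1]) simp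
    obtain \<delta> where \<delta>: "\<And>x. pbij t (p @ x) = Some (q @ \<delta> x)" using pbij_extend[OF a(2) q(1)] by blast
    have "pbij \<rho> (p @ x) = pbij \<rho>' (p @ x)" for x
    proof -
      have "pbij t' (p @ x) = Some (q @ \<delta> x)" using agp \<delta>[of x] by (simp add: agree_def)
      then show ?thesis using agq \<delta>[of x] by (simp add: a(6) a'(6) map_comp_def agree_def)
    qed
    then have "agree \<rho> \<rho>' (prefix (max n1 N) \<omega>)" by (simp add: agree_def p_def)
    then have "germ \<Gamma> \<rho> \<omega> = germ \<Gamma> \<rho>' \<omega>'"
      using germ_eq_iff[OF a(3) a'(3) comp_dom(1)[OF comp] comp_dom(1)[OF comp']] \<omega>' by blast
    then show ?thesis using k by simp
  qed
  show ?thesis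
    unfolding germ_comp_def
  proof (rule the_equality)
    show "\<exists>s'\<in>S. \<exists>t'\<in>S. \<exists>\<rho>'\<in>S. \<exists>\<omega>'.
        \<omega>' \<in> bd_dom t' \<and> bd_act t' \<omega>' \<in> bd_dom s' \<and> pbij \<rho>' = pbij s' \<circ>\<^sub>m pbij t' \<and>
        germ \<Gamma> s (bd_act t \<omega>) = germ \<Gamma> s' (bd_act t' \<omega>') \<and> germ \<Gamma> t \<omega> = germ \<Gamma> t' \<omega>' \<and>
        germ \<Gamma> \<rho> \<omega> = germ \<Gamma> \<rho>' \<omega>'"
      using a by blast
  qed (use eq in \<open>auto simp: composite_def\<close>)
qed

text \<open>The restriction of the partial bijection to the words below \<open>p\<close>, again
  written as a triple: for \<open>p = v @ z\<close> the source word becomes \<open>p\<close>, the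
  group element its section at \<open>z\<close>, and the target word absorbs the image of
  \<open>z\<close>.\<close>

definition rst :: "'a triple \<Rightarrow> 'a list \<Rightarrow> 'a triple" where
  "rst s p = (case s of (u, \<gamma>, v) \<Rightarrow> (u @ \<gamma> (drop (length v) p), sect \<gamma> (drop (length v) p), p))"

lemma rst:
  assumes "s \<in> S" "pbij s p = Some q"
  shows "rst s p = (q, fst (snd (rst s p)), p)" "rst s p \<in> S" "agree (rst s p) s p"
    "bd_dom (rst s p) = cyl p" "\<And>\<omega>. \<omega> \<in> cyl p \<Longrightarrow> germ \<Gamma> (rst s p) \<omega> = germ \<Gamma> s \<omega>"
proof -
  obtain u \<gamma> v where s: "s = (u, \<gamma>, v)" "\<gamma> \<in> \<Gamma>" using assms(1) by (auto simp: triples_def)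
  obtain w where w: "p = v @ w" "q = u @ \<gamma> w" using pbij_SomeE assms(2) s(1) by blast
  have r: "rst s p = (q, sect \<gamma> w, p)" by (simp add: rst_def s(1) w)
  then show "rst s p = (q, fst (snd (rst s p)), p)" "bd_dom (rst s p) = cyl p"
    by (simp_all add: bd_dom_cyl)
  show t: "rst s p \<in> S" using sect(1)[OF s(2)] by (simp add: r triples_iff)
  show ag: "agree (rst s p) s p"
  proof -
    have "pbij s (p @ x) = Some (q @ sect \<gamma> w x)" for x
      using pbij_append[of u \<gamma> v "w @ x"] sect(2)[OF s(2), of w x] by (simp add: w s(1))
    then show ?thesis unfolding agree_def r pbij_append by simp
  qed
  show "germ \<Gamma> (rst s p) \<omega> = germ \<Gamma> s \<omega>" if "\<omega> \<in> cyl p" for \<omega>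
  proof -
    have "\<omega> \<in> bd_dom s" by (rule pbij_cyl(1)[OF assms(1) that assms(2)])
    moreover have "agree (rst s p) s (prefix (length p) \<omega>)" using ag that by (simp add: cyl_def)
    moreover have "\<omega> \<in> bd_dom (rst s p)" using that by (simp add: r bd_dom_cyl)
    ultimately show ?thesis using germ_eq_iff[OF t assms(1)] by blast
  qed
qed

text \<open>Restricting \<open>t\<close> to a long prefix \<open>p\<close> with image
  \<open>q\<close>, and \<open>s\<close> to \<open>q\<close>, makes the two inner words equal. The
  composite is then simply the triple with group element \<gamma> \<circ> \<delta>; no comparison of
  the original inner words and no inverse section is involved.\<close>

lemma composable_cases:
  assumes s: "s \<in> S" and t: "t \<in> S" and \<omega>: "\<omega> \<in> bd_dom t" "bd_act t \<omega> \<in> bd_dom s"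
  obtains s' t' \<rho> where "composite s' t' \<rho> \<omega>"
    "germ \<Gamma> s' (bd_act t' \<omega>) = germ \<Gamma> s (bd_act t \<omega>)" "germ \<Gamma> t' \<omega> = germ \<Gamma> t \<omega>"
proof -
  obtain M where M: "\<And>n. n \<ge> M \<Longrightarrow> \<exists>q. pbij s (prefix n (bd_act t \<omega>)) = Some q \<and> 0 \<le> length q"
    using pbij_prefix[OF s \<omega>(2)] by blast
  obtain N where "\<And>n. n \<ge> N \<Longrightarrow> \<exists>q. pbij t (prefix n \<omega>) = Some q \<and> M \<le> length q"
    using pbij_prefix[OF t \<omega>(1)] by blast
  then obtain q where q: "pbij t (prefix N \<omega>) = Some q" "M \<le> length q" by blast
  define p where "p = prefix N \<omega>"
  have c: "bd_act t \<omega> \<in> cyl q" by (rule pbij_cyl(2)[OF t cyl_prefix q(1)])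
  then have "prefix (length q) (bd_act t \<omega>) = q" by (simp add: cyl_def)
  then obtain r where r: "pbij s q = Some r" using M[OF q(2)] by auto
  have q': "pbij t p = Some q" using q(1) by (simp add: p_def)
  note R = rst[OF t q'] and S = rst[OF s r]
  obtain \<gamma> \<delta> where \<gamma>: "rst s q = (r, \<gamma>, q)" and \<delta>: "rst t p = (q, \<delta>, p)" using R(1) S(1) by blast
  have \<Gamma>: "\<gamma> \<in> \<Gamma>" "\<delta> \<in> \<Gamma>" using R(2) S(2) by (simp_all add: \<gamma> \<delta> triples_iff)
  have "pbij (r, \<gamma> \<circ> \<delta>, p) x = (pbij (rst s q) \<circ>\<^sub>m pbij (rst t p)) x" for x
  proof (cases "\<exists>w. x = p @ w")
    case True
    then obtain w where "x = p @ w" by blast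
    then show ?thesis unfolding \<gamma> \<delta> by (simp add: map_comp_def pbij_append)
  next
    case False
    then show ?thesis unfolding \<gamma> \<delta> by (simp add: map_comp_def pbij.simps)
  qed
  then have comp: "pbij (r, \<gamma> \<circ> \<delta>, p) = pbij (rst s q) \<circ>\<^sub>m pbij (rst t p)" ..
  have \<omega>p: "\<omega> \<in> cyl p" by (simp add: p_def cyl_prefix)
  then have dom: "\<omega> \<in> bd_dom (rst t p)" by (simp add: R(4))
  have "agree (rst t p) t (prefix N \<omega>)" using R(3) by (simp add: p_def)
  then have act: "bd_act (rst t p) \<omega> = bd_act t \<omega>" by (rule agree_bd_act[OF R(2) t dom])
  have "bd_act (rst t p) \<omega> \<in> bd_dom (rst s q)" using c by (simp add: act S(4))
  then have "composite (rst s q) (rst t p) (r, \<gamma> \<circ> \<delta>, p) \<omega>"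
    using S(2) R(2) dom comp \<Gamma>_comp[OF \<Gamma>] by (simp add: composite_def triples_iff)
  then show thesis
  proof (rule that)
    show "germ \<Gamma> (rst s q) (bd_act (rst t p) \<omega>) = germ \<Gamma> s (bd_act t \<omega>)" unfolding act by (rule S(5)[OF c])
    show "germ \<Gamma> (rst t p) \<omega> = germ \<Gamma> t \<omega>" by (rule R(5)[OF \<omega>p])
  qed
qed

section \<open>The attached groupoid is ample\<close>

lemma length_pbij:
  assumes "(u, \<gamma>, v) \<in> S" "pbij (u, \<gamma>, v) x = Some y"
  shows "length y + length v = length x + length u"
proof -
  obtain w where "x = v @ w" "y = u @ \<gamma> w" by (rule pbij_SomeE[OF assms(2)])
  then show ?thesis using \<Gamma>_length[of \<gamma> w] assms(1) by (simp add: triples_iff)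
qed

text \<open>A triple shifts lengths by a constant, so the images of prefixes of equal length have
  equal length. Being prefixes of the same infinite word they are equal, and injectivity of
  \<open>pbij\<close> applies.\<close>

lemma bd_act_inj:
  assumes "s \<in> S" "\<omega> \<in> bd_dom s" "\<omega>' \<in> bd_dom s" "bd_act s \<omega> = bd_act s \<omega>'"
  shows "\<omega> = \<omega>'"
proof (rule word_eqI)
  fix m
  obtain u \<gamma> v where s: "s = (u, \<gamma>, v)" by (rule prod_cases3)
  obtain N where N: "\<And>n. n \<ge> N \<Longrightarrow> \<exists>q. pbij s (prefix n \<omega>) = Some q \<and> 0 \<le> length q"
    using pbij_prefix[OF assms(1,2)] by blast
  obtain N' where N': "\<And>n. n \<ge> N' \<Longrightarrow> \<exists>q. pbij s (prefix n \<omega>') = Some q \<and> 0 \<le> length q"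
    using pbij_prefix[OF assms(1,3)] by blast
  define n where "n = max m (max N N')"
  have "N \<le> n" "N' \<le> n" by (simp_all add: n_def)
  obtain q where q: "pbij s (prefix n \<omega>) = Some q" using N[OF \<open>N \<le> n\<close>] by blast
  obtain q' where q': "pbij s (prefix n \<omega>') = Some q'" using N'[OF \<open>N' \<le> n\<close>] by blast
  have "length q = length q'"
    using length_pbij[OF assms(1)[unfolded s] q[unfolded s]] length_pbij[OF assms(1)[unfolded s] q'[unfolded s]]
    by simp
  moreover have "bd_act s \<omega> \<in> cyl q" "bd_act s \<omega> \<in> cyl q'"
    using pbij_cyl(2)[OF assms(1) cyl_prefix q] pbij_cyl(2)[OF assms(1) cyl_prefix q'] assms(4) by simp_all
  ultimately have "q = q'" by (simp add: cyl_def)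
  then have "prefix n \<omega> = prefix n \<omega>'" using pbij_inj[OF assms(1) q] q' by blast
  then have "\<omega>' \<in> cyl (prefix n \<omega>)" by (metis cyl_prefix)
  moreover have "m \<le> length (prefix n \<omega>)" by (simp add: n_def)
  ultimately show "\<exists>q. m \<le> length q \<and> \<omega> \<in> cyl q \<and> \<omega>' \<in> cyl q" using cyl_prefix by blast
qed

abbreviation basis_sets :: "'a germ set set" where
  "basis_sets \<equiv> {{germ \<Gamma> s \<omega> | \<omega>. \<omega> \<in> W} | s W. s \<in> S \<and> openin word_space W \<and> W \<subseteq> bd_dom s}"

lemma openin_bd_dom: "openin word_space (bd_dom s)"
  by (cases s) (simp add: bd_dom_cyl openin_cyl)

lemma openin_germ_image:
  assumes "s \<in> S" "openin word_space W" "W \<subseteq> bd_dom s"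
  shows "openin (germ_top \<Gamma>) (germ \<Gamma> s ` W)"
proof -
  have "germ \<Gamma> s ` W = {germ \<Gamma> s \<omega> | \<omega>. \<omega> \<in> W}" by blast
  then have "germ \<Gamma> s ` W \<in> basis_sets" using assms by blast
  then show ?thesis unfolding germ_top_def by (rule topology_generated_by_Basis)
qed

lemma topspace_germ_iff:
  "g \<in> topspace (germ_top \<Gamma>) \<longleftrightarrow> (\<exists>s\<in>S. \<exists>\<omega>\<in>bd_dom s. g = germ \<Gamma> s \<omega>)"
proof
  assume "g \<in> topspace (germ_top \<Gamma>)"
  then have "g \<in> \<Union>basis_sets" unfolding germ_top_def topology_generated_by_topspace .
  then show "\<exists>s\<in>S. \<exists>\<omega>\<in>bd_dom s. g = germ \<Gamma> s \<omega>" by blast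
next
  assume "\<exists>s\<in>S. \<exists>\<omega>\<in>bd_dom s. g = germ \<Gamma> s \<omega>"
  then obtain s \<omega> where g: "s \<in> S" "\<omega> \<in> bd_dom s" "g = germ \<Gamma> s \<omega>" by blast
  have "openin (germ_top \<Gamma>) (germ \<Gamma> s ` bd_dom s)"
    by (rule openin_germ_image[OF g(1) openin_bd_dom order_refl])
  then show "g \<in> topspace (germ_top \<Gamma>)" using g openin_subset by blast
qed

lemma germ_in_topspace: "s \<in> S \<Longrightarrow> \<omega> \<in> bd_dom s \<Longrightarrow> germ \<Gamma> s \<omega> \<in> topspace (germ_top \<Gamma>)"
  using topspace_germ_iff by blast

text \<open>The topology is given by a subbasis, and the induction shows that slices over cylinders,
  taken with one fixed representative \<open>s\<close>, already form a neighbourhood base at the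
  germ. For a generating slice of another triple \<open>t\<close>, agreement below a prefix turns a
  small slice of \<open>s\<close> into one of \<open>t\<close>.\<close>

lemma germ_nbhd:
  assumes "openin (germ_top \<Gamma>) V" "s \<in> S" "\<omega> \<in> bd_dom s" "germ \<Gamma> s \<omega> \<in> V"
  shows "\<exists>n. cyl (prefix n \<omega>) \<subseteq> bd_dom s \<and> germ \<Gamma> s ` cyl (prefix n \<omega>) \<subseteq> V"
proof -
  have "generate_topology_on basis_sets V"
    using assms(1) unfolding germ_top_def openin_topology_generated_by_iff .
  then show ?thesis
    using assms(4)
  proof induction
    case Empty
    then show ?case by simp
  next
    case (Int A B)
    then obtain n m where n: "cyl (prefix n \<omega>) \<subseteq> bd_dom s" "germ \<Gamma> s ` cyl (prefix n \<omega>) \<subseteq> A"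
      and m: "germ \<Gamma> s ` cyl (prefix m \<omega>) \<subseteq> B" by blast
    have "cyl (prefix (max n m) \<omega>) \<subseteq> cyl (prefix n \<omega>)" "cyl (prefix (max n m) \<omega>) \<subseteq> cyl (prefix m \<omega>)"
      by (simp_all add: cyl_prefix_mono)
    then show ?case using n m by (intro exI[of _ "max n m"]) blast
  next
    case (UN K)
    then show ?case by (meson Union_iff Union_upper order_trans)
  next
    case (Basis A)
    then obtain t W where t: "t \<in> S" and W: "openin word_space W" "W \<subseteq> bd_dom t"
      and A: "A = {germ \<Gamma> t \<omega> | \<omega>. \<omega> \<in> W}" by blast
    obtain \<omega>' where "germ \<Gamma> s \<omega> = germ \<Gamma> t \<omega>'" "\<omega>' \<in> W" using Basis.prems A by blast
    then have \<omega>: "\<omega> \<in> W" and "\<exists>n. agree s t (prefix n \<omega>)"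
      using germ_eq_iff[OF assms(2) t assms(3)] W(2) by blast+
    then obtain n1 where n1: "agree s t (prefix n1 \<omega>)" by blast
    obtain n2 where n2: "cyl (prefix n2 \<omega>) \<subseteq> W \<inter> bd_dom s"
      using openin_word_cyl[of "W \<inter> bd_dom s" \<omega>] W(1) openin_bd_dom \<omega> assms(3) by blast
    define n where "n = max n1 n2"
    have c2: "cyl (prefix n \<omega>) \<subseteq> W \<inter> bd_dom s"
      by (rule order_trans[OF cyl_prefix_mono n2]) (simp add: n_def)
    have ag: "agree s t (prefix n \<omega>)" by (rule agree_prefix[OF n1]) (simp add: n_def)
    have "germ \<Gamma> s \<eta> \<in> A" if \<eta>: "\<eta> \<in> cyl (prefix n \<omega>)" for \<eta>
    proof -
      have "prefix n \<eta> = prefix n \<omega>" using \<eta> by (simp add: cyl_def)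
      then have "agree s t (prefix n \<eta>)" using ag by simp
      then have "germ \<Gamma> s \<eta> = germ \<Gamma> t \<eta>"
        using germ_eq_iff[OF assms(2) t] c2 \<eta> W(2) by blast
      then show ?thesis using c2 \<eta> A by blast
    qed
    then show ?case using c2 by blast
  qed
qed

lemma composable:
  assumes "g \<in> topspace (germ_top \<Gamma>)" "h \<in> topspace (germ_top \<Gamma>)" "germ_src g = germ_rng h"
  obtains s t \<rho> \<omega> where "composite s t \<rho> \<omega>" "g = germ \<Gamma> s (bd_act t \<omega>)"
    "h = germ \<Gamma> t \<omega>" "germ_comp \<Gamma> g h = germ \<Gamma> \<rho> \<omega>"
proof -
  obtain s \<zeta> where g: "s \<in> S" "\<zeta> \<in> bd_dom s" "g = germ \<Gamma> s \<zeta>"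
    using assms(1) topspace_germ_iff by blast
  obtain t \<omega> where h: "t \<in> S" "\<omega> \<in> bd_dom t" "h = germ \<Gamma> t \<omega>"
    using assms(2) topspace_germ_iff by blast
  have \<zeta>: "\<zeta> = bd_act t \<omega>" using assms(3) g h by (simp add: germ_src germ_rng)
  have dom: "bd_act t \<omega> \<in> bd_dom s" using g(2) \<zeta> by simp
  obtain s' t' \<rho> where r: "composite s' t' \<rho> \<omega>"
    "germ \<Gamma> s' (bd_act t' \<omega>) = germ \<Gamma> s (bd_act t \<omega>)" "germ \<Gamma> t' \<omega> = germ \<Gamma> t \<omega>"
    by (rule composable_cases[OF g(1) h(1,2) dom])
  have "germ_comp \<Gamma> g h = germ \<Gamma> \<rho> \<omega>"
    using germ_comp_eq[OF r(1)] by (simp add: g(3) h(3) \<zeta> r(2,3))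
  then show thesis using r by (intro that[OF r(1)]) (simp_all add: g(3) h(3) \<zeta>)
qed

text \<open>Over a long common prefix \<open>s\<close> carries the images under \<open>t\<close> and
  \<open>t'\<close> of any extension to the same word. Since \<open>s\<close> is injective on words,
  \<open>t\<close> and \<open>t'\<close> agree there.\<close>

lemma germ_cancel_left:
  assumes "g \<in> topspace (germ_top \<Gamma>)" "h \<in> topspace (germ_top \<Gamma>)" "h' \<in> topspace (germ_top \<Gamma>)"
    "germ_src g = germ_rng h" "germ_src g = germ_rng h'" "germ_comp \<Gamma> g h = germ_comp \<Gamma> g h'"
  shows "h = h'"
proof -
  obtain s t \<rho> \<omega> where c: "composite s t \<rho> \<omega>"
    and g: "g = germ \<Gamma> s (bd_act t \<omega>)" and h: "h = germ \<Gamma> t \<omega>" and gh: "germ_comp \<Gamma> g h = germ \<Gamma> \<rho> \<omega>"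
    by (rule composable[OF assms(1,2,4)])
  note a = compositeD[OF c]
  obtain s' t' \<rho>' \<omega>' where c': "composite s' t' \<rho>' \<omega>'"
    and g': "g = germ \<Gamma> s' (bd_act t' \<omega>')" and h': "h' = germ \<Gamma> t' \<omega>'" and gh': "germ_comp \<Gamma> g h' = germ \<Gamma> \<rho>' \<omega>'"
    by (rule composable[OF assms(1,3,5)])
  note a' = compositeD[OF c']
  have "germ \<Gamma> \<rho> \<omega> = germ \<Gamma> \<rho>' \<omega>'" using assms(6) gh gh' by simp
  then obtain n1 where \<omega>': "\<omega>' = \<omega>" and n1: "agree \<rho> \<rho>' (prefix n1 \<omega>)"
    using germ_eq_iff[OF a(3) a'(3) comp_dom(1)[OF c] comp_dom(1)[OF c']] by blast
  note c' = c'[unfolded \<omega>'] and a' = a'[unfolded \<omega>']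
  obtain m where act: "bd_act t' \<omega> = bd_act t \<omega>" and m: "agree s s' (prefix m (bd_act t \<omega>))"
    using germ_eq_iff[OF a(1) a'(1) a(5) a'(5)] g g' \<omega>' by auto
  obtain N where N: "\<And>n. n \<ge> N \<Longrightarrow> \<exists>q. pbij t (prefix n \<omega>) = Some q \<and> m \<le> length q"
    "\<And>n. n \<ge> N \<Longrightarrow> \<exists>r. pbij \<rho> (prefix n \<omega>) = Some r"
    using pbij_comp_dom[OF c, of m] by blast
  obtain N' where N': "\<And>n. n \<ge> N' \<Longrightarrow> \<exists>q. pbij t' (prefix n \<omega>) = Some q \<and> m \<le> length q"
    using pbij_prefix[OF a'(2,4)] by blast
  define n where "n = max n1 (max N N')"
  define p where "p = prefix n \<omega>"
  have n_ge: "n1 \<le> n" "N \<le> n" "N' \<le> n" by (simp_all add: n_def)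
  obtain q where q: "pbij t p = Some q" "m \<le> length q" using N(1)[OF n_ge(2)] by (auto simp: p_def)
  obtain q' where q': "pbij t' p = Some q'" "m \<le> length q'" using N'[OF n_ge(3)] by (auto simp: p_def)
  obtain r where r: "pbij \<rho> p = Some r" using N(2)[OF n_ge(2)] by (auto simp: p_def)
  have \<omega>p: "\<omega> \<in> cyl p" by (simp add: p_def cyl_prefix)
  have "bd_act t \<omega> \<in> cyl q'" using pbij_cyl(2)[OF a'(2) \<omega>p q'(1)] by (simp add: act)
  then have ag_q': "agree s s' q'" by (rule agree_cyl[OF m _ q'(2)])
  have ag_p: "agree \<rho> \<rho>' p" unfolding p_def by (rule agree_prefix[OF n1 n_ge(1)])
  obtain \<delta> where \<delta>: "\<And>x. pbij t (p @ x) = Some (q @ \<delta> x)" using pbij_extend[OF a(2) q(1)] by blast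
  obtain \<delta>' where \<delta>': "\<And>x. pbij t' (p @ x) = Some (q' @ \<delta>' x)" using pbij_extend[OF a'(2) q'(1)] by blast
  obtain \<delta>r where \<delta>r: "\<And>x. pbij \<rho> (p @ x) = Some (r @ \<delta>r x)" using pbij_extend[OF a(3) r] by blast
  have "pbij t (p @ x) = pbij t' (p @ x)" for x
  proof -
    have 1: "pbij s (q @ \<delta> x) = Some (r @ \<delta>r x)" using \<delta>r[of x] \<delta>[of x] by (simp add: a(6) map_comp_def)
    have "pbij s' (q' @ \<delta>' x) = pbij \<rho>' (p @ x)" using \<delta>'[of x] by (simp add: a'(6) map_comp_def)
    also have "\<dots> = Some (r @ \<delta>r x)" using ag_p \<delta>r[of x] by (simp add: agree_def)
    finally have 2: "pbij s (q' @ \<delta>' x) = Some (r @ \<delta>r x)" using ag_q' by (simp add: agree_def)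
    show ?thesis using pbij_inj[OF a(1) 1 2] \<delta>[of x] \<delta>'[of x] by simp
  qed
  then have "agree t t' (prefix n \<omega>)" by (simp add: agree_def p_def)
  then show ?thesis
    unfolding h h' \<omega>' using germ_eq_iff[OF a(2) a'(2) a(4) a'(4)] by blast
qed

text \<open>Elements of \<Gamma> are surjective on words, so the words \<open>q @ \<delta> x\<close>
  exhaust all extensions of \<open>q\<close>, and equality of the products below \<open>p\<close>
  becomes agreement of \<open>s\<close> and \<open>s'\<close> below \<open>q\<close>.\<close>

lemma germ_cancel_right:
  assumes "g \<in> topspace (germ_top \<Gamma>)" "g' \<in> topspace (germ_top \<Gamma>)" "h \<in> topspace (germ_top \<Gamma>)"
    "germ_src g = germ_rng h" "germ_src g' = germ_rng h" "germ_comp \<Gamma> g h = germ_comp \<Gamma> g' h"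
  shows "g = g'"
proof -
  obtain s t \<rho> \<omega> where c: "composite s t \<rho> \<omega>"
    and g: "g = germ \<Gamma> s (bd_act t \<omega>)" and h: "h = germ \<Gamma> t \<omega>" and gh: "germ_comp \<Gamma> g h = germ \<Gamma> \<rho> \<omega>"
    by (rule composable[OF assms(1,3,4)])
  note a = compositeD[OF c]
  obtain s' t' \<rho>' \<omega>' where c': "composite s' t' \<rho>' \<omega>'"
    and g': "g' = germ \<Gamma> s' (bd_act t' \<omega>')" and h': "h = germ \<Gamma> t' \<omega>'" and gh': "germ_comp \<Gamma> g' h = germ \<Gamma> \<rho>' \<omega>'"
    by (rule composable[OF assms(2,3,5)])
  note a' = compositeD[OF c']
  obtain m where \<omega>': "\<omega>' = \<omega>" and m: "agree t t' (prefix m \<omega>)"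
    using germ_eq_iff[OF a(2) a'(2) a(4) a'(4)] h h' by auto
  note c' = c'[unfolded \<omega>'] and a' = a'[unfolded \<omega>']
  have act: "bd_act t' \<omega> = bd_act t \<omega>" using agree_bd_act[OF a(2) a'(2) a(4) m] by simp
  have "germ \<Gamma> \<rho> \<omega> = germ \<Gamma> \<rho>' \<omega>" using assms(6) gh gh' \<omega>' by simp
  then obtain n1 where n1: "agree \<rho> \<rho>' (prefix n1 \<omega>)"
    using germ_eq_iff[OF a(3) a'(3) comp_dom(1)[OF c] comp_dom(1)[OF c']] by blast
  obtain N where N: "\<And>n. n \<ge> N \<Longrightarrow> \<exists>q. pbij t (prefix n \<omega>) = Some q \<and> 0 \<le> length q"
    using pbij_prefix[OF a(2,4)] by blast
  define n where "n = max n1 (max N m)"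
  define p where "p = prefix n \<omega>"
  have n_ge: "n1 \<le> n" "N \<le> n" "m \<le> n" by (simp_all add: n_def)
  obtain q where q: "pbij t p = Some q" using N[OF n_ge(2)] by (auto simp: p_def)
  have "bd_act t \<omega> \<in> cyl q" by (rule pbij_cyl(2)[OF a(2) _ q]) (simp add: p_def cyl_prefix)
  then have q_prefix: "prefix (length q) (bd_act t \<omega>) = q" by (simp add: cyl_def)
  have ag_t: "agree t t' p" unfolding p_def by (rule agree_prefix[OF m n_ge(3)])
  have ag_\<rho>: "agree \<rho> \<rho>' p" unfolding p_def by (rule agree_prefix[OF n1 n_ge(1)])
  obtain \<delta> where \<delta>: "\<delta> \<in> \<Gamma>" "\<And>x. pbij t (p @ x) = Some (q @ \<delta> x)" using pbij_extend[OF a(2) q] by blast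
  have "pbij s (q @ y) = pbij s' (q @ y)" for y
  proof -
    obtain x where x: "y = \<delta> x" using \<Gamma>_bij[OF \<delta>(1)] by (meson bij_pointE)
    have "pbij t' (p @ x) = Some (q @ y)" using ag_t \<delta>(2)[of x] by (simp add: agree_def x)
    then have "pbij \<rho>' (p @ x) = pbij s' (q @ y)" by (simp add: a'(6) map_comp_def)
    moreover have "pbij \<rho> (p @ x) = pbij s (q @ y)" using \<delta>(2)[of x] by (simp add: a(6) map_comp_def x)
    ultimately show ?thesis using ag_\<rho> by (simp add: agree_def)
  qed
  then have "agree s s' (prefix (length q) (bd_act t \<omega>))" by (simp add: agree_def q_prefix)
  then show ?thesis
    unfolding g g' \<omega>' act using germ_eq_iff[OF a(1) a'(1) a(5)] a'(5) by (auto simp: act)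
qed

lemma id_triple: "([], id, []) \<in> S" "\<omega> \<in> bd_dom ([], id, [])" "bd_act ([], id, []) \<omega> = \<omega>"
  by (simp_all add: triples_iff \<Gamma>_id bd_dom_cyl cyl_def bd_act.simps bd_map_def nth_append)

lemma continuous_germ_src: "continuous_map (germ_top \<Gamma>) word_space germ_src"
  unfolding continuous_map_def
proof (intro conjI allI impI)
  show "germ_src \<in> topspace (germ_top \<Gamma>) \<rightarrow> topspace word_space" by (simp add: topspace_word_space)
  fix W :: "'a word set" assume W: "openin word_space W"
  have "{g \<in> topspace (germ_top \<Gamma>). germ_src g \<in> W} = (\<Union>s\<in>S. germ \<Gamma> s ` (W \<inter> bd_dom s))"
    by (auto simp: topspace_germ_iff germ_src)
  also have "openin (germ_top \<Gamma>) \<dots>"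
    using W openin_bd_dom by (auto intro!: openin_Union openin_germ_image openin_Int)
  finally show "openin (germ_top \<Gamma>) {g \<in> topspace (germ_top \<Gamma>). germ_src g \<in> W}" .
qed

lemma open_germ_src: "open_map (germ_top \<Gamma>) word_space germ_src"
  unfolding open_map_def
proof (intro allI impI)
  fix V assume V: "openin (germ_top \<Gamma>) V"
  show "openin word_space (germ_src ` V)"
  proof (subst openin_subopen, intro ballI)
    fix \<omega> assume "\<omega> \<in> germ_src ` V"
    then obtain g where g: "g \<in> V" "\<omega> = germ_src g" by blast
    then have "g \<in> topspace (germ_top \<Gamma>)" using openin_subset[OF V] by blast
    then obtain s \<omega>' where s': "s \<in> S" "\<omega>' \<in> bd_dom s" "g = germ \<Gamma> s \<omega>'"
      using topspace_germ_iff by blast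
    have "\<omega>' = \<omega>" by (simp add: g(2) s'(3) germ_src[OF s'(1,2)])
    note s = s'[unfolded this]
    obtain n where n: "cyl (prefix n \<omega>) \<subseteq> bd_dom s" "germ \<Gamma> s ` cyl (prefix n \<omega>) \<subseteq> V"
      using germ_nbhd[OF V s(1,2)] g(1) unfolding s(3) by blast
    have "cyl (prefix n \<omega>) \<subseteq> germ_src ` V"
    proof
      fix \<eta> assume \<eta>: "\<eta> \<in> cyl (prefix n \<omega>)"
      then have "germ_src (germ \<Gamma> s \<eta>) = \<eta>" using n(1) by (intro germ_src[OF s(1)]) blast
      moreover have "germ \<Gamma> s \<eta> \<in> V" using n(2) \<eta> by blast
      ultimately show "\<eta> \<in> germ_src ` V" by (rule image_eqI[OF sym])
    qed
    then show "\<exists>T. openin word_space T \<and> \<omega> \<in> T \<and> T \<subseteq> germ_src ` V"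
      using openin_cyl[of "prefix n \<omega>"] cyl_prefix[of \<omega> n] by blast
  qed
qed

abbreviation G where "G \<equiv> attached_groupoid \<Gamma>"

lemma G_simps: "arr G = germ_top \<Gamma>" "base G = word_space" "src G = germ_src" "rng G = germ_rng"
  "idn G \<omega> = germ \<Gamma> ([], id, []) \<omega>" "comp G = germ_comp \<Gamma>"
  by (simp_all add: attached_groupoid_def)

sublocale ample_groupoid G
proof (unfold_locales, unfold G_simps)
  fix V and x :: "'a word" assume V: "openin word_space V" "x \<in> V"
  obtain n where "cyl (prefix n x) \<subseteq> V" by (rule openin_word_cyl[OF V])
  then show "\<exists>W. openin word_space W \<and> compactin word_space W \<and> x \<in> W \<and> W \<subseteq> V"
    using openin_cyl[of "prefix n x"] compactin_cyl[of "prefix n x"] cyl_prefix[of x n] by blast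
next
  fix g assume "g \<in> topspace (germ_top \<Gamma>)"
  then obtain s \<omega> where g: "s \<in> S" "\<omega> \<in> bd_dom s" "g = germ \<Gamma> s \<omega>" using topspace_germ_iff by blast
  have "germ_comp \<Gamma> (germ \<Gamma> s (bd_act ([], id, []) \<omega>)) (germ \<Gamma> ([], id, []) \<omega>) = germ \<Gamma> s \<omega>"
  proof (rule germ_comp_eq)
    have "pbij ([], id, []) x = Some x" for x :: "'a list" using pbij_append[of "[]" id "[]" x] by simp
    then have "pbij s = pbij s \<circ>\<^sub>m pbij ([], id, [])" by (simp add: map_comp_def)
    then show "composite s ([], id, []) s \<omega>" by (simp add: composite_def g id_triple)
  qed
  then show "germ_comp \<Gamma> g (germ \<Gamma> ([], id, []) (germ_src g)) = g"
    using g by (simp add: id_triple(3) germ_src)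
next
  fix g h assume *: "g \<in> topspace (germ_top \<Gamma>)" "h \<in> topspace (germ_top \<Gamma>)" "germ_src g = germ_rng h"
  obtain s t \<rho> \<omega> where c: "composite s t \<rho> \<omega>"
    and g: "g = germ \<Gamma> s (bd_act t \<omega>)" and h: "h = germ \<Gamma> t \<omega>" and gh: "germ_comp \<Gamma> g h = germ \<Gamma> \<rho> \<omega>"
    by (rule composable[OF *])
  note a = compositeD[OF c]
  note dom = comp_dom[OF c]
  show "germ_comp \<Gamma> g h \<in> topspace (germ_top \<Gamma>)" using gh germ_in_topspace[OF a(3) dom(1)] by simp
  show "germ_src (germ_comp \<Gamma> g h) = germ_src h"
    unfolding gh unfolding h germ_src[OF a(3) dom(1)] germ_src[OF a(2,4)] ..
  show "germ_rng (germ_comp \<Gamma> g h) = germ_rng g"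
    unfolding gh unfolding g germ_rng[OF a(3) dom(1)] germ_rng[OF a(1,5)] by (rule dom(2))
qed (use continuous_germ_src open_germ_src Hausdorff_word_space germ_cancel_left germ_cancel_right
  in \<open>auto simp: topspace_word_space germ_in_topspace germ_src germ_rng id_triple\<close>)

section \<open>Bisections of the attached groupoid\<close>

definition bis :: "'a list \<Rightarrow> ('a list \<Rightarrow> 'a list) \<Rightarrow> 'a list \<Rightarrow> 'a germ set" where
  "bis u \<gamma> v = germ \<Gamma> (u, \<gamma>, v) ` cyl v"

lemma germ_triple_src: "\<gamma> \<in> \<Gamma> \<Longrightarrow> \<omega> \<in> cyl v \<Longrightarrow> germ_src (germ \<Gamma> (u, \<gamma>, v) \<omega>) = \<omega>"
  by (rule germ_src) (simp_all add: triples_iff bd_dom_cyl)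

lemma germ_triple_arr: "\<gamma> \<in> \<Gamma> \<Longrightarrow> \<omega> \<in> cyl v \<Longrightarrow> germ \<Gamma> (u, \<gamma>, v) \<omega> \<in> topspace (arr G)"
  unfolding G_simps by (rule germ_in_topspace) (simp_all add: triples_iff bd_dom_cyl)

lemma open_bisection_bis:
  assumes "\<gamma> \<in> \<Gamma>"
  shows "open_bisection G (bis u \<gamma> v)"
proof -
  have t: "(u, \<gamma>, v) \<in> S" using assms by (simp add: triples_iff)
  have "openin (germ_top \<Gamma>) (bis u \<gamma> v)"
    unfolding bis_def by (rule openin_germ_image[OF t openin_cyl]) (simp add: bd_dom_cyl)
  moreover have "inj_on germ_src (bis u \<gamma> v)"
    unfolding bis_def using assms by (auto simp: inj_on_def germ_triple_src)
  moreover have "inj_on germ_rng (bis u \<gamma> v)"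
  proof (rule inj_onI)
    fix g h assume "g \<in> bis u \<gamma> v" "h \<in> bis u \<gamma> v" and eq: "germ_rng g = germ_rng h"
    then obtain \<omega> \<omega>' where g: "\<omega> \<in> bd_dom (u, \<gamma>, v)" "g = germ \<Gamma> (u, \<gamma>, v) \<omega>"
      and h: "\<omega>' \<in> bd_dom (u, \<gamma>, v)" "h = germ \<Gamma> (u, \<gamma>, v) \<omega>'"
      unfolding bis_def bd_dom_cyl by blast
    have "bd_act (u, \<gamma>, v) \<omega> = bd_act (u, \<gamma>, v) \<omega>'"
      using eq unfolding g(2) h(2) germ_rng[OF t g(1)] germ_rng[OF t h(1)] .
    then have "\<omega> = \<omega>'" by (rule bd_act_inj[OF t g(1) h(1)])
    then show "g = h" by (simp add: g(2) h(2))
  qed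
  ultimately show ?thesis by (simp add: open_bisection_def G_simps)
qed

lemma src_bis: "\<gamma> \<in> \<Gamma> \<Longrightarrow> src G ` bis u \<gamma> v = cyl v"
  by (simp add: G_simps bis_def image_image germ_triple_src)

lemma compactin_bis:
  assumes "\<gamma> \<in> \<Gamma>"
  shows "compactin (arr G) (bis u \<gamma> v)"
proof -
  have "compactin (arr G) (restr G (bis u \<gamma> v) (cyl v))"
    by (rule compactin_restr[OF open_bisection_bis[OF assms]])
       (simp_all add: src_bis[OF assms] compactin_cyl G_simps(2))
  moreover have "restr G (bis u \<gamma> v) (cyl v) = bis u \<gamma> v"
    using src_bis[OF assms, of u v] by (auto simp: restr_def)
  ultimately show ?thesis by simp
qed

lemma germ_mem_bis:
  assumes "\<gamma> \<in> \<Gamma>" "\<delta> \<in> \<Gamma>" "\<omega> \<in> cyl v"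
  shows "germ \<Gamma> (u, \<gamma>, v) \<omega> \<in> bis u \<delta> v \<longleftrightarrow> germ \<Gamma> (u, \<delta>, v) \<omega> = germ \<Gamma> (u, \<gamma>, v) \<omega>"
proof
  assume "germ \<Gamma> (u, \<gamma>, v) \<omega> \<in> bis u \<delta> v"
  then obtain \<eta> where \<eta>: "\<eta> \<in> cyl v" "germ \<Gamma> (u, \<gamma>, v) \<omega> = germ \<Gamma> (u, \<delta>, v) \<eta>"
    unfolding bis_def by blast
  have "\<eta> = \<omega>"
    using arg_cong[OF \<eta>(2), of germ_src] by (simp add: germ_triple_src assms \<eta>(1))
  then show "germ \<Gamma> (u, \<delta>, v) \<omega> = germ \<Gamma> (u, \<gamma>, v) \<omega>" using \<eta>(2) by simp
next
  assume "germ \<Gamma> (u, \<delta>, v) \<omega> = germ \<Gamma> (u, \<gamma>, v) \<omega>"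
  then show "germ \<Gamma> (u, \<gamma>, v) \<omega> \<in> bis u \<delta> v" using assms(3) unfolding bis_def by (metis image_eqI)
qed

text \<open>Tree automorphisms preserve length, so in
  \<open>u @ \<gamma> z = u' @ \<delta> z\<close> the first parts have equal length and coincide.
  Over a fixed source word \<open>v\<close>, germs with different target words never meet, which
  lets local coefficients be chosen separately for each \<open>u\<close>.\<close>

lemma germ_eq_same_range:
  assumes "\<gamma> \<in> \<Gamma>" "\<delta> \<in> \<Gamma>" "\<omega> \<in> cyl v" "germ \<Gamma> (u, \<gamma>, v) \<omega> = germ \<Gamma> (u', \<delta>, v) \<omega>"
  shows "u = u'"
proof -
  have t: "(u, \<gamma>, v) \<in> S" "(u', \<delta>, v) \<in> S" "\<omega> \<in> bd_dom (u, \<gamma>, v)" "\<omega> \<in> bd_dom (u', \<delta>, v)"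
    using assms by (simp_all add: triples_iff bd_dom_cyl)
  then obtain n where n: "agree (u, \<gamma>, v) (u', \<delta>, v) (prefix n \<omega>)"
    using germ_eq_iff[OF t] assms(4) by blast
  obtain z where z: "prefix (max n (length v)) \<omega> = v @ z"
    using cyl_prefix_le[OF assms(3), of "max n (length v)"] max.cobounded2 by blast
  have "agree (u, \<gamma>, v) (u', \<delta>, v) (v @ z)"
    unfolding z[symmetric] by (rule agree_prefix[OF n]) simp
  then have "pbij (u, \<gamma>, v) ((v @ z) @ []) = pbij (u', \<delta>, v) ((v @ z) @ [])" unfolding agree_def by blast
  then have "u @ \<gamma> z = u' @ \<delta> z" by (simp add: pbij_append)
  moreover have "length (\<gamma> z) = length (\<delta> z)" using \<Gamma>_length assms(1,2) by simp
  ultimately show ?thesis by simp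
qed

text \<open>Agreement of the two translated triples below \<open>v @ p\<close> is agreement of
  \<gamma> and \<delta> below \<open>p\<close>. So the pattern of equal germs does not change with
  \<open>u\<close> and \<open>v\<close>, and bounds obtained on the whole boundary hold inside every
  cylinder.\<close>

lemma germ_eq_shift:
  assumes "\<gamma> \<in> \<Gamma>" "\<delta> \<in> \<Gamma>"
  shows "germ \<Gamma> (u, \<gamma>, v) (v \<frown> \<eta>) = germ \<Gamma> (u, \<delta>, v) (v \<frown> \<eta>) \<longleftrightarrow>
    germ \<Gamma> ([], \<gamma>, []) \<eta> = germ \<Gamma> ([], \<delta>, []) \<eta>"
proof -
  have dom: "v \<frown> \<eta> \<in> cyl v" "\<eta> \<in> cyl []" by (auto simp: cyl_iff)
  have t: "(u, \<gamma>, v) \<in> S" "([], \<gamma>, []) \<in> S" "(u, \<delta>, v) \<in> S" "([], \<delta>, []) \<in> S"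
    using assms by (simp_all add: triples_iff)
  have "agree (u, \<gamma>, v) (u, \<delta>, v) (v @ p) \<longleftrightarrow> agree ([], \<gamma>, []) ([], \<delta>, []) p" for p
    using pbij_append[of u \<gamma> v "p @ _"] pbij_append[of u \<delta> v "p @ _"]
      pbij_append[of "[]" \<gamma> "[]" "p @ _"] pbij_append[of "[]" \<delta> "[]" "p @ _"]
    by (simp add: agree_def)
  moreover have "prefix (length v + n) (v \<frown> \<eta>) = v @ prefix n \<eta>" for n by simp
  ultimately have *: "agree (u, \<gamma>, v) (u, \<delta>, v) (prefix (length v + n) (v \<frown> \<eta>)) \<longleftrightarrow>
      agree ([], \<gamma>, []) ([], \<delta>, []) (prefix n \<eta>)" for n by simp
  have "(\<exists>n. agree (u, \<gamma>, v) (u, \<delta>, v) (prefix n (v \<frown> \<eta>))) \<longleftrightarrow>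
      (\<exists>n. agree ([], \<gamma>, []) ([], \<delta>, []) (prefix n \<eta>))"
  proof
    assume "\<exists>n. agree (u, \<gamma>, v) (u, \<delta>, v) (prefix n (v \<frown> \<eta>))"
    then obtain n where "agree (u, \<gamma>, v) (u, \<delta>, v) (prefix n (v \<frown> \<eta>))" by blast
    then have "agree (u, \<gamma>, v) (u, \<delta>, v) (prefix (length v + n) (v \<frown> \<eta>))" by (rule agree_prefix) simp
    then show "\<exists>n. agree ([], \<gamma>, []) ([], \<delta>, []) (prefix n \<eta>)" using * by blast
  next
    assume "\<exists>n. agree ([], \<gamma>, []) ([], \<delta>, []) (prefix n \<eta>)"
    then show "\<exists>n. agree (u, \<gamma>, v) (u, \<delta>, v) (prefix n (v \<frown> \<eta>))" using * by blast
  qed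
  then show ?thesis
    using dom by (simp add: germ_eq_iff[OF t(1,3)] germ_eq_iff[OF t(2,4)] bd_dom_cyl)
qed

end

section \<open>Contracting groups\<close>

locale contracting_group = self_similar_group \<Gamma> for \<Gamma> :: "('a :: finite list \<Rightarrow> 'a list) set" +
  fixes N :: "('a list \<Rightarrow> 'a list) set"
  assumes finite_N: "finite N" and N_subset: "N \<subseteq> \<Gamma>"
    and absorbing: "\<gamma> \<in> \<Gamma> \<Longrightarrow> \<exists>l. \<forall>u. l \<le> length u \<longrightarrow> sect \<gamma> u \<in> N"
begin

lemma N_\<Gamma>: "\<gamma> \<in> N \<Longrightarrow> \<gamma> \<in> \<Gamma>"
  using N_subset by blast

text \<open>The section of a group element at a long word lies in \<open>N\<close>, so restriction
  to a long prefix brings \<open>s\<close> into the stated form. Validity for all large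
  \<open>n\<close> permits one prefix to serve here and in an approximation at the same
  time.\<close>

lemma germ_normal_form:
  assumes s: "s \<in> S" and \<omega>: "\<omega> \<in> bd_dom s"
  obtains n0 where "\<And>n. n0 \<le> n \<Longrightarrow> \<exists>u. \<exists>\<gamma>\<in>N. \<forall>\<zeta>\<in>cyl (prefix n \<omega>).
    \<zeta> \<in> bd_dom s \<and> germ \<Gamma> (u, \<gamma>, prefix n \<omega>) \<zeta> = germ \<Gamma> s \<zeta>"
proof -
  obtain u \<gamma> v where s': "s = (u, \<gamma>, v)" "\<gamma> \<in> \<Gamma>" using s by (auto simp: triples_def)
  obtain l where l: "\<And>z. l \<le> length z \<Longrightarrow> sect \<gamma> z \<in> N" using absorbing[OF s'(2)] by blast
  have "\<exists>u. \<exists>\<gamma>\<in>N. \<forall>\<zeta>\<in>cyl (prefix n \<omega>).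
      \<zeta> \<in> bd_dom s \<and> germ \<Gamma> (u, \<gamma>, prefix n \<omega>) \<zeta> = germ \<Gamma> s \<zeta>" if n: "length v + l \<le> n" for n
  proof -
    have "\<omega> \<in> cyl v" "length v \<le> n" using \<omega> n by (simp_all add: s'(1) bd_dom_cyl)
    then obtain z where z: "prefix n \<omega> = v @ z" by (rule cyl_prefix_le)
    have "length (prefix n \<omega>) = n" by simp
    then have "l \<le> length z" using n unfolding z by simp
    then have N: "sect \<gamma> z \<in> N" by (rule l)
    have p: "pbij s (prefix n \<omega>) = Some (u @ \<gamma> z)" unfolding z s'(1) by (rule pbij_append)
    have r: "rst s (prefix n \<omega>) = (u @ \<gamma> z, sect \<gamma> z, prefix n \<omega>)"
      unfolding z s'(1) rst_def by simp
    have "\<forall>\<zeta>\<in>cyl (prefix n \<omega>). \<zeta> \<in> bd_dom s \<and> germ \<Gamma> (u @ \<gamma> z, sect \<gamma> z, prefix n \<omega>) \<zeta> = germ \<Gamma> s \<zeta>"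
      using rst(5)[OF s p] pbij_cyl(1)[OF s _ p] unfolding r by blast
    then show ?thesis using N by blast
  qed
  then show thesis by (rule that)
qed

section \<open>Classes of elements of \<open>N\<close> with equal germs, and duality\<close>

definition germ_class :: "('a list \<Rightarrow> 'a list) \<Rightarrow> 'a word \<Rightarrow> ('a list \<Rightarrow> 'a list) set" where
  "germ_class \<gamma> \<eta> = {\<delta> \<in> N. germ \<Gamma> ([], \<delta>, []) \<eta> = germ \<Gamma> ([], \<gamma>, []) \<eta>}"

lemma germ_class_shift:
  assumes "\<gamma> \<in> N"
  shows "{\<delta> \<in> N. germ \<Gamma> (u, \<delta>, v) (v \<frown> \<eta>) = germ \<Gamma> (u, \<gamma>, v) (v \<frown> \<eta>)} = germ_class \<gamma> \<eta>"
  unfolding germ_class_def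
  by (intro Collect_cong conj_cong refl germ_eq_shift N_\<Gamma> assms)

text \<open>The subset \<open>M\<close> is fixed over \<open>W\<close>, while its representative
  \<gamma> may vary with \<eta>. Such classes occur at units outside any set with empty interior, so
  singular elements control their coefficient sums.\<close>

definition generic :: "('a list \<Rightarrow> 'a list) set set" where
  "generic = {M. \<exists>W. openin word_space W \<and> W \<noteq> {} \<and> (\<forall>\<eta>\<in>W. \<exists>\<gamma>\<in>N. M = germ_class \<gamma> \<eta>)}"

lemma generic_subset: "M \<in> generic \<Longrightarrow> M \<subseteq> N"
  by (auto simp: generic_def germ_class_def)

definition comb :: "(('a list \<Rightarrow> 'a list) \<Rightarrow> complex) \<Rightarrow> 'a germ \<Rightarrow> complex" where
  "comb c g = (\<Sum>\<gamma>\<in>N. c \<gamma> * indicator (bis [] \<gamma> []) g)"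

lemma comb_germ:
  assumes "\<gamma> \<in> N"
  shows "comb c (germ \<Gamma> ([], \<gamma>, []) \<eta>) = (\<Sum>\<delta>\<in>germ_class \<gamma> \<eta>. c \<delta>)"
proof -
  have \<eta>: "\<eta> \<in> cyl []" by (auto simp: cyl_iff)
  show ?thesis
    unfolding comb_def using finite_N germ_mem_bis[OF N_\<Gamma>[OF assms] N_\<Gamma> \<eta>, of _ "[]"]
    by (intro sum.mono_neutral_cong_right) (auto simp: germ_class_def indicator_def)
qed

text \<open>If the support contained an open set, the coincidences of the bisections of
  \<open>N\<close> would be constant over some open set of units below it. The class of a fixed
  \<gamma> would then be constant there, hence generic, and the value of \<open>comb c\<close> is
  the sum of \<open>c\<close> over that class, which is 0.\<close>

lemma comb_alg_sing:
  assumes c: "\<And>M. M \<in> generic \<Longrightarrow> (\<Sum>\<delta>\<in>M. c \<delta>) = 0"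
  shows "comb c \<in> alg_sing_ideal G"
proof -
  let ?B = "\<lambda>\<gamma>. bis [] \<gamma> []"
  have "comb c \<in> steinberg G"
    unfolding comb_def
    by (intro steinberg_combination steinberg_indicator open_bisection_bis compactin_bis N_\<Gamma>)
  moreover have "arr G interior_of (supp_open G (comb c)) = {}"
  proof (rule ccontr)
    assume "\<not> ?thesis"
    then obtain V where V: "openin (arr G) V" "V \<noteq> {}" "V \<subseteq> supp_open G (comb c)"
      by (auto simp: interior_of_def)
    have fin: "finite (?B ` N)" using finite_N by simp
    have opn: "openin (arr G) U" if "U \<in> ?B ` N" for U
      using that open_bisection_bis N_\<Gamma> by (auto simp: open_bisection_def)
    have src_V: "openin (base G) (src G ` V)" "src G ` V \<noteq> {}"
      using V(1,2) by (simp_all add: openin_src_image)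
    obtain W y where W: "openin (base G) W" "y \<in> W" "W \<subseteq> src G ` V"
      "\<forall>x\<in>W. coincidence (?B ` N) x = coincidence (?B ` N) y"
      using coincidence_locally_constant[OF fin opn src_V] by blast
    obtain g where g: "g \<in> V" "src G g = y" using W(2,3) by blast
    then have "comb c g \<noteq> 0" using V(3) by (auto simp: supp_open_def)
    then obtain \<gamma> where \<gamma>: "\<gamma> \<in> N" "g \<in> ?B \<gamma>"
      unfolding comb_def by (metis (no_types, lifting) indicator_simps(2) mult_zero_right sum.neutral)
    have nil: "\<eta> \<in> cyl []" for \<eta> :: "'a word" by (auto simp: cyl_iff)
    obtain y' where y': "g = germ \<Gamma> ([], \<gamma>, []) y'" using \<gamma>(2) unfolding bis_def by blast
    then have "y' = y" using g(2) germ_triple_src[OF N_\<Gamma>[OF \<gamma>(1)] nil, of "[]" y'] by (simp add: G_simps)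
    \<comment> \<open>Translates the pattern of bisections into classes of equal germs, so that
      constancy of the former gives constancy of the latter.\<close>
    have coinc: "(?B \<gamma>, ?B \<delta>) \<in> coincidence (?B ` N) \<eta> \<longleftrightarrow> \<delta> \<in> germ_class \<gamma> \<eta>" if \<delta>: "\<delta> \<in> N" for \<delta> \<eta>
    proof -
      have "\<eta> \<in> src G ` (?B \<gamma> \<inter> ?B \<delta>) \<longleftrightarrow> germ \<Gamma> ([], \<gamma>, []) \<eta> \<in> ?B \<delta>"
      proof
        assume "\<eta> \<in> src G ` (?B \<gamma> \<inter> ?B \<delta>)"
        then obtain \<zeta> where "\<eta> = germ_src (germ \<Gamma> ([], \<gamma>, []) \<zeta>)" "germ \<Gamma> ([], \<gamma>, []) \<zeta> \<in> ?B \<delta>"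
          unfolding G_simps bis_def by blast
        then show "germ \<Gamma> ([], \<gamma>, []) \<eta> \<in> ?B \<delta>"
          using germ_triple_src[OF N_\<Gamma>[OF \<gamma>(1)] nil, of "[]" \<zeta>] by simp
      next
        assume "germ \<Gamma> ([], \<gamma>, []) \<eta> \<in> ?B \<delta>"
        moreover have "germ \<Gamma> ([], \<gamma>, []) \<eta> \<in> ?B \<gamma>" using nil by (simp add: bis_def)
        moreover have "src G (germ \<Gamma> ([], \<gamma>, []) \<eta>) = \<eta>"
          unfolding G_simps by (rule germ_triple_src[OF N_\<Gamma>[OF \<gamma>(1)] nil])
        ultimately show "\<eta> \<in> src G ` (?B \<gamma> \<inter> ?B \<delta>)" by (metis IntI image_eqI)
      qed
      then show ?thesis
        using \<gamma>(1) \<delta> germ_mem_bis[OF N_\<Gamma>[OF \<gamma>(1)] N_\<Gamma>[OF \<delta>] nil, of "[]" \<eta>]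
        by (simp add: coincidence_def germ_class_def)
    qed
    have "germ_class \<gamma> y = germ_class \<gamma> \<eta>" if "\<eta> \<in> W" for \<eta>
    proof -
      have "\<delta> \<in> germ_class \<gamma> y \<longleftrightarrow> \<delta> \<in> germ_class \<gamma> \<eta>" if "\<delta> \<in> N" for \<delta>
        using coinc[OF that, of y] coinc[OF that, of \<eta>] bspec[OF W(4) \<open>\<eta> \<in> W\<close>] by simp
      then show ?thesis by (auto simp: germ_class_def)
    qed
    then have "germ_class \<gamma> y \<in> generic"
      using W(1,2) \<gamma>(1) unfolding generic_def G_simps by blast
    then have "comb c g = 0" using c comb_germ[OF \<gamma>(1), of c y] y' \<open>y' = y\<close> by simp
    then show False using \<open>comb c g \<noteq> 0\<close> by simp
  qed
  ultimately show ?thesis by (simp add: alg_sing_ideal_def)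
qed

lemma sum_ind: "M \<subseteq> N \<Longrightarrow> (\<Sum>i\<in>N. c i * indicator M i) = (\<Sum>i\<in>M. c i :: complex)"
  using finite_N by (intro sum.mono_neutral_cong_right) (auto simp: indicator_def)

text \<open>Otherwise some coefficient vector \<open>c\<close> would annihilate every generic class
  but not this one; \<open>comb c\<close> would then lie in J_C and be nonzero at the germ of
  \<gamma> at \<eta>.\<close>

lemma class_in_span:
  assumes J: "alg_sing_ideal G = {0}" and \<gamma>: "\<gamma> \<in> N"
  shows "indicator (germ_class \<gamma> \<eta>) \<in> module.span (\<lambda>(c :: complex) f i. c * f i) (indicator ` generic)"
proof (rule ccontr)
  let ?v = "indicator (germ_class \<gamma> \<eta>) :: _ \<Rightarrow> complex"
  assume "\<not> ?thesis"
  then have "\<exists>c. (\<forall>w\<in>indicator ` generic. (\<Sum>i\<in>N. c i * w i) = 0) \<and> (\<Sum>i\<in>N. c i * ?v i) \<noteq> 0"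
  proof (rule span_separation[OF finite_N])
    fix w i assume "w \<in> insert ?v (indicator ` generic)" "i \<notin> N"
    then show "w i = 0" by (auto simp: indicator_def germ_class_def dest: generic_subset[THEN subsetD])
  qed
  then obtain c where c: "\<And>M. M \<in> generic \<Longrightarrow> (\<Sum>i\<in>N. c i * indicator M i) = 0"
    and v: "(\<Sum>i\<in>N. c i * ?v i) \<noteq> 0" by blast
  have "comb c \<in> alg_sing_ideal G"
    by (rule comb_alg_sing) (use c sum_ind[OF generic_subset] in metis)
  then have "comb c (germ \<Gamma> ([], \<gamma>, []) \<eta>) = 0" using J by simp
  moreover have "germ_class \<gamma> \<eta> \<subseteq> N" by (auto simp: germ_class_def)
  ultimately show False using v sum_ind[of "germ_class \<gamma> \<eta>" c] comb_germ[OF \<gamma>] by simp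
qed

text \<open>The constant is uniform because there are only finitely many subsets of \<open>N\<close>.\<close>

lemma class_sum_bound:
  assumes J: "alg_sing_ideal G = {0}"
  obtains K where "0 \<le> K" "\<And>c t \<gamma> \<eta>. \<gamma> \<in> N \<Longrightarrow> 0 \<le> t \<Longrightarrow>
    (\<And>M. M \<in> generic \<Longrightarrow> cmod (\<Sum>\<delta>\<in>M. c \<delta>) \<le> t) \<Longrightarrow> cmod (\<Sum>\<delta>\<in>germ_class \<gamma> \<eta>. c \<delta>) \<le> K * t"
proof -
  \<comment> \<open>This property is stable under linear combinations, with constants
    \<open>K + L\<close> and \<open>cmod a * K\<close>, and a generic class has constant 1.
    Membership in the span therefore yields a constant that does not depend on the coefficients
    \<open>c\<close>.\<close>
  define bd where "bd v K \<longleftrightarrow> 0 \<le> K \<and> (\<forall>c t. (\<forall>M\<in>generic. cmod (\<Sum>\<delta>\<in>M. c \<delta>) \<le> t) \<longrightarrow>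
      cmod (\<Sum>\<delta>\<in>N. c \<delta> * v \<delta>) \<le> K * t)" for v and K :: real
  have ex: "\<exists>K. bd v K" if "v \<in> module.span (\<lambda>(c :: complex) f i. c * f i) (indicator ` generic)" for v
    using that
  proof (induction rule: span_fun_induct)
    case zero
    have "bd 0 0" by (simp add: bd_def)
    then show ?case by blast
  next
    case (base v)
    then obtain M where M: "M \<in> generic" "v = indicator M" by blast
    have "bd v 1" unfolding bd_def M(2) sum_ind[OF generic_subset[OF M(1)]] using M(1) by simp
    then show ?case by blast
  next
    case (add v w)
    then obtain K L where K: "bd v K" and L: "bd w L" by blast
    have "bd (v + w) (K + L)"
      unfolding bd_def
    proof (intro conjI allI impI)
      show "0 \<le> K + L" using K L by (simp add: bd_def)
      fix c t assume t: "\<forall>M\<in>generic. cmod (\<Sum>\<delta>\<in>M. c \<delta>) \<le> t"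
      have "cmod (\<Sum>\<delta>\<in>N. c \<delta> * (v + w) \<delta>) \<le> cmod (\<Sum>\<delta>\<in>N. c \<delta> * v \<delta>) + cmod (\<Sum>\<delta>\<in>N. c \<delta> * w \<delta>)"
        by (simp add: distrib_left sum.distrib norm_triangle_ineq)
      also have "\<dots> \<le> K * t + L * t" using K L t unfolding bd_def by (intro add_mono) blast+
      finally show "cmod (\<Sum>\<delta>\<in>N. c \<delta> * (v + w) \<delta>) \<le> (K + L) * t" by (simp add: distrib_right)
    qed
    then show ?case by blast
  next
    case (scale a v)
    then obtain K where K: "bd v K" by blast
    have "bd (\<lambda>i. a * v i) (cmod a * K)"
      unfolding bd_def
    proof (intro conjI allI impI)
      show "0 \<le> cmod a * K" using K by (simp add: bd_def)
      fix c t assume t: "\<forall>M\<in>generic. cmod (\<Sum>\<delta>\<in>M. c \<delta>) \<le> t"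
      have "(\<Sum>\<delta>\<in>N. c \<delta> * (a * v \<delta>)) = a * (\<Sum>\<delta>\<in>N. c \<delta> * v \<delta>)"
        by (simp add: sum_distrib_left mult_ac)
      then have "cmod (\<Sum>\<delta>\<in>N. c \<delta> * (a * v \<delta>)) = cmod a * cmod (\<Sum>\<delta>\<in>N. c \<delta> * v \<delta>)"
        by (simp only: norm_mult)
      also have "\<dots> \<le> cmod a * (K * t)"
        using K t unfolding bd_def by (intro mult_left_mono) auto
      finally show "cmod (\<Sum>\<delta>\<in>N. c \<delta> * (a * v \<delta>)) \<le> cmod a * K * t" by (simp add: mult.assoc)
    qed
    then show ?case by blast
  qed
  define Q where "Q = {germ_class \<gamma> \<eta> | \<gamma> \<eta>. \<gamma> \<in> N}"
  have QN: "Q \<subseteq> Pow N" by (auto simp: Q_def germ_class_def)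
  then have finQ: "finite Q" using finite_N finite_subset by blast
  have "\<forall>M\<in>Q. \<exists>K. bd (indicator M) K" using class_in_span[OF J] ex unfolding Q_def by blast
  from bchoice[OF this] obtain k where k: "\<And>M. M \<in> Q \<Longrightarrow> bd (indicator M) (k M)" by blast
  have k_nonneg: "0 \<le> k M" if "M \<in> Q" for M using k[OF that] by (simp add: bd_def)
  show thesis
  \<comment> \<open>All constants are nonnegative, so their sum over the finite set of classes
    dominates each of them.\<close>
  proof (rule that[of "\<Sum>M\<in>Q. k M"])
    show "0 \<le> (\<Sum>M\<in>Q. k M)" using k_nonneg by (rule sum_nonneg)
    fix c t \<gamma> \<eta>
    assume \<gamma>: "\<gamma> \<in> N" and t: "0 \<le> t" "\<And>M. M \<in> generic \<Longrightarrow> cmod (\<Sum>\<delta>\<in>M. c \<delta>) \<le> t"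
    have M: "germ_class \<gamma> \<eta> \<in> Q" using \<gamma> by (auto simp: Q_def)
    have "cmod (\<Sum>\<delta>\<in>N. c \<delta> * indicator (germ_class \<gamma> \<eta>) \<delta>) \<le> k (germ_class \<gamma> \<eta>) * t"
      using k[OF M] t(2) unfolding bd_def by blast
    also have "\<dots> \<le> (\<Sum>M\<in>Q. k M) * t"
      using finQ M k_nonneg t(1) by (intro mult_right_mono member_le_sum) auto
    finally show "cmod (\<Sum>\<delta>\<in>germ_class \<gamma> \<eta>. c \<delta>) \<le> (\<Sum>M\<in>Q. k M) * t"
      using sum_ind[of "germ_class \<gamma> \<eta>" c] M QN by auto
  qed
qed

section \<open>Local approximation of convolution functions and the vanishing of J\<close>

text \<open>The inner sum is the value at the germ of a translate of a combination of elements of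
  \<open>N\<close>. The coefficients may depend on \<open>u\<close>, but not on \<gamma> or on the
  point \<zeta>: one vector \<open>c\<close> describes the function at generic and non-generic units
  alike, which is what transfers bounds between them.\<close>

definition approx :: "('a germ \<Rightarrow> complex) \<Rightarrow> 'a list \<Rightarrow> real \<Rightarrow> bool" where
  "approx \<phi> v \<epsilon> \<longleftrightarrow> (\<forall>u. \<exists>c. \<forall>\<gamma>\<in>N. \<forall>\<zeta>\<in>cyl v.
     cmod (\<phi> (germ \<Gamma> (u, \<gamma>, v) \<zeta>) -
       (\<Sum>\<delta>\<in>{\<delta> \<in> N. germ \<Gamma> (u, \<delta>, v) \<zeta> = germ \<Gamma> (u, \<gamma>, v) \<zeta>}. c \<delta>)) \<le> \<epsilon>)"

text \<open>The closure in \<open>U\<close> of the support is compact, so its source image is closed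
  and avoids \<omega>, even if \<omega> is a limit of sources of \<open>U\<close>. Over a cylinder
  around \<omega> the function is 0, and all coefficients are taken to be 0.\<close>

lemma Cc_on_approx_off:
  assumes U: "open_bisection G U" and f: "f \<in> Cc_on G U" and \<omega>: "\<omega> \<notin> src G ` U" and "0 < \<epsilon>"
  shows "\<exists>n0. \<forall>n\<ge>n0. approx f (prefix n \<omega>) \<epsilon>"
proof -
  define K where "K = (subtopology (arr G) U) closure_of {g \<in> U. f g \<noteq> 0}"
  have "compactin (subtopology (arr G) U) K" and out: "\<And>g. g \<notin> U \<Longrightarrow> f g = 0"
    using f by (auto simp: Cc_on_def K_def)
  then have K: "compactin (arr G) K" "K \<subseteq> U" by (simp_all add: compactin_subtopology)
  have "{g \<in> U. f g \<noteq> 0} \<subseteq> K"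
    unfolding K_def using open_bisection_subset[OF U] by (intro closure_of_subset) auto
  then have zero: "f g = 0" if "g \<notin> K" for g using that out by blast
  have "openin word_space (UNIV - src G ` K)"
    using closedin_src_compact[OF K(1)] by (simp add: G_simps closedin_def topspace_word_space)
  moreover have "\<omega> \<in> UNIV - src G ` K" using \<omega> K(2) by blast
  ultimately obtain n0 where n0: "cyl (prefix n0 \<omega>) \<subseteq> UNIV - src G ` K" by (rule openin_word_cyl)
  have "approx f (prefix n \<omega>) \<epsilon>" if "n0 \<le> n" for n
    unfolding approx_def
  proof (intro allI exI[of _ "\<lambda>_. 0"] ballI)
    fix u \<gamma> \<zeta> assume \<gamma>: "\<gamma> \<in> N" and \<zeta>: "\<zeta> \<in> cyl (prefix n \<omega>)"
    have "\<zeta> \<notin> src G ` K" using cyl_prefix_mono[OF that] n0 \<zeta> by blast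
    moreover have "src G (germ \<Gamma> (u, \<gamma>, prefix n \<omega>) \<zeta>) = \<zeta>"
      unfolding G_simps by (rule germ_triple_src[OF N_\<Gamma>[OF \<gamma>] \<zeta>])
    ultimately have "germ \<Gamma> (u, \<gamma>, prefix n \<omega>) \<zeta> \<notin> K" by (metis image_eqI)
    then show "cmod (f (germ \<Gamma> (u, \<gamma>, prefix n \<omega>) \<zeta>) - (\<Sum>\<delta>\<in>{\<delta> \<in> N.
        germ \<Gamma> (u, \<delta>, prefix n \<omega>) \<zeta> = germ \<Gamma> (u, \<gamma>, prefix n \<omega>) \<zeta>}. 0)) \<le> \<epsilon>"
      using zero \<open>0 < \<epsilon>\<close> by simp
  qed
  then show ?thesis by blast
qed

text \<open>Near \<open>g\<close> the bisection has a normal form with an element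
  \<open>\<gamma>'\<close> of \<open>N\<close>, and by continuity \<open>f\<close> stays within
  \<epsilon> of \<open>f g\<close> along this slice. Every point of \<open>U\<close> over the small
  cylinder lies on the slice, so a single coefficient suffices.\<close>

lemma Cc_on_approx_at:
  assumes U: "open_bisection G U" and f: "f \<in> Cc_on G U" and g: "g \<in> U" "src G g = \<omega>" and "0 < \<epsilon>"
  shows "\<exists>n0. \<forall>n\<ge>n0. approx f (prefix n \<omega>) \<epsilon>"
proof -
  have cont: "continuous_map (subtopology (arr G) U) euclidean f" and out: "\<And>g. g \<notin> U \<Longrightarrow> f g = 0"
    using f by (auto simp: Cc_on_def)
  have openU: "openin (arr G) U" using U by (simp add: open_bisection_def)
  obtain s \<omega>' where s': "s \<in> S" "\<omega>' \<in> bd_dom s" "g = germ \<Gamma> s \<omega>'"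
    using open_bisection_subset[OF U] g(1) topspace_germ_iff unfolding G_simps by blast
  have "\<omega>' = \<omega>" using g(2) by (simp add: G_simps s'(3) germ_src[OF s'(1,2)])
  note s = s'[unfolded this]
  define V where "V = {h \<in> U. f h \<in> ball (f g) \<epsilon>}"
  have "openin (subtopology (arr G) U) {h \<in> topspace (subtopology (arr G) U). f h \<in> ball (f g) \<epsilon>}"
    by (rule openin_continuous_map_preimage[OF cont]) (simp add: open_openin[symmetric])
  moreover have "{h \<in> topspace (subtopology (arr G) U). f h \<in> ball (f g) \<epsilon>} = V"
    using open_bisection_subset[OF U] by (auto simp: V_def)
  ultimately have "openin (arr G) V" using openin_trans_full openU by metis
  then have V: "openin (germ_top \<Gamma>) V" by (simp add: G_simps)
  have "germ \<Gamma> s \<omega> \<in> V" using g(1) \<open>0 < \<epsilon>\<close> by (simp add: V_def s(3)[symmetric])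
  then obtain n1 where n1: "germ \<Gamma> s ` cyl (prefix n1 \<omega>) \<subseteq> V" using germ_nbhd[OF V s(1,2)] by blast
  obtain n2 where n2: "\<And>n. n2 \<le> n \<Longrightarrow> \<exists>u. \<exists>\<gamma>\<in>N. \<forall>\<zeta>\<in>cyl (prefix n \<omega>).
      \<zeta> \<in> bd_dom s \<and> germ \<Gamma> (u, \<gamma>, prefix n \<omega>) \<zeta> = germ \<Gamma> s \<zeta>"
    using germ_normal_form[OF s(1,2)] by blast
  have "approx f (prefix n \<omega>) \<epsilon>" if n: "max n1 n2 \<le> n" for n
    unfolding approx_def
  proof
    fix u
    let ?v = "prefix n \<omega>"
    obtain u' \<gamma>' where \<gamma>': "\<gamma>' \<in> N"
      and norm: "\<And>\<zeta>. \<zeta> \<in> cyl ?v \<Longrightarrow> \<zeta> \<in> bd_dom s \<and> germ \<Gamma> (u', \<gamma>', ?v) \<zeta> = germ \<Gamma> s \<zeta>"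
      using n2[of n] n by auto
    have inV: "germ \<Gamma> s \<zeta> \<in> V" if "\<zeta> \<in> cyl ?v" for \<zeta>
      using n1 cyl_prefix_mono[of n1 n \<omega>] n that by auto
    \<comment> \<open>For \<open>u\<close> different from \<open>u'\<close> no germ in question lies
      in \<open>U\<close>, by \<open>germ_eq_same_range\<close>, so the coefficients are 0. For
      \<open>u = u'\<close> the value \<open>f g\<close> is placed on \<open>\<gamma>'\<close>
      alone; other elements with the same germ receive it through the class sum.\<close>
    define c where "c \<delta> = (if u = u' \<and> \<delta> = \<gamma>' then f g else 0)" for \<delta>
    show "\<exists>c. \<forall>\<gamma>\<in>N. \<forall>\<zeta>\<in>cyl ?v. cmod (f (germ \<Gamma> (u, \<gamma>, ?v) \<zeta>) -
       (\<Sum>\<delta>\<in>{\<delta> \<in> N. germ \<Gamma> (u, \<delta>, ?v) \<zeta> = germ \<Gamma> (u, \<gamma>, ?v) \<zeta>}. c \<delta>)) \<le> \<epsilon>"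
    proof (intro exI[of _ c] ballI)
      fix \<gamma> \<zeta> assume \<gamma>: "\<gamma> \<in> N" and \<zeta>: "\<zeta> \<in> cyl ?v"
      let ?h = "germ \<Gamma> (u, \<gamma>, ?v) \<zeta>" and ?D = "{\<delta> \<in> N. germ \<Gamma> (u, \<delta>, ?v) \<zeta> = germ \<Gamma> (u, \<gamma>, ?v) \<zeta>}"
      have finD: "finite ?D" using finite_N by simp
      show "cmod (f ?h - (\<Sum>\<delta>\<in>?D. c \<delta>)) \<le> \<epsilon>"
      proof (cases "?h \<in> U")
        case True
        have "src G ?h = src G (germ \<Gamma> s \<zeta>)"
          unfolding G_simps germ_triple_src[OF N_\<Gamma>[OF \<gamma>] \<zeta>]
          using norm[OF \<zeta>] germ_src[OF s(1), of \<zeta>] by simp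
        moreover have "germ \<Gamma> s \<zeta> \<in> U" using inV[OF \<zeta>] by (simp add: V_def)
        ultimately have h: "?h = germ \<Gamma> s \<zeta>" using open_bisection_inj[OF U True] by blast
        then have eq: "germ \<Gamma> (u, \<gamma>, ?v) \<zeta> = germ \<Gamma> (u', \<gamma>', ?v) \<zeta>" using norm[OF \<zeta>] by simp
        then have u: "u = u'" by (rule germ_eq_same_range[OF N_\<Gamma>[OF \<gamma>] N_\<Gamma>[OF \<gamma>'] \<zeta>])
        then have "\<gamma>' \<in> ?D" using \<gamma>' eq by simp
        then have "(\<Sum>\<delta>\<in>?D. c \<delta>) = f g" using finD u by (simp add: c_def)
        moreover have "f ?h \<in> ball (f g) \<epsilon>" using inV[OF \<zeta>] unfolding h V_def by simp
        ultimately show ?thesis by (simp add: dist_norm norm_minus_commute)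
      next
        case False
        have "c \<delta> = 0" if "\<delta> \<in> ?D" for \<delta>
        proof (rule ccontr)
          assume "c \<delta> \<noteq> 0"
          then have "u = u'" "\<delta> = \<gamma>'" by (auto simp: c_def split: if_splits)
          then have "?h = germ \<Gamma> s \<zeta>" using that norm[OF \<zeta>] by simp
          then show False using inV[OF \<zeta>] False by (simp add: V_def)
        qed
        then show ?thesis using out[OF False] \<open>0 < \<epsilon>\<close> by simp
      qed
    qed
  qed
  then show ?thesis by blast
qed

lemma Cc_approx:
  assumes "\<phi> \<in> Cc G" "0 < \<epsilon>"
  shows "\<exists>n0. \<forall>n\<ge>n0. approx \<phi> (prefix n \<omega>) \<epsilon>"
  using assms unfolding Cc_def
proof (induction arbitrary: \<epsilon> rule: span_fun_induct)
  case zero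
  then show ?case unfolding approx_def by (intro exI[of _ "0 :: nat"] allI impI exI[of _ "\<lambda>_. 0"]) simp
next
  case (base f)
  then obtain U where U: "open_bisection G U" "f \<in> Cc_on G U" by blast
  show ?case
  proof (cases "\<omega> \<in> src G ` U")
    case True
    then obtain g where "g \<in> U" "src G g = \<omega>" by blast
    then show ?thesis using Cc_on_approx_at[OF U _ _ base.prems] by blast
  next
    case False
    then show ?thesis by (rule Cc_on_approx_off[OF U _ base.prems])
  qed
next
  case (add f f')
  obtain n1 where n1: "\<And>n. n1 \<le> n \<Longrightarrow> approx f (prefix n \<omega>) (\<epsilon> / 2)" using add.IH(1)[of "\<epsilon> / 2"] add.prems by auto
  obtain n2 where n2: "\<And>n. n2 \<le> n \<Longrightarrow> approx f' (prefix n \<omega>) (\<epsilon> / 2)" using add.IH(2)[of "\<epsilon> / 2"] add.prems by auto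
  have "approx (f + f') v \<epsilon>" if a: "approx f v (\<epsilon> / 2)" "approx f' v (\<epsilon> / 2)" for v
    unfolding approx_def
  proof
    fix u
    let ?D = "\<lambda>\<gamma> \<zeta>. {\<delta> \<in> N. germ \<Gamma> (u, \<delta>, v) \<zeta> = germ \<Gamma> (u, \<gamma>, v) \<zeta>}"
    obtain c where c: "\<And>\<gamma> \<zeta>. \<gamma> \<in> N \<Longrightarrow> \<zeta> \<in> cyl v \<Longrightarrow>
        cmod (f (germ \<Gamma> (u, \<gamma>, v) \<zeta>) - (\<Sum>\<delta>\<in>?D \<gamma> \<zeta>. c \<delta>)) \<le> \<epsilon> / 2"
      using a(1) unfolding approx_def by blast
    obtain c' where c': "\<And>\<gamma> \<zeta>. \<gamma> \<in> N \<Longrightarrow> \<zeta> \<in> cyl v \<Longrightarrow>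
        cmod (f' (germ \<Gamma> (u, \<gamma>, v) \<zeta>) - (\<Sum>\<delta>\<in>?D \<gamma> \<zeta>. c' \<delta>)) \<le> \<epsilon> / 2"
      using a(2) unfolding approx_def by blast
    have "cmod ((f + f') (germ \<Gamma> (u, \<gamma>, v) \<zeta>) - (\<Sum>\<delta>\<in>?D \<gamma> \<zeta>. c \<delta> + c' \<delta>)) \<le> \<epsilon>"
      if "\<gamma> \<in> N" "\<zeta> \<in> cyl v" for \<gamma> \<zeta>
      using norm_triangle_mono[OF c[OF that] c'[OF that]] by (simp add: sum.distrib algebra_simps)
    then show "\<exists>c. \<forall>\<gamma>\<in>N. \<forall>\<zeta>\<in>cyl v. cmod ((f + f') (germ \<Gamma> (u, \<gamma>, v) \<zeta>) - (\<Sum>\<delta>\<in>?D \<gamma> \<zeta>. c \<delta>)) \<le> \<epsilon>"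
      by (intro exI[of _ "\<lambda>\<delta>. c \<delta> + c' \<delta>"]) blast
  qed
  then have "approx (f + f') (prefix n \<omega>) \<epsilon>" if "max n1 n2 \<le> n" for n
    using n1[of n] n2[of n] that by simp
  then show ?case by blast
next
  case (scale a f)
  \<comment> \<open>Adding 1 keeps the denominator positive when \<open>a = 0\<close>.\<close>
  have pos: "0 < \<epsilon> / (cmod a + 1)" using scale.prems by (simp add: add_nonneg_pos)
  then obtain n1 where n1: "\<And>n. n1 \<le> n \<Longrightarrow> approx f (prefix n \<omega>) (\<epsilon> / (cmod a + 1))" using scale.IH by blast
  have le: "cmod a * (\<epsilon> / (cmod a + 1)) \<le> \<epsilon>"
    using scale.prems by (simp add: divide_simps add_nonneg_pos mult_right_mono)
  have "approx (\<lambda>g. a * f g) v \<epsilon>" if a: "approx f v (\<epsilon> / (cmod a + 1))" for v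
    unfolding approx_def
  proof
    fix u
    let ?D = "\<lambda>\<gamma> \<zeta>. {\<delta> \<in> N. germ \<Gamma> (u, \<delta>, v) \<zeta> = germ \<Gamma> (u, \<gamma>, v) \<zeta>}"
    obtain c where c: "\<And>\<gamma> \<zeta>. \<gamma> \<in> N \<Longrightarrow> \<zeta> \<in> cyl v \<Longrightarrow>
        cmod (f (germ \<Gamma> (u, \<gamma>, v) \<zeta>) - (\<Sum>\<delta>\<in>?D \<gamma> \<zeta>. c \<delta>)) \<le> \<epsilon> / (cmod a + 1)"
      using a unfolding approx_def by blast
    have "cmod (a * f (germ \<Gamma> (u, \<gamma>, v) \<zeta>) - (\<Sum>\<delta>\<in>?D \<gamma> \<zeta>. a * c \<delta>)) \<le> \<epsilon>"
      if "\<gamma> \<in> N" "\<zeta> \<in> cyl v" for \<gamma> \<zeta>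
    proof -
      have "cmod (a * f (germ \<Gamma> (u, \<gamma>, v) \<zeta>) - (\<Sum>\<delta>\<in>?D \<gamma> \<zeta>. a * c \<delta>)) =
          cmod a * cmod (f (germ \<Gamma> (u, \<gamma>, v) \<zeta>) - (\<Sum>\<delta>\<in>?D \<gamma> \<zeta>. c \<delta>))"
        by (simp add: norm_mult[symmetric] right_diff_distrib sum_distrib_left)
      also have "\<dots> \<le> cmod a * (\<epsilon> / (cmod a + 1))" by (intro mult_left_mono c that) simp
      finally show ?thesis using le by linarith
    qed
    then show "\<exists>c. \<forall>\<gamma>\<in>N. \<forall>\<zeta>\<in>cyl v. cmod (a * f (germ \<Gamma> (u, \<gamma>, v) \<zeta>) - (\<Sum>\<delta>\<in>?D \<gamma> \<zeta>. c \<delta>)) \<le> \<epsilon>"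
      by (intro exI[of _ "\<lambda>\<delta>. a * c \<delta>"]) blast
  qed
  then show ?case using n1 by blast
qed

lemma sing_fun_zero:
  assumes J: "alg_sing_ideal G = {0}" and F: "F \<in> sing_ideal G" and g: "g \<in> topspace (arr G)"
  shows "cstar_fun G F g = 0"
proof -
  define a where "a = cstar_fun G F"
  have Fst: "F \<in> Cstar_red G" and sing: "base G interior_of (src G ` supp_open G a) = {}"
    using F by (auto simp: sing_ideal_def a_def)
  obtain K where K: "0 \<le> K" "\<And>c t \<gamma> \<eta>. \<gamma> \<in> N \<Longrightarrow> 0 \<le> t \<Longrightarrow>
      (\<And>M. M \<in> generic \<Longrightarrow> cmod (\<Sum>\<delta>\<in>M. c \<delta>) \<le> t) \<Longrightarrow> cmod (\<Sum>\<delta>\<in>germ_class \<gamma> \<eta>. c \<delta>) \<le> K * t"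
    using class_sum_bound[OF J] by blast
  obtain s \<omega> where s: "s \<in> S" "\<omega> \<in> bd_dom s" "g = germ \<Gamma> s \<omega>"
    using g topspace_germ_iff unfolding G_simps by blast
  \<comment> \<open>Replacing values of \<open>a\<close> below \<open>v\<close> by coefficient sums
    costs 2\<epsilon>: \<epsilon> for passing to \<phi> and \<epsilon> for its local form. Generic
    sums are thus at most 2\<epsilon>, the sum at \<open>g\<close> at most 2K\<epsilon>, and the
    comparison at \<open>g\<close> adds 2\<epsilon>. The constant \<open>K\<close> is fixed before
    \<epsilon>.\<close>
  have bound: "cmod (a g) \<le> (2 + 2 * K) * \<epsilon>" if \<epsilon>: "0 < \<epsilon>" for \<epsilon>
  proof -
    obtain \<phi> where \<phi>: "\<phi> \<in> Cc G" "\<And>g. g \<in> topspace (arr G) \<Longrightarrow> cmod (a g - \<phi> g) \<le> \<epsilon>"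
      unfolding a_def using cstar_fun_approx[OF Fst \<epsilon>] by blast
    obtain n1 where n1: "\<And>n. n1 \<le> n \<Longrightarrow> approx \<phi> (prefix n \<omega>) \<epsilon>" using Cc_approx[OF \<phi>(1) \<epsilon>] by blast
    obtain n2 where n2: "\<And>n. n2 \<le> n \<Longrightarrow> \<exists>u. \<exists>\<gamma>\<in>N. \<forall>\<zeta>\<in>cyl (prefix n \<omega>).
        \<zeta> \<in> bd_dom s \<and> germ \<Gamma> (u, \<gamma>, prefix n \<omega>) \<zeta> = germ \<Gamma> s \<zeta>"
      using germ_normal_form[OF s(1,2)] by blast
    define v where "v = prefix (max n1 n2) \<omega>"
    have ap: "approx \<phi> v \<epsilon>" unfolding v_def by (rule n1) simp
    obtain u \<gamma> where \<gamma>: "\<gamma> \<in> N" and norm: "\<forall>\<zeta>\<in>cyl v. germ \<Gamma> (u, \<gamma>, v) \<zeta> = germ \<Gamma> s \<zeta>"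
      unfolding v_def using n2[of "max n1 n2"] by auto
    obtain \<eta>0 where \<omega>: "\<omega> = v \<frown> \<eta>0" using prefix_suffix[of \<omega> "max n1 n2"] unfolding v_def by blast
    have shift: "v \<frown> \<eta> \<in> cyl v" for \<eta> by (auto simp: cyl_iff)
    have g_eq: "g = germ \<Gamma> (u, \<gamma>, v) (v \<frown> \<eta>0)" using norm shift s(3) \<omega> by simp
    obtain c where "\<forall>\<gamma>\<in>N. \<forall>\<zeta>\<in>cyl v. cmod (\<phi> (germ \<Gamma> (u, \<gamma>, v) \<zeta>) -
        (\<Sum>\<delta>\<in>{\<delta> \<in> N. germ \<Gamma> (u, \<delta>, v) \<zeta> = germ \<Gamma> (u, \<gamma>, v) \<zeta>}. c \<delta>)) \<le> \<epsilon>"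
      using ap unfolding approx_def by blast
    from bspec[OF bspec[OF this] shift]
    have c: "cmod (\<phi> (germ \<Gamma> (u, \<gamma>, v) (v \<frown> \<eta>)) - (\<Sum>\<delta>\<in>germ_class \<gamma> \<eta>. c \<delta>)) \<le> \<epsilon>"
      if "\<gamma> \<in> N" for \<gamma> \<eta>
      using that unfolding germ_class_shift[OF that, symmetric, of \<eta> u v] .
    have c_a: "cmod (a (germ \<Gamma> (u, \<gamma>, v) (v \<frown> \<eta>)) - (\<Sum>\<delta>\<in>germ_class \<gamma> \<eta>. c \<delta>)) \<le> 2 * \<epsilon>"
      if "\<gamma> \<in> N" for \<gamma> \<eta>
    proof -
      have "germ \<Gamma> (u, \<gamma>, v) (v \<frown> \<eta>) \<in> topspace (arr G)" by (rule germ_triple_arr[OF N_\<Gamma>[OF that] shift])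
      from norm_triangle_mono[OF \<phi>(2)[OF this] c[OF that, of \<eta>]] show ?thesis by simp
    qed
    \<comment> \<open>The class \<open>M\<close> is realised at all \<eta> in some cylinder.
      Translated by \<open>v\<close>, this cylinder is not filled by sources of the support of
      \<open>a\<close>, so \<open>a\<close> vanishes on the whole fibre over one of its
      points.\<close>
    have "cmod (\<Sum>\<delta>\<in>M. c \<delta>) \<le> 2 * \<epsilon>" if M: "M \<in> generic" for M
    proof -
      obtain W \<eta>1 where W: "openin word_space W" "\<eta>1 \<in> W" "\<And>\<eta>. \<eta> \<in> W \<Longrightarrow> \<exists>\<gamma>\<in>N. M = germ_class \<gamma> \<eta>"
        using M unfolding generic_def by blast
      obtain k where k: "cyl (prefix k \<eta>1) \<subseteq> W" by (rule openin_word_cyl[OF W(1,2)])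
      have "\<not> cyl (v @ prefix k \<eta>1) \<subseteq> src G ` supp_open G a"
      proof
        assume sub: "cyl (v @ prefix k \<eta>1) \<subseteq> src G ` supp_open G a"
        have "openin (base G) (cyl (v @ prefix k \<eta>1))" by (simp add: G_simps openin_cyl)
        from interior_of_maximal[OF sub this] have "cyl (v @ prefix k \<eta>1) = {}" using sing by simp
        moreover have "v \<frown> \<eta>1 \<in> cyl (v @ prefix k \<eta>1)"
          using prefix_suffix[of \<eta>1 k] by (metis conc_conc cyl_iff)
        ultimately show False by blast
      qed
      then obtain \<zeta> where \<zeta>: "\<zeta> \<in> cyl (v @ prefix k \<eta>1)" "\<zeta> \<notin> src G ` supp_open G a" by blast
      then obtain \<xi> where \<xi>: "\<zeta> = v \<frown> prefix k \<eta>1 \<frown> \<xi>" by (auto simp: cyl_iff)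
      define \<eta> where "\<eta> = prefix k \<eta>1 \<frown> \<xi>"
      have \<zeta>_eq: "\<zeta> = v \<frown> \<eta>" by (simp add: \<xi> \<eta>_def)
      have "\<eta> \<in> cyl (prefix k \<eta>1)" unfolding \<eta>_def cyl_iff by blast
      then have "\<eta> \<in> W" using k by blast
      \<comment> \<open>The representative is chosen only after the point is found; whichever it is,
        its class at \<eta> is \<open>M\<close>.\<close>
      then obtain \<gamma>' where \<gamma>': "\<gamma>' \<in> N" "M = germ_class \<gamma>' \<eta>" using W(3) by blast
      let ?h = "germ \<Gamma> (u, \<gamma>', v) (v \<frown> \<eta>)"
      have h: "?h \<in> topspace (arr G)" by (rule germ_triple_arr[OF N_\<Gamma>[OF \<gamma>'(1)] shift])
      have "src G ?h = \<zeta>" unfolding G_simps \<zeta>_eq by (rule germ_triple_src[OF N_\<Gamma>[OF \<gamma>'(1)] shift])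
      then have "?h \<notin> supp_open G a" using \<zeta>(2) by blast
      then have "a ?h = 0" using h by (simp add: supp_open_def)
      then show ?thesis using c_a[OF \<gamma>'(1), of \<eta>] by (simp add: \<gamma>'(2))
    qed
    then have "cmod (\<Sum>\<delta>\<in>germ_class \<gamma> \<eta>0. c \<delta>) \<le> K * (2 * \<epsilon>)"
      using \<epsilon> by (intro K(2)[OF \<gamma>]) auto
    moreover have "cmod (a g - (\<Sum>\<delta>\<in>germ_class \<gamma> \<eta>0. c \<delta>)) \<le> 2 * \<epsilon>"
      unfolding g_eq by (rule c_a[OF \<gamma>])
    ultimately have "cmod (a g) \<le> 2 * \<epsilon> + K * (2 * \<epsilon>)"
      using norm_triangle_sub[of "a g" "\<Sum>\<delta>\<in>germ_class \<gamma> \<eta>0. c \<delta>"] by linarith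
    then show ?thesis by (simp add: algebra_simps)
  qed
  have "cmod (a g) \<le> 0"
  proof (rule field_le_epsilon)
    fix e :: real assume "0 < e"
    then have "cmod (a g) \<le> (2 + 2 * K) * (e / (2 + 2 * K))" using K(1) by (intro bound) simp
    then show "cmod (a g) \<le> 0 + e" using K(1) by simp
  qed
  then show ?thesis by (simp add: a_def)
qed

lemma sing_zero_if_alg_sing_zero:
  assumes "alg_sing_ideal G = {0}"
  shows "sing_ideal G = {cstar_zero G}"
proof -
  have "F = cstar_zero G" if "F \<in> sing_ideal G" for F
    using sing_fun_zero[OF assms that] that by (intro cstar_zeroI) (auto simp: sing_ideal_def)
  then show ?thesis using cstar_zero_sing by blast
qed

end

theorem corollary7p14:
  fixes \<Gamma> :: "('a::finite list \<Rightarrow> 'a list) set"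
  assumes "self_similar \<Gamma>" and "contracting \<Gamma>"
  shows "(sing_ideal (attached_groupoid \<Gamma>) = {cstar_zero (attached_groupoid \<Gamma>)} \<longleftrightarrow>
            alg_sing_ideal (attached_groupoid \<Gamma>) = {0}) \<and>
         (alg_sing_ideal (attached_groupoid \<Gamma>) = {0} \<longleftrightarrow> \<not> cond_S0 (attached_groupoid \<Gamma>))"
proof -
  obtain N where N: "N \<subseteq> \<Gamma>" "finite N" "\<forall>\<gamma>\<in>\<Gamma>. \<exists>l. \<forall>u. length u \<ge> l \<longrightarrow> sect \<gamma> u \<in> N"
    using assms(2) unfolding contracting_def by blast
  interpret contracting_group \<Gamma> N
    by unfold_locales (use assms(1) N in auto)
  show ?thesis
  proof (intro conjI iffI)
    show "sing_ideal (attached_groupoid \<Gamma>) = {cstar_zero (attached_groupoid \<Gamma>)}"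
      if "alg_sing_ideal (attached_groupoid \<Gamma>) = {0}"
      using that by (rule sing_zero_if_alg_sing_zero)
    show "alg_sing_ideal (attached_groupoid \<Gamma>) = {0}"
      if "sing_ideal (attached_groupoid \<Gamma>) = {cstar_zero (attached_groupoid \<Gamma>)}"
      using that by (rule alg_sing_zero_if_sing_zero)
  qed (simp_all add: alg_sing_zero_iff)
qed

end
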